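(* Let $\mathcal Q$ be compact, suppose the experiments form a continuous Blackwell chain in inverse information (as defined in the context), and assume that for some $\bar\delta>0$ the intervals $[v_\star(q),v_\star(q)+\bar\delta]$, $q\in\mathcal Q$, lie in a common compact subset of $(0,\infty)$. Assume the Differentiated Gaussian Transfer and Smooth-Target Transfer assumptions of the context uniformly over all contexts and all inverse-information levels in these intervals. Suppose $A_k\to0$ as $k\to\infty$, and that the infimum defining $A_k$ is attained or approached with relative error $o(1)$. For any $k_n\to\infty$ such that $A_{k_n}>0$, let $H_n$ satisfy \[ H_n\to\infty,\qquad \frac{H_n^{11}}{\sqrt n}\to0,\qquad H_n^{10}A_{k_n}\to0 . \] If $\eta_{0,n}(H)\le CH^5n^{-1/2}+CH^2e^{-cH^2}$ and $\eta_{1,n}(H)\le CH^7n^{-1/2}+CH^4e^{-cH^2}$ uniformly (for some constants $C,c>0$), then \[ F_{n,k_n}(H_n)=A_{k_n}\{1+o(1)\}. \] No additional restriction relating sample size $n$ and menu size $k_n$ is required. The conditions on $H_n$ can always be met; one explicit choice is $H_n=\min\{A_{k_n}^{-1/20},n^{1/44}\}$.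
   Context: Gaussian reference: $Y=h+\sqrt v\,Z$, $Z\sim N(0,1)$, $|h|\le H$; for a prior $\pi$ on $[-H,H]$, $r^G_v(\pi)$ is the Bayes risk for $h$ under squared error, $w^G_v(Y)$ the posterior variance, $\mathbb E^G$ the expectation with $h\sim\pi$. Menus and chain. $\mathcal Q$ is the context space, $\mathcal A$ the action space, $\theta_0$ an interior parameter value. In context $q$, action $a$ yields the experiment $\mathcal E_q(v(q,a))$ (parameter $\theta$ near $\theta_0$), where $v(q,a)\in(0,\infty]$ is the inverse of the one-observation Fisher information at $\theta_0$; $v_\star(q)$ is the level of the oracle (best) action. Continuous Blackwell chain: $v_\star(q)\le v(q,a)$ for all $a$; $\mathcal E_q(v_1)\succeq_B\mathcal E_q(v_2)$ whenever $v_1\le v_2$ (i.e. $\mathcal E_q(v_2)$ is the image of $\mathcal E_q(v_1)$ under a Markov kernel not depending on the parameter); and an experiment $\mathcal E_q(v)$ is available at every intermediate inverse-information level in a fixed neighborhood of $v_\star(q)$. For a finite menu $V\subset\mathcal A$, $v_V(q)=\min_{a\in V}v(q,a)$. Local risks. The local experiment in context $q$ at level $v$ with sample size $n$ consists of $n$ independent observations from $\mathcal E_q(v)$ at $\theta=\theta_0+h/\sqrt n$, $|h|\le H$. The target is $\psi_q(\theta)$; $b(q)=\dot\psi_q(\theta_0)$, $\psi_{q,n}(h)=\sqrt n\{\psi_q(\theta_0+h/\sqrt n)-\psi_q(\theta_0)\}$, and $\mathcal R^\psi_{n,H}(q,v)=\inf_T\sup_{|h|\le H}\mathbb E_{n,q,v,h}\{T-\psi_{q,n}(h)\}^2$.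 For a prior $\pi$ on $[-H,H]$, $r^h_{n,v}(\pi)$ (also written $r^E_{n,v}(\pi)$) and $r^\psi_{n,v}(\pi)$ are the squared-error Bayes risks for the targets $h$ and $\psi_{q,n}(h)$; $R^E_{n,H}(v)$ is the minimax risk for $h$ (dependence on $q$ suppressed). Frontiers: $A_k=\inf_{1\le|V|\le k}\sup_{q\in\mathcal Q}b(q)^2\{v_V(q)-v_\star(q)\}$ and $F_{n,k}(H)=\inf_{1\le|V|\le k}\sup_{q\in\mathcal Q}\{\mathcal R^\psi_{n,H}(q,v_V(q))-\mathcal R^\psi_{n,H}(q,v_\star(q))\}$, infima over menus $V\subset\mathcal A$. Differentiated Gaussian Transfer (uniform over levels $v$ in the relevant compact set, all priors $\pi$ on $[-H,H]$, and $H=H_n$): (1) $R^E_{n,H}(v)=\sup_\pi r^E_{n,v}(\pi)$ with an attaining least-favorable prior; (2) every Bayes risk is differentiable in $v$ and $0\le\partial_vr^E_{n,v}(\pi)\le C_{\mathcal K}H^4$; (3) there are deterministic $\eta_{0,n}(H),\eta_{1,n}(H)$ with $|r^E_{n,v}(\pi)-r^G_v(\pi)|\le\eta_{0,n}(H)$ and $|\partial_vr^E_{n,v}(\pi)-\mathbb E^G[(w^G_v(Y)/v)^2]|\le\eta_{1,n}(H)$. Smooth-Target Transfer (uniform over contexts, priors and relevant levels): $0<b_0\le|b(q)|\le b_1<\infty$; the second derivatives of $\psi_q$ are uniformly bounded; for every stated $n,H,q,v$, $\mathcal R^\psi_{n,H}(q,v)=\sup_{\pi}r^\psi_{n,v}(\pi)$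 over priors on $[-H,H]$, with the supremum attained; and \[|r^\psi_{n,v}(\pi)-b(q)^2r^h_{n,v}(\pi)|\le C\{H^3n^{-1/2}+H^4n^{-1}\},\] \[\{|b(q)|-CHn^{-1/2}\}_+^2\,\partial_vr^h_{n,v}(\pi)\le\partial_vr^\psi_{n,v}(\pi)\le\{|b(q)|+CHn^{-1/2}\}^2\,\partial_vr^h_{n,v}(\pi).\] *)

theory Defs
  imports "HOL-Probability.Probability"
begin

definition priors :: "real \<Rightarrow> real measure set" where
  "priors H = space (prob_algebra (restrict_space borel {-H..H}))"

text \<open>All members of an experiment \<open>P\<close> carry the same sigma-algebra, so that of \<open>P 0\<close> serves as
  the sample space on which estimators \<open>T\<close> live.\<close>

definition minimax_risk :: "(real \<Rightarrow> 's measure) \<Rightarrow> (real \<Rightarrow> real) \<Rightarrow> real \<Rightarrow> ennreal" where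
  "minimax_risk P g H =
     (INF T\<in>borel_measurable (P 0). SUP h\<in>{-H..H}. \<integral>\<^sup>+x. ennreal ((T x - g h)\<^sup>2) \<partial>P h)"

definition bayes_risk :: "(real \<Rightarrow> 's measure) \<Rightarrow> (real \<Rightarrow> real) \<Rightarrow> real measure \<Rightarrow> ennreal" where
  "bayes_risk P g \<pi> =
     (INF T\<in>borel_measurable (P 0). \<integral>\<^sup>+h. (\<integral>\<^sup>+x. ennreal ((T x - g h)\<^sup>2) \<partial>P h) \<partial>\<pi>)"

definition minimax_attained :: "(real \<Rightarrow> 's measure) \<Rightarrow> (real \<Rightarrow> real) \<Rightarrow> real \<Rightarrow> bool" where
  "minimax_attained P g H \<longleftrightarrow>
     minimax_risk P g H = (SUP \<pi>\<in>priors H. bayes_risk P g \<pi>) \<and>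
     (\<exists>\<pi>\<in>priors H. bayes_risk P g \<pi> = minimax_risk P g H)"

definition gaussian_shift :: "real \<Rightarrow> real \<Rightarrow> real measure" where
  "gaussian_shift v h = density lborel (\<lambda>y. ennreal (normal_density h (sqrt v) y))"

definition gaussian_bayes_risk :: "real \<Rightarrow> real measure \<Rightarrow> ennreal" where
  "gaussian_bayes_risk v \<pi> = bayes_risk (gaussian_shift v) (\<lambda>h. h) \<pi>"

definition gaussian_posterior :: "real \<Rightarrow> real measure \<Rightarrow> real \<Rightarrow> real measure" where
  "gaussian_posterior v \<pi> y =
     density \<pi> (\<lambda>h. ennreal (normal_density h (sqrt v) y / (\<integral>u. normal_density u (sqrt v) y \<partial>\<pi>)))"

definition gaussian_posterior_variance :: "real \<Rightarrow> real measure \<Rightarrow> real \<Rightarrow> real" where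
  "gaussian_posterior_variance v \<pi> y =
     (\<integral>h. (h - (\<integral>u. u \<partial>gaussian_posterior v \<pi> y))\<^sup>2 \<partial>gaussian_posterior v \<pi> y)"

definition gaussian_expectation :: "real \<Rightarrow> real measure \<Rightarrow> (real \<Rightarrow> real) \<Rightarrow> real" where
  "gaussian_expectation v \<pi> f = (\<integral>h. (\<integral>y. f y \<partial>gaussian_shift v h) \<partial>\<pi>)"

definition blackwell_dominates :: "real set \<Rightarrow> (real \<Rightarrow> 'x measure) \<Rightarrow> (real \<Rightarrow> 'y measure) \<Rightarrow> bool" where
  "blackwell_dominates \<Theta> P P' \<longleftrightarrow>
     (\<exists>K. \<forall>\<theta>\<in>\<Theta>. K \<in> P \<theta> \<rightarrow>\<^sub>M prob_algebra (P' \<theta>) \<and> P' \<theta> = P \<theta> \<bind> K)"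

text \<open>Fisher information in the sense of differentiability in quadratic mean: \<open>p\<close> are densities
  near \<open>\<theta>\<^sub>0\<close> with respect to a sigma-finite \<open>\<mu>\<close>, \<open>s\<close> is the score at \<open>\<theta>\<^sub>0\<close>.\<close>

definition has_fisher_information :: "(real \<Rightarrow> 'x measure) \<Rightarrow> real \<Rightarrow> real \<Rightarrow> bool" where
  "has_fisher_information P \<theta>\<^sub>0 J \<longleftrightarrow>
     (\<exists>\<mu> p s. sigma_finite_measure \<mu> \<and>
        (\<forall>\<^sub>F \<theta> in nhds \<theta>\<^sub>0. p \<theta> \<in> borel_measurable \<mu> \<and> (\<forall>x. 0 \<le> p \<theta> x) \<and>
           P \<theta> = density \<mu> (\<lambda>x. ennreal (p \<theta> x))) \<and>
        s \<in> borel_measurable \<mu> \<and>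
        integrable (P \<theta>\<^sub>0) (\<lambda>x. (s x)\<^sup>2) \<and>
        ((\<lambda>t. (\<integral>x. (sqrt (p (\<theta>\<^sub>0 + t) x) - sqrt (p \<theta>\<^sub>0 x) - t / 2 * s x * sqrt (p \<theta>\<^sub>0 x))\<^sup>2 \<partial>\<mu>) / t\<^sup>2)
           \<longlongrightarrow> 0) (at 0) \<and>
        J = (\<integral>x. (s x)\<^sup>2 \<partial>P \<theta>\<^sub>0))"

text \<open>\<open>expt M q l \<theta>\<close> is the law of one observation in context \<open>q\<close> from the experiment at inverse
  information level \<open>l\<close>, and \<open>target M q\<close> is the functional \<open>\<psi>\<^sub>q\<close>.\<close>

record ('q, 'a, 'x) menu_problem =
  contexts :: "'q set"
  actions :: "'a set"
  level :: "'q \<Rightarrow> 'a \<Rightarrow> ereal"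
  param_set :: "real set"
  base_param :: real
  expt :: "'q \<Rightarrow> ereal \<Rightarrow> real \<Rightarrow> 'x measure"
  target :: "'q \<Rightarrow> real \<Rightarrow> real"

text \<open>The level of the best action, without requiring that the infimum be attained. It is used
  only where the infimum is a positive real number.\<close>

definition oracle_level :: "('q, 'a, 'x) menu_problem \<Rightarrow> 'q \<Rightarrow> real" where
  "oracle_level M q = real_of_ereal (INF a\<in>actions M. level M q a)"

definition near_levels :: "('q, 'a, 'x) menu_problem \<Rightarrow> real \<Rightarrow> 'q \<Rightarrow> real set" where
  "near_levels M \<delta> q = {oracle_level M q..oracle_level M q + \<delta>}"

definition available_levels :: "('q, 'a, 'x) menu_problem \<Rightarrow> real \<Rightarrow> 'q \<Rightarrow> ereal set" where
  "available_levels M \<delta> q = level M q ` actions M \<union> ereal ` near_levels M \<delta> q"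

text \<open>The first clause on \<open>expt\<close> says that \<open>\<theta> \<mapsto> P\<^sub>\<theta>\<close> is a Markov kernel from the parameter set to
  one fixed sample space, which is what Bayes risks presuppose. At level \<open>\<infinity>\<close> the information is
  \<open>inverse \<infinity> = 0\<close>.\<close>

definition continuous_blackwell_chain :: "('q, 'a, 'x) menu_problem \<Rightarrow> real \<Rightarrow> bool" where
  "continuous_blackwell_chain M \<delta> \<longleftrightarrow>
     base_param M \<in> interior (param_set M) \<and>
     (\<forall>q\<in>contexts M.
        (\<forall>a\<in>actions M. 0 < level M q a \<and> ereal (oracle_level M q) \<le> level M q a) \<and>
        (\<forall>l\<in>available_levels M \<delta> q.
           expt M q l \<in> restrict_space borel (param_set M) \<rightarrow>\<^sub>M prob_algebra (expt M q l (base_param M)) \<and>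
           has_fisher_information (expt M q l) (base_param M) (real_of_ereal (inverse l))) \<and>
        (\<forall>l\<in>available_levels M \<delta> q. \<forall>l'\<in>available_levels M \<delta> q.
           l \<le> l' \<longrightarrow> blackwell_dominates (param_set M) (expt M q l) (expt M q l')))"

definition menus :: "('q, 'a, 'x) menu_problem \<Rightarrow> nat \<Rightarrow> 'a set set" where
  "menus M k = {V. V \<subseteq> actions M \<and> finite V \<and> 1 \<le> card V \<and> card V \<le> k}"

definition menu_level :: "('q, 'a, 'x) menu_problem \<Rightarrow> 'a set \<Rightarrow> 'q \<Rightarrow> ereal" where
  "menu_level M V q = Min (level M q ` V)"

definition target_slope :: "('q, 'a, 'x) menu_problem \<Rightarrow> 'q \<Rightarrow> real" where
  "target_slope M q = deriv (target M q) (base_param M)"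

definition local_expt :: "('q, 'a, 'x) menu_problem \<Rightarrow> nat \<Rightarrow> 'q \<Rightarrow> ereal \<Rightarrow> real \<Rightarrow> (nat \<Rightarrow> 'x) measure" where
  "local_expt M n q l h = PiM {..<n} (\<lambda>_. expt M q l (base_param M + h / sqrt (real n)))"

definition local_target :: "('q, 'a, 'x) menu_problem \<Rightarrow> nat \<Rightarrow> 'q \<Rightarrow> real \<Rightarrow> real" where
  "local_target M n q h =
     sqrt (real n) * (target M q (base_param M + h / sqrt (real n)) - target M q (base_param M))"

definition target_minimax_risk :: "('q, 'a, 'x) menu_problem \<Rightarrow> nat \<Rightarrow> real \<Rightarrow> 'q \<Rightarrow> ereal \<Rightarrow> ennreal" where
  "target_minimax_risk M n H q l = minimax_risk (local_expt M n q l) (local_target M n q) H"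

definition shift_bayes_risk :: "('q, 'a, 'x) menu_problem \<Rightarrow> nat \<Rightarrow> 'q \<Rightarrow> real measure \<Rightarrow> real \<Rightarrow> real" where
  "shift_bayes_risk M n q \<pi> v = enn2real (bayes_risk (local_expt M n q (ereal v)) (\<lambda>h. h) \<pi>)"

definition target_bayes_risk :: "('q, 'a, 'x) menu_problem \<Rightarrow> nat \<Rightarrow> 'q \<Rightarrow> real measure \<Rightarrow> real \<Rightarrow> real" where
  "target_bayes_risk M n q \<pi> v =
     enn2real (bayes_risk (local_expt M n q (ereal v)) (local_target M n q) \<pi>)"

definition information_gap :: "('q, 'a, 'x) menu_problem \<Rightarrow> 'a set \<Rightarrow> ereal" where
  "information_gap M V =
     (SUP q\<in>contexts M. ereal ((target_slope M q)\<^sup>2) * (menu_level M V q - ereal (oracle_level M q)))"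

definition information_frontier :: "('q, 'a, 'x) menu_problem \<Rightarrow> nat \<Rightarrow> ereal" where
  "information_frontier M k = (INF V\<in>menus M k. information_gap M V)"

definition risk_gap :: "('q, 'a, 'x) menu_problem \<Rightarrow> nat \<Rightarrow> real \<Rightarrow> 'a set \<Rightarrow> ereal" where
  "risk_gap M n H V =
     (SUP q\<in>contexts M. enn2ereal (target_minimax_risk M n H q (menu_level M V q))
        - enn2ereal (target_minimax_risk M n H q (ereal (oracle_level M q))))"

definition risk_frontier :: "('q, 'a, 'x) menu_problem \<Rightarrow> nat \<Rightarrow> nat \<Rightarrow> real \<Rightarrow> ereal" where
  "risk_frontier M n k H = (INF V\<in>menus M k. risk_gap M n H V)"

text \<open>The two transfer assumptions are imposed at the radii \<open>H n\<close> for all large \<open>n\<close> (for small \<open>n\<close> the points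
  \<open>\<theta>\<^sub>0 + h / sqrt n\<close> need not be parameters), with constants not depending on the context, the
  level, the prior or \<open>n\<close>. Derivatives in the level are one-sided at the ends of
  \<open>near_levels M \<delta> q\<close>, since no experiments need exist beyond it.\<close>

definition differentiated_gaussian_transfer ::
    "('q, 'a, 'x) menu_problem \<Rightarrow> real \<Rightarrow> (nat \<Rightarrow> real) \<Rightarrow> (nat \<Rightarrow> real \<Rightarrow> real) \<Rightarrow> (nat \<Rightarrow> real \<Rightarrow> real) \<Rightarrow> bool" where
  "differentiated_gaussian_transfer M \<delta> H \<eta>\<^sub>0 \<eta>\<^sub>1 \<longleftrightarrow>
     (\<exists>C. \<forall>\<^sub>F n in sequentially. \<forall>q\<in>contexts M. \<forall>v\<in>near_levels M \<delta> q.
        minimax_attained (local_expt M n q (ereal v)) (\<lambda>h. h) (H n) \<and>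
        (\<forall>\<pi>\<in>priors (H n).
           \<bar>shift_bayes_risk M n q \<pi> v - enn2real (gaussian_bayes_risk v \<pi>)\<bar> \<le> \<eta>\<^sub>0 n (H n) \<and>
           (\<exists>D. (shift_bayes_risk M n q \<pi> has_real_derivative D) (at v within near_levels M \<delta> q) \<and>
              0 \<le> D \<and> D \<le> C * H n ^ 4 \<and>
              \<bar>D - gaussian_expectation v \<pi> (\<lambda>y. (gaussian_posterior_variance v \<pi> y / v)\<^sup>2)\<bar> \<le> \<eta>\<^sub>1 n (H n))))"

definition smooth_target_transfer :: "('q, 'a, 'x) menu_problem \<Rightarrow> real \<Rightarrow> (nat \<Rightarrow> real) \<Rightarrow> bool" where
  "smooth_target_transfer M \<delta> H \<longleftrightarrow>
     (\<exists>b\<^sub>0 b\<^sub>1. 0 < b\<^sub>0 \<and> (\<forall>q\<in>contexts M. b\<^sub>0 \<le> \<bar>target_slope M q\<bar> \<and> \<bar>target_slope M q\<bar> \<le> b\<^sub>1)) \<and>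
     (\<exists>B. \<exists>\<rho>>0. ball (base_param M) \<rho> \<subseteq> param_set M \<and>
        (\<forall>q\<in>contexts M. \<forall>\<theta>\<in>ball (base_param M) \<rho>.
           target M q differentiable at \<theta> \<and> deriv (target M q) differentiable at \<theta> \<and>
           \<bar>deriv (deriv (target M q)) \<theta>\<bar> \<le> B)) \<and>
     (\<exists>C. \<forall>\<^sub>F n in sequentially. \<forall>q\<in>contexts M. \<forall>v\<in>near_levels M \<delta> q.
        minimax_attained (local_expt M n q (ereal v)) (local_target M n q) (H n) \<and>
        (\<forall>\<pi>\<in>priors (H n).
           \<bar>target_bayes_risk M n q \<pi> v - (target_slope M q)\<^sup>2 * shift_bayes_risk M n q \<pi> v\<bar>
             \<le> C * (H n ^ 3 / sqrt (real n) + H n ^ 4 / real n) \<and>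
           (\<exists>D\<^sub>h D\<^sub>\<psi>.
              (shift_bayes_risk M n q \<pi> has_real_derivative D\<^sub>h) (at v within near_levels M \<delta> q) \<and>
              (target_bayes_risk M n q \<pi> has_real_derivative D\<^sub>\<psi>) (at v within near_levels M \<delta> q) \<and>
              (max 0 (\<bar>target_slope M q\<bar> - C * H n / sqrt (real n)))\<^sup>2 * D\<^sub>h \<le> D\<^sub>\<psi> \<and>
              D\<^sub>\<psi> \<le> (\<bar>target_slope M q\<bar> + C * H n / sqrt (real n))\<^sup>2 * D\<^sub>h)))"

definition admissible_radii :: "(nat \<Rightarrow> ereal) \<Rightarrow> (nat \<Rightarrow> real) \<Rightarrow> bool" where
  "admissible_radii \<alpha> H \<longleftrightarrow>
     filterlim H at_top sequentially \<and>
     (\<lambda>n. H n ^ 11 / sqrt (real n)) \<longlonglongrightarrow> 0 \<and>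
     (\<lambda>n. ereal (H n ^ 10) * \<alpha> n) \<longlonglongrightarrow> 0"

end

theory Submission
  imports Defs "HOL-Real_Asymp.Real_Asymp"
begin

text \<open>Everything rests on one estimate: if a prior on \<open>[-H, H]\<close> has Gaussian Bayes risk close to its upper
  bound \<open>v\<close>, then the derivative \<open>E (w / v)\<^sup>2\<close> is close to \<open>1\<close>. With \<open>Z\<close> the standardised noise and
  \<open>a\<^sub>k\<close> the posterior mean of the \<open>k\<close>-th Hermite polynomial of \<open>Z\<close>, one has \<open>w / v = 1 + a\<^sub>2 - a\<^sub>1\<^sup>2\<close> and
  \<open>E a\<^sub>1\<^sup>2 = 1 - E w / v\<close>; integration by parts gives \<open>E a\<^sub>2\<^sup>2 = - E (a\<^sub>1 a\<^sub>3) + E (a\<^sub>1\<^sup>2 a\<^sub>2)\<close>, which is small with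
  \<open>E a\<^sub>1\<^sup>2\<close> because all higher moments are bounded by moments of \<open>Z\<close>, uniformly in the prior and in \<open>H\<close>.

  A van Trees bound shows that the Gaussian minimax risk is \<open>v - O(1 / H\<^sup>2)\<close>, so by transfer least favorable
  priors for the target have nearly maximal Gaussian risk, also at levels within \<open>O(A\<^sub>k)\<close> of the given one. Comparing
  the minimax risks at two levels through the least favorable prior of either one and the mean value
  theorem, the increment is \<open>b\<^sup>2 (v - v\<^sub>\<star>) (1 + o(1))\<close>. Menus whose level is far from the oracle level are
  handled by Blackwell monotonicity, going through an intermediate level.\<close>

section \<open>Gaussian preliminaries\<close>

text \<open>Nothing ties \<open>k n\<close> to \<open>n\<close>, so the frontier may be far smaller
  than the additive transfer error \<open>\<eta>\<^sub>0\<close>, and subtracting Gaussian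
  approximations of two risks would say nothing about their difference. For this reason one prior is
  held fixed while the level moves: its risk increment is a derivative times the difference of the
  levels, so an o(1) error in the derivative turns into a relative error. The additive errors serve
  only to certify that the prior is nearly least favorable in the Gaussian problem.

  The obstacle in the Gaussian estimate is that a mean of \<open>w / v\<close> close to 1 does not
  by itself bound the mean of its square: pointwise only \<open>w \<le> H^2\<close> is available,
  which grows with the radius. The Hermite means replace these powers of \<open>H\<close> by moments
  of the noise.\<close>

lemma FTC_integral_whole_line_zero:
  fixes F f :: "real \<Rightarrow> real"
  assumes deriv: "\<And>x. (F has_real_derivative f x) (at x)"
    and cont: "\<And>x. isCont f x"
    and int: "integrable lborel f"
    and top: "(F \<longlongrightarrow> 0) at_top" and bot: "(F \<longlongrightarrow> 0) at_bot"
  shows "(\<integral>x. f x \<partial>lborel) = 0"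
proof -
  have "(LBINT x=-\<infinity>..\<infinity>. f x) = 0 - 0"
  proof (rule interval_integral_FTC_integrable)
    show "(F has_vector_derivative f x) (at x)" for x
      using deriv by (simp add: has_real_derivative_iff_has_vector_derivative)
    show "set_integrable lborel (einterval (-\<infinity>) \<infinity>) f"
      using int by (simp add: set_integrable_def einterval_def)
    show "((F \<circ> real_of_ereal) \<longlongrightarrow> 0) (at_right (-\<infinity>))" "((F \<circ> real_of_ereal) \<longlongrightarrow> 0) (at_left \<infinity>)"
      using top bot by (simp_all add: ereal_tendsto_simps)
  qed (use cont in auto)
  then show ?thesis
    by (simp add: interval_lebesgue_integral_def set_lebesgue_integral_def)
qed

text \<open>The weights 1, 1, 3, 15, 105 are the even moments \<open>(2k - 1)!!\<close> of a
  standard normal variable. Degree 8 is reached by the fourth power of the second Hermite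
  polynomial.\<close>

lemma std_normal_even_poly:
  fixes c\<^sub>0 c\<^sub>2 c\<^sub>4 c\<^sub>6 c\<^sub>8 :: real
  shows "has_bochner_integral lborel
    (\<lambda>x. std_normal_density x * (c\<^sub>0 + c\<^sub>2 * x\<^sup>2 + c\<^sub>4 * x ^ 4 + c\<^sub>6 * x ^ 6 + c\<^sub>8 * x ^ 8))
    (c\<^sub>0 + c\<^sub>2 + 3 * c\<^sub>4 + 15 * c\<^sub>6 + 105 * c\<^sub>8)"
proof -
  have e: "has_bochner_integral lborel (\<lambda>x. c * (std_normal_density x * x ^ (2 * k)))
      (c * (fact (2 * k) / (2 ^ k * fact k)))" for c :: real and k
    by (rule has_bochner_integral_mult_right) (rule std_normal_moment_even)
  have "has_bochner_integral lborel (\<lambda>x. c\<^sub>0 * (std_normal_density x * x ^ (2 * 0))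
      + c\<^sub>2 * (std_normal_density x * x ^ (2 * 1)) + c\<^sub>4 * (std_normal_density x * x ^ (2 * 2))
      + c\<^sub>6 * (std_normal_density x * x ^ (2 * 3)) + c\<^sub>8 * (std_normal_density x * x ^ (2 * 4)))
    (c\<^sub>0 * (fact (2 * 0) / (2 ^ 0 * fact 0)) + c\<^sub>2 * (fact (2 * 1) / (2 ^ 1 * fact 1))
      + c\<^sub>4 * (fact (2 * 2) / (2 ^ 2 * fact 2)) + c\<^sub>6 * (fact (2 * 3) / (2 ^ 3 * fact 3))
      + c\<^sub>8 * (fact (2 * 4) / (2 ^ 4 * fact 4)))"
    by (intro has_bochner_integral_add e)
  also have "(\<lambda>x. c\<^sub>0 * (std_normal_density x * x ^ (2 * 0))
      + c\<^sub>2 * (std_normal_density x * x ^ (2 * 1)) + c\<^sub>4 * (std_normal_density x * x ^ (2 * 2))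
      + c\<^sub>6 * (std_normal_density x * x ^ (2 * 3)) + c\<^sub>8 * (std_normal_density x * x ^ (2 * 4)))
    = (\<lambda>x. std_normal_density x * (c\<^sub>0 + c\<^sub>2 * x\<^sup>2 + c\<^sub>4 * x ^ 4 + c\<^sub>6 * x ^ 6 + c\<^sub>8 * x ^ 8))"
    by (auto simp: distrib_left mult.left_commute)
  finally show ?thesis
    by (simp add: fact_numeral mult.commute)
qed

text \<open>Young's inequality with a free weight: in \<open>EW2_upper\<close> a large
  \<open>t\<close> puts the small coefficient on the high moments and the large one on the small
  quantity \<open>1 - EW\<close>.\<close>

lemma weighted_AM_GM:
  fixes a b t :: real
  assumes "0 < t"
  shows "a * b \<le> t * a\<^sup>2 / 2 + b\<^sup>2 / (2 * t)"
proof -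
  have "0 \<le> (t * a - b)\<^sup>2 / (2 * t)" using assms by simp
  also have "\<dots> = t * a\<^sup>2 / 2 + b\<^sup>2 / (2 * t) - a * b"
    using assms by (simp add: power2_eq_square field_simps)
  finally show ?thesis by simp
qed

lemma poly_normal_density_tendsto_0:
  fixes s H :: real assumes "0 < s" "0 \<le> H"
  shows "((\<lambda>y. s * ((y + H) / s) * (((y + H) / s)\<^sup>2 + 1) * normal_density H s y) \<longlongrightarrow> 0) at_top"
proof -
  have "((\<lambda>y. (y + H) * (((y + H) / s)\<^sup>2 + 1) * (1 / sqrt (2 * pi * s\<^sup>2) * exp (- (y - H)\<^sup>2 / (2 * s\<^sup>2)))) \<longlongrightarrow> 0) at_top"
    using assms by real_asymp
  then show ?thesis using assms by (simp add: normal_density_def)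
qed

text \<open>The right side is the sum of noise moments that arises in \<open>EW2_upper\<close>;
  sorting it by even powers lets \<open>std_normal_even_poly\<close> evaluate its Gaussian
  mean.\<close>

lemma hermite_moment_polynomial:
  fixes c t z :: real
  shows "(-1 + c / 2) + (2 + t + 7 * c) * z\<^sup>2 + (- (5/2) * c) * z ^ 4 + (- c) * z ^ 6 + (c / 2) * z ^ 8 =
  1 + (2 * (z\<^sup>2 - 1) + (t * z\<^sup>2 + (c * (z ^ 3 - 3 * z)\<^sup>2 + (c / 2 * z ^ 4 + c / 2 * (z\<^sup>2 - 1) ^ 4))))"
proof -
  define x where "x = z\<^sup>2"
  have p: "z ^ 4 = x ^ 2" "z ^ 6 = x ^ 3" "z ^ 8 = x ^ 4" "z\<^sup>2 = x" by (simp_all add: x_def)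
  have "(z ^ 3 - 3 * z)\<^sup>2 = x * (x - 3)\<^sup>2"
    unfolding x_def by algebra
  then show ?thesis unfolding p
    by (simp only:) (simp add: power4_eq_xxxx power3_eq_cube power2_eq_square, simp add: field_simps)
qed

section \<open>Gaussian posteriors for a bounded prior\<close>

locale bounded_prior =
  fixes \<pi> :: "real measure" and H v :: real
  assumes prior: "\<pi> \<in> priors H" and v_pos: "0 < v"
begin

definition s :: real where "s = sqrt v"

lemma s_pos: "0 < s" and s_sq: "s\<^sup>2 = v"
  using v_pos by (auto simp: s_def)

sublocale prob_space \<pi>
  using prior by (simp add: priors_def space_prob_algebra)

lemma sets_prior: "sets \<pi> = sets (restrict_space borel {-H..H})"
  using prior by (simp add: priors_def space_prob_algebra)

lemma space_prior: "space \<pi> = {-H..H}"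
  using sets_eq_imp_space_eq[OF sets_prior] by (simp add: space_restrict_space)

lemma measurable_ident_prior [measurable]: "(\<lambda>h. h) \<in> borel_measurable \<pi>"
  by (subst measurable_cong_sets[OF sets_prior refl]) (rule measurable_restrict_space1, simp)

lemma H_nonneg: "0 \<le> H"
  using not_empty space_prior by auto

lemma integrable_prior:
  fixes g :: "real \<Rightarrow> real"
  assumes "continuous_on {-H..H} g"
  shows "integrable \<pi> g"
proof -
  have "bounded (g ` {-H..H})"
    using assms compact_continuous_image compact_imp_bounded by blast
  then obtain B where B: "\<And>h. h \<in> {-H..H} \<Longrightarrow> norm (g h) \<le> B"
    unfolding bounded_iff by blast
  have "g \<in> borel_measurable \<pi>"
    by (subst measurable_cong_sets[OF sets_prior refl])
       (rule borel_measurable_continuous_on_restrict[OF assms])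
  then show ?thesis
    by (intro integrable_const_bound[of _ B]) (auto simp: space_prior intro!: AE_I2 B[unfolded real_norm_def])
qed

text \<open>Dominated convergence along sequences: a convergent sequence of arguments is bounded by
  some \<open>R\<close> and the prior lives on \<open>[-H, H]\<close>, so the mean value inequality
  bounds all difference quotients by the maximum of \<open>g'\<close> on
  \<open>[-(R+H), R+H]\<close>.\<close>

lemma DERIV_integral_shift:
  fixes g g' :: "real \<Rightarrow> real"
  assumes g: "\<And>x. (g has_real_derivative g' x) (at x)" and g': "\<And>x. isCont g' x"
  shows "((\<lambda>y. \<integral>h. g (y - h) \<partial>\<pi>) has_real_derivative (\<integral>h. g' (y - h) \<partial>\<pi>)) (at y)"
  unfolding has_field_derivative_iff tendsto_at_iff_sequentially
proof (intro allI impI)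
  fix X :: "nat \<Rightarrow> real" assume X: "\<forall>i. X i \<in> UNIV - {y}" "X \<longlonglongrightarrow> y"
  have cg: "continuous_on UNIV g"
    using DERIV_isCont[OF g] by (intro continuous_at_imp_continuous_on) blast
  have cg': "continuous_on UNIV g'"
    using g' by (intro continuous_at_imp_continuous_on) blast
  have ig: "integrable \<pi> (\<lambda>h. g (y - h))" for y
    by (intro integrable_prior continuous_on_compose2[OF cg] continuous_intros) auto
  have ig': "integrable \<pi> (\<lambda>h. g' (y - h))" for y
    by (intro integrable_prior continuous_on_compose2[OF cg'] continuous_intros) auto
  have "bounded (range X)" using X(2) convergent_imp_bounded by blast
  then obtain R where R: "\<And>i. \<bar>X i\<bar> \<le> R" by (auto simp: bounded_iff)
  have R_y: "\<bar>y\<bar> \<le> R"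
    using tendsto_upperbound[OF tendsto_rabs[OF X(2)]] R by auto
  have "bounded (g' ` {-(R+H)..R+H})"
    by (intro compact_imp_bounded compact_continuous_image continuous_on_subset[OF cg']) auto
  then obtain B where B: "\<And>x. \<bar>x\<bar> \<le> R + H \<Longrightarrow> \<bar>g' x\<bar> \<le> B"
    unfolding bounded_iff by (metis image_eqI abs_le_iff atLeastAtMost_iff minus_le_iff real_norm_def)
  let ?q = "\<lambda>i h. (g (X i - h) - g (y - h)) / (X i - y)"
  have "(\<lambda>i. \<integral>h. ?q i h \<partial>\<pi>) \<longlonglongrightarrow> (\<integral>h. g' (y - h) \<partial>\<pi>)"
  proof (rule integral_dominated_convergence[where w="\<lambda>_. B"])
    show "AE h in \<pi>. (\<lambda>i. ?q i h) \<longlonglongrightarrow> g' (y - h)"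
    proof (rule AE_I2)
      fix h
      have "((\<lambda>y. g (y - h)) has_real_derivative g' (y - h)) (at y)"
        by (rule DERIV_chain'[where f="\<lambda>y. y - h" and D=1, simplified]) (auto intro!: derivative_eq_intros g)
      then show "(\<lambda>i. ?q i h) \<longlonglongrightarrow> g' (y - h)"
        unfolding has_field_derivative_iff tendsto_at_iff_sequentially using X by (auto simp: comp_def)
    qed
    fix i
    show "AE h in \<pi>. norm (?q i h) \<le> B"
    proof (rule AE_I2)
      fix h assume "h \<in> space \<pi>"
      then have h: "\<bar>h\<bar> \<le> H" by (auto simp: space_prior)
      have "norm (g (X i - h) - g (y - h)) \<le> B * norm ((X i - h) - (y - h))"
      proof (rule field_differentiable_bound[where f'=g' and S="{-(R+H)..R+H}"])
        show "convex {-(R+H)..R+H}" by simp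
        show "X i - h \<in> {-(R+H)..R+H}" "y - h \<in> {-(R+H)..R+H}"
          using R[of i] R_y h by auto
      qed (use g B in \<open>auto intro: has_field_derivative_at_within\<close>)
      then show "norm (?q i h) \<le> B" using X(1) by (auto simp: divide_simps)
    qed
  qed (use ig ig' in auto)
  then show "((\<lambda>z. ((\<integral>h. g (z - h) \<partial>\<pi>) - (\<integral>h. g (y - h) \<partial>\<pi>)) / (z - y)) \<circ> X) \<longlonglongrightarrow> (\<integral>h. g' (y - h) \<partial>\<pi>)"
    using ig by (simp add: comp_def)
qed

text \<open>In terms of \<open>z = (y - h) / s\<close>, \<open>N f y\<close> is the posterior expectation of \<open>f z\<close> given \<open>y\<close>, times the
  marginal density \<open>m y = N (\<lambda>_. 1) y\<close>. Up to
  the factor \<open>- 1 / s\<close>, differentiation in \<open>y\<close> maps each Hermite polynomial \<open>f\<close> to the next one.\<close>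

definition N :: "(real \<Rightarrow> real) \<Rightarrow> real \<Rightarrow> real" where
  "N f y = (\<integral>h. f ((y - h) / s) * normal_density h s y \<partial>\<pi>)"

lemma normal_density_shift: "normal_density h s y = std_normal_density ((y - h) / s) / s"
  using s_pos by (simp add: normal_density_def std_normal_density_def power_divide real_sqrt_mult divide_simps)

lemma cont_density: "continuous_on A (\<lambda>h. normal_density h s y)"
  unfolding normal_density_def using s_pos by (intro continuous_intros) auto

lemma integrable_N:
  assumes "continuous_on UNIV f"
  shows "integrable \<pi> (\<lambda>h. f ((y - h) / s) * normal_density h s y)"
  using s_pos by (intro integrable_prior continuous_intros cont_density continuous_on_compose2[OF assms]) auto

text \<open>The standard normal density \<open>p\<close> satisfies \<open>p' = - z * p\<close>, so
  the product rule gives \<open>(f * p)' = (f' - z * f) * p\<close>; the factor \<open>1 / s\<close>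
  comes from the standardisation of \<open>y - h\<close>.\<close>

lemma DERIV_N:
  assumes f: "\<And>z. (f has_real_derivative f' z) (at z)" and c: "continuous_on UNIV f'"
  shows "(N f has_real_derivative N (\<lambda>z. f' z - z * f z) y / s) (at y)"
proof -
  let ?g = "\<lambda>x. f (x / s) * (std_normal_density (x / s) / s)"
  let ?g' = "\<lambda>x. (f' (x / s) - (x / s) * f (x / s)) * (std_normal_density (x / s) / s) / s"
  have contf: "isCont f z" for z using f DERIV_isCont by blast
  have contf': "isCont f' z" for z using c by (simp add: continuous_on_eq_continuous_at)
  have d: "(std_normal_density has_real_derivative - z * std_normal_density z) (at z)" for z
  proof -
    have "((\<lambda>z. exp (- z\<^sup>2 / 2)) has_real_derivative - z * exp (- z\<^sup>2 / 2)) (at z)"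
      by (auto intro!: derivative_eq_intros)
    from DERIV_cmult[OF this, of "1 / sqrt (2 * pi)"] show ?thesis
      by (simp add: std_normal_density_def[abs_def])
  qed
  have cs: "isCont std_normal_density z" for z using d DERIV_isCont by blast
  have "((\<lambda>y. \<integral>h. ?g (y - h) \<partial>\<pi>) has_real_derivative (\<integral>h. ?g' (y - h) \<partial>\<pi>)) (at y)"
  proof (rule DERIV_integral_shift)
    fix x
    have 1: "((\<lambda>x. f (x / s)) has_real_derivative f' (x / s) * (1 / s)) (at x)"
      by (rule DERIV_chain2[OF f]) (use s_pos in \<open>auto intro!: derivative_eq_intros\<close>)
    have 2: "((\<lambda>x. std_normal_density (x / s)) has_real_derivative (- (x / s) * std_normal_density (x / s)) * (1 / s)) (at x)"
      by (rule DERIV_chain2[OF d]) (use s_pos in \<open>auto intro!: derivative_eq_intros\<close>)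
    show "(?g has_real_derivative ?g' x) (at x)"
      using s_pos by (auto intro!: derivative_eq_intros 1 2 simp: field_simps)
    have "isCont (\<lambda>x. f (x / s)) x" "isCont (\<lambda>x. f' (x / s)) x" "isCont (\<lambda>x. std_normal_density (x / s)) x"
      using s_pos by (auto intro!: isCont_o2[OF _ contf] isCont_o2[OF _ contf'] isCont_o2[OF _ cs] continuous_intros)
    then show "isCont ?g' x" using s_pos
      by (intro continuous_intros) auto
  qed
  then show ?thesis by (simp add: N_def[abs_def] normal_density_shift)
qed

lemma measurable_N [measurable]:
  assumes [measurable]: "f \<in> borel_measurable borel"
  shows "N f \<in> borel_measurable borel"
  unfolding N_def[abs_def] normal_density_def by measurable

lemma N_add: "continuous_on UNIV f \<Longrightarrow> continuous_on UNIV g \<Longrightarrow> N (\<lambda>z. f z + g z) y = N f y + N g y"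
  unfolding N_def using integrable_N by (simp add: distrib_right)

lemma N_diff: "continuous_on UNIV f \<Longrightarrow> continuous_on UNIV g \<Longrightarrow> N (\<lambda>z. f z - g z) y = N f y - N g y"
  unfolding N_def using integrable_N by (simp add: left_diff_distrib)

lemma N_cmult: "N (\<lambda>z. c * f z) y = c * N f y"
  unfolding N_def by (simp add: mult.assoc)

lemma N_nonneg: "(\<And>z. 0 \<le> f z) \<Longrightarrow> 0 \<le> N f y"
  unfolding N_def using s_pos by (intro integral_nonneg_AE) auto

abbreviation m :: "real \<Rightarrow> real" where "m \<equiv> N (\<lambda>_. 1)"

lemma m_pos: "0 < m y"
proof -
  have "AE h in \<pi>. 0 \<le> 1 * normal_density h s y" by simp
  from integral_nonneg_eq_0_iff_AE[OF integrable_N[of "\<lambda>_. 1" y] this] have "m y \<noteq> 0"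
    unfolding N_def using s_pos normal_density_pos[of s _ y] by (simp add: AE_False order_less_imp_not_eq2)
  then show ?thesis using N_nonneg[of "\<lambda>_. 1" y] by simp
qed

text \<open>Nonnegativity of the posterior variance of \<open>f\<close>, cleared of denominators;
  \<open>?c\<close> is the posterior mean.\<close>

lemma N_Cauchy_Schwarz:
  assumes f: "continuous_on UNIV f"
  shows "(N f y)\<^sup>2 \<le> m y * N (\<lambda>z. (f z)\<^sup>2) y"
proof -
  let ?c = "N f y / m y"
  have "0 \<le> N (\<lambda>z. (f z - ?c)\<^sup>2) y" by (rule N_nonneg) simp
  also have "(\<lambda>z. (f z - ?c)\<^sup>2) = (\<lambda>z. ((f z)\<^sup>2 - (2 * ?c) * f z) + ?c\<^sup>2 * 1)"
    by (auto simp: power2_eq_square algebra_simps)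
  also have "N \<dots> y = N (\<lambda>z. (f z)\<^sup>2) y - 2 * ?c * N f y + ?c\<^sup>2 * m y"
    by (subst N_add, (intro continuous_intros f)+, subst N_diff, (intro continuous_intros f)+, simp only: N_cmult)
  finally show ?thesis using m_pos[of y]
    by (simp add: power2_eq_square field_simps)
qed

text \<open>Substituting \<open>y = h + s * x\<close> removes \<open>h\<close> from the inner
  integral, because the noise is independent of the parameter. This is the source of all bounds that
  hold uniformly in the prior and in \<open>H\<close>.\<close>

lemma N_integral:
  assumes f: "continuous_on UNIV f" and int: "integrable lborel (\<lambda>x. std_normal_density x * f x)"
  shows "integrable lborel (N f)" and "(\<integral>y. N f y \<partial>lborel) = (\<integral>x. std_normal_density x * f x \<partial>lborel)"
proof -
  interpret P: pair_sigma_finite \<pi> lborel by standard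
  let ?F = "\<lambda>(h, y). f ((y - h) / s) * normal_density h s y"
  have [measurable]: "f \<in> borel_measurable borel" using f borel_measurable_continuous_onI by blast
  have shift: "std_normal_density x * g x = s * (g ((h + s * x - h) / s) * normal_density h s (h + s * x))" for g h x
    using s_pos by (simp add: normal_density_shift)
  have i: "integrable lborel (\<lambda>y. f ((y - h) / s) * normal_density h s y)" for h
  proof -
    have "integrable lborel (\<lambda>x. f ((h + s * x - h) / s) * normal_density h s (h + s * x))"
      using int s_pos unfolding shift[of _ f h] integrable_mult_right_iff by simp
    then show ?thesis using s_pos
      lborel_integrable_real_affine_iff[of s "\<lambda>y. f ((y - h) / s) * normal_density h s y" h] by simp
  qed
  have e: "(\<integral>y. g ((y - h) / s) * normal_density h s y \<partial>lborel) = (\<integral>x. std_normal_density x * g x \<partial>lborel)" for h g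
    unfolding shift[of _ g h] using s_pos
    by (subst lborel_integral_real_affine[where c=s and t=h]) simp_all
  have I: "integrable (\<pi> \<Otimes>\<^sub>M lborel) ?F"
  proof (rule P.Fubini_integrable)
    show "?F \<in> borel_measurable (\<pi> \<Otimes>\<^sub>M lborel)" unfolding normal_density_def by measurable
    show "AE h in \<pi>. integrable lborel (\<lambda>y. ?F (h, y))" using i by simp
    have "(\<integral>y. norm (?F (h, y)) \<partial>lborel) = (\<integral>x. std_normal_density x * \<bar>f x\<bar> \<partial>lborel)" for h
      using e[of "\<lambda>x. \<bar>f x\<bar>" h] by (simp add: abs_mult)
    then show "integrable \<pi> (\<lambda>h. \<integral>y. norm (?F (h, y)) \<partial>lborel)" by simp
  qed
  show "integrable lborel (N f)"
    using P.integrable_snd[OF I] by (simp add: N_def[abs_def])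
  show "(\<integral>y. N f y \<partial>lborel) = (\<integral>x. std_normal_density x * f x \<partial>lborel)"
    using P.Fubini_integral[OF I] by (simp add: N_def[abs_def] e prob_space)
qed

lemma posterior_integral:
  assumes f: "continuous_on UNIV f"
  shows "(\<integral>h. f ((y - h) / s) \<partial>gaussian_posterior v \<pi> y) = N f y / m y"
proof -
  have m: "(\<integral>u. normal_density u (sqrt v) y \<partial>\<pi>) = m y" by (simp add: N_def s_def)
  have [measurable]: "f \<in> borel_measurable borel" using f borel_measurable_continuous_onI by blast
  have [measurable]: "(\<lambda>h. f ((y - h) / s)) \<in> borel_measurable \<pi>" by measurable
  have "(\<integral>h. f ((y - h) / s) \<partial>gaussian_posterior v \<pi> y)
    = (\<integral>h. (normal_density h s y / m y) *\<^sub>R f ((y - h) / s) \<partial>\<pi>)"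
    unfolding gaussian_posterior_def m
    by (subst integral_density) (use m_pos[of y] s_pos in \<open>auto simp: s_def normal_density_def\<close>)
  also have "\<dots> = (\<integral>h. f ((y - h) / s) * normal_density h s y / m y \<partial>\<pi>)"
    by (simp add: field_simps)
  finally show ?thesis by (simp add: N_def)
qed

section \<open>Posterior mean and variance through Hermite means\<close>

abbreviation N1 where "N1 \<equiv> N (\<lambda>z. z)"
abbreviation N2 where "N2 \<equiv> N (\<lambda>z. z\<^sup>2 - 1)"
abbreviation N3 where "N3 \<equiv> N (\<lambda>z. z ^ 3 - 3 * z)"

text \<open>\<open>W\<close> is \<open>w / v\<close>: given \<open>y\<close>, the parameter
  \<open>h = y - s * z\<close> is affine in the noise \<open>z\<close>, so its posterior variance is
  \<open>v\<close> times that of \<open>z\<close>, whose posterior second moment is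
  \<open>1 + N2 y / m y\<close>.\<close>

definition W :: "real \<Rightarrow> real" where
  "W y = 1 + N2 y / m y - (N1 y / m y)\<^sup>2"

lemma N_sq: "N (\<lambda>z. z\<^sup>2) y = m y + N2 y"
  by (subst N_diff) (auto intro!: continuous_intros)

text \<open>Tweedie's formula: as \<open>m' = - N1 / s\<close>, the correction
  \<open>- s * (N1 y / m y)\<close> is \<open>v\<close> times the logarithmic derivative of the
  marginal density.\<close>

lemma posterior_mean: "(\<integral>u. u \<partial>gaussian_posterior v \<pi> y) = y - s * (N1 y / m y)"
proof -
  have "(\<integral>u. u \<partial>gaussian_posterior v \<pi> y) = (\<integral>h. (\<lambda>z. y - s * z) ((y - h) / s) \<partial>gaussian_posterior v \<pi> y)"
    using s_pos by simp
  also have "\<dots> = N (\<lambda>z. y * 1 - s * z) y / m y"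
    by (subst posterior_integral) (auto intro!: continuous_intros)
  also have "\<dots> = y - s * (N1 y / m y)"
    using m_pos[of y] by (subst N_diff) (auto intro!: continuous_intros simp: N_cmult[of y "\<lambda>_. 1", simplified] N_cmult diff_divide_distrib)
  finally show ?thesis .
qed

lemma mW_eq: "m y * W y = N (\<lambda>z. z\<^sup>2) y - m y * (N1 y / m y)\<^sup>2"
proof -
  have "m y * (N2 y / m y) = N2 y" using m_pos[of y] by simp
  then show ?thesis by (simp add: W_def N_sq distrib_left right_diff_distrib)
qed

lemma N_centered_sq: "N (\<lambda>z. (z - N1 y / m y)\<^sup>2) y = m y * W y"
proof -
  let ?a = "N1 y / m y"
  have "(\<lambda>z. (z - ?a)\<^sup>2) = (\<lambda>z. (z\<^sup>2 - (2 * ?a) * z) + ?a\<^sup>2 * 1)"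
    by (auto simp: power2_eq_square algebra_simps)
  then have "N (\<lambda>z. (z - ?a)\<^sup>2) y = N (\<lambda>z. (z\<^sup>2 - (2 * ?a) * z) + ?a\<^sup>2 * 1) y" by simp
  also have "\<dots> = N (\<lambda>z. z\<^sup>2) y - 2 * ?a * N1 y + ?a\<^sup>2 * m y"
    by (subst N_add, (intro continuous_intros)+, subst N_diff, (intro continuous_intros)+, simp only: N_cmult)
  also have "\<dots> = m y * W y"
    using m_pos[of y] unfolding mW_eq by (simp add: power2_eq_square field_simps)
  finally show ?thesis .
qed

lemma posterior_variance: "gaussian_posterior_variance v \<pi> y = v * W y"
proof -
  have "gaussian_posterior_variance v \<pi> y
     = (\<integral>h. (\<lambda>z. v * (z - N1 y / m y)\<^sup>2) ((y - h) / s) \<partial>gaussian_posterior v \<pi> y)"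
    unfolding gaussian_posterior_variance_def posterior_mean
  proof (rule Bochner_Integration.integral_cong[OF refl])
    fix h
    have "h - (y - s * (N1 y / m y)) = - (s * ((y - h) / s - N1 y / m y))"
      unfolding right_diff_distrib using s_pos by simp
    then show "(h - (y - s * (N1 y / m y)))\<^sup>2 = v * ((y - h) / s - N1 y / m y)\<^sup>2"
      by (simp only: power_mult_distrib power2_minus s_sq)
  qed
  also have "\<dots> = N (\<lambda>z. v * (z - N1 y / m y)\<^sup>2) y / m y"
    by (intro posterior_integral continuous_intros)
  also have "\<dots> = v * W y"
    using m_pos[of y] by (simp add: N_cmult N_centered_sq)
  finally show ?thesis .
qed

lemma W_nonneg: "0 \<le> W y"
  using N_nonneg[of "\<lambda>z. (z - N1 y / m y)\<^sup>2" y] m_pos[of y] by (simp add: N_centered_sq zero_le_mult_iff)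

lemma N_mono:
  assumes "continuous_on UNIV f" "continuous_on UNIV g"
    and "\<And>h. \<bar>h\<bar> \<le> H \<Longrightarrow> f ((y - h) / s) \<le> g ((y - h) / s)"
  shows "N f y \<le> N g y"
  unfolding N_def using assms s_pos
  by (intro integral_mono_AE integrable_N AE_I2 mult_right_mono) (auto simp: space_prior)

text \<open>The posterior variance is at most the posterior second moment about \<open>0\<close>.\<close>

lemma W_bounded: "W y \<le> (H / s)\<^sup>2"
proof -
  have "m y * W y = N (\<lambda>z. z\<^sup>2) y - m y * (N1 y / m y)\<^sup>2" by (rule mW_eq)
  also have "\<dots> \<le> N (\<lambda>z. z\<^sup>2) y - m y * (N1 y / m y)\<^sup>2 + m y * (N1 y / m y - y / s)\<^sup>2"
    using m_pos[of y] by simp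
  also have "\<dots> = N (\<lambda>z. z\<^sup>2) y - (2 * (y / s)) * N1 y + (y / s)\<^sup>2 * m y"
    using m_pos[of y] s_pos by (simp add: power2_eq_square field_simps)
  also have "\<dots> = N (\<lambda>z. (z\<^sup>2 - (2 * (y / s)) * z) + (y / s)\<^sup>2 * 1) y"
    by (subst N_add, (intro continuous_intros)+, subst N_diff, (intro continuous_intros)+, simp only: N_cmult)
  also have "\<dots> \<le> N (\<lambda>z. (H / s)\<^sup>2 * 1) y"
  proof (rule N_mono)
    fix h :: real assume h: "\<bar>h\<bar> \<le> H"
    have "((y - h) / s)\<^sup>2 - 2 * (y / s) * ((y - h) / s) + (y / s)\<^sup>2 * 1 = (h / s)\<^sup>2"
      by (simp add: diff_divide_distrib power2_eq_square algebra_simps)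
    also have "\<dots> \<le> (H / s)\<^sup>2 * 1"
      using s_pos H_nonneg h by (auto simp: abs_le_square_iff[symmetric] divide_right_mono)
    finally show "((y - h) / s)\<^sup>2 - 2 * (y / s) * ((y - h) / s) + (y / s)\<^sup>2 * 1 \<le> (H / s)\<^sup>2 * 1" .
  qed (intro continuous_intros)+
  finally show ?thesis using m_pos[of y] by (simp only: N_cmult) (simp add: mult.commute)
qed

section \<open>Averages over the marginal law of the observation\<close>

lemma integrable_m: "integrable lborel m" and integral_m: "(\<integral>y. m y \<partial>lborel) = 1"
  using N_integral[of "\<lambda>_. 1"] std_normal_moment_even[of 0]
  by (auto simp: has_bochner_integral_iff)

lemma measurable_W [measurable]: "W \<in> borel_measurable borel"
  unfolding W_def[abs_def] by measurable

lemma gaussian_expectation_eq: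
  assumes [measurable]: "g \<in> borel_measurable borel" and B: "\<And>y. \<bar>g y\<bar> \<le> B"
  shows "gaussian_expectation v \<pi> g = (\<integral>y. m y * g y \<partial>lborel)"
proof -
  interpret P: pair_sigma_finite \<pi> lborel by standard
  let ?F = "\<lambda>(h, y). normal_density h s y * g y"
  have dens: "integrable lborel (normal_density h s)" "(\<integral>y. normal_density h s y \<partial>lborel) = 1" for h
    using s_pos by (auto simp: integrable_normal_density integral_normal_density)
  have bd: "norm (normal_density h s y * g y) \<le> B * normal_density h s y" for h y
    using mult_right_mono[OF B[of y], of "normal_density h s y"] s_pos by (simp add: abs_mult mult.commute)
  have "norm (normal_density h s y * g y) \<le> norm (B * normal_density h s y)" for h y
    using bd[of h y] by simp
  then have i: "integrable lborel (\<lambda>y. normal_density h s y * g y)" for h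
    by (intro Bochner_Integration.integrable_bound[of _ "\<lambda>y. B * normal_density h s y" "\<lambda>y. normal_density h s y * g y"])
       (auto simp: dens)
  have le: "(\<integral>y. norm (normal_density h s y * g y) \<partial>lborel) \<le> B" for h
  proof -
    have "(\<integral>y. norm (normal_density h s y * g y) \<partial>lborel) \<le> (\<integral>y. B * normal_density h s y \<partial>lborel)"
      by (rule integral_mono) (use i dens bd in auto)
    then show ?thesis by (simp add: dens)
  qed
  have I: "integrable (\<pi> \<Otimes>\<^sub>M lborel) ?F"
  proof (rule P.Fubini_integrable)
    show M: "?F \<in> borel_measurable (\<pi> \<Otimes>\<^sub>M lborel)" unfolding normal_density_def by measurable
    show "AE h in \<pi>. integrable lborel (\<lambda>y. ?F (h, y))" using i by simp
    show "integrable \<pi> (\<lambda>h. \<integral>y. norm (?F (h, y)) \<partial>lborel)"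
    proof (rule integrable_const_bound[of _ B])
      show "AE h in \<pi>. norm (\<integral>y. norm (?F (h, y)) \<partial>lborel) \<le> B"
        using le by (intro AE_I2) (simp add: integral_nonneg_AE)
      show "(\<lambda>h. \<integral>y. norm (?F (h, y)) \<partial>lborel) \<in> borel_measurable \<pi>"
        using M by measurable
    qed
  qed
  have "gaussian_expectation v \<pi> g = (\<integral>h. \<integral>y. ?F (h, y) \<partial>lborel \<partial>\<pi>)"
    unfolding gaussian_expectation_def gaussian_shift_def s_def[symmetric]
  proof (rule Bochner_Integration.integral_cong[OF refl])
    fix h
    show "(\<integral>y. g y \<partial>density lborel (\<lambda>y. ennreal (normal_density h s y))) = (\<integral>y. ?F (h, y) \<partial>lborel)"
      by (subst integral_density) (use s_pos in auto)
  qed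
  also have "\<dots> = (\<integral>y. \<integral>h. ?F (h, y) \<partial>\<pi> \<partial>lborel)"
    using P.Fubini_integral[OF I] by simp
  also have "\<dots> = (\<integral>y. m y * g y \<partial>lborel)" by (simp add: N_def)
  finally show ?thesis .
qed

text \<open>Both are normalised by \<open>v\<close>: \<open>v * EW\<close> is the risk of the
  posterior mean, and \<open>EW2\<close> is the functional to which the transfer assumption compares
  the derivative of the risk.\<close>

definition EW :: real where "EW = (\<integral>y. m y * W y \<partial>lborel)"
definition EW2 :: real where "EW2 = (\<integral>y. m y * (W y)\<^sup>2 \<partial>lborel)"

lemma expectation_variance_sq:
  "gaussian_expectation v \<pi> (\<lambda>y. (gaussian_posterior_variance v \<pi> y / v)\<^sup>2) = EW2"
proof -
  have "\<bar>(W y)\<^sup>2\<bar> \<le> ((H / s)\<^sup>2)\<^sup>2" for y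
    using W_bounded[of y] W_nonneg[of y] power_mono[of "W y" "(H / s)\<^sup>2" 2] by simp
  then show ?thesis using v_pos
    by (simp add: posterior_variance EW2_def gaussian_expectation_eq[of "\<lambda>y. (W y)\<^sup>2" "((H / s)\<^sup>2)\<^sup>2"])
qed

text \<open>The bound \<open>W \<le> (H / s)^2\<close> grows with \<open>H\<close>; it supplies
  integrability here and enters no quantitative estimate.\<close>

lemma integrable_mW: "integrable lborel (\<lambda>y. m y * W y)" "integrable lborel (\<lambda>y. m y * (W y)\<^sup>2)"
proof -
  have *: "integrable lborel (\<lambda>y. m y * g y)"
    if [measurable]: "g \<in> borel_measurable borel" and g: "\<And>y. \<bar>g y\<bar> \<le> B" for g :: "real \<Rightarrow> real" and B
  proof (rule Bochner_Integration.integrable_bound[of _ "\<lambda>y. m y * B"])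
    show "AE y in lborel. norm (m y * g y) \<le> norm (m y * B)"
    proof (rule AE_I2)
      fix y
      have "\<bar>m y\<bar> * \<bar>g y\<bar> \<le> \<bar>m y\<bar> * \<bar>B\<bar>"
        using g[of y] by (intro mult_left_mono) auto
      then show "norm (m y * g y) \<le> norm (m y * B)" by (simp add: abs_mult)
    qed
  qed (use integrable_m in auto)
  have W: "\<bar>W y\<bar> \<le> (H / s)\<^sup>2" for y
    using W_bounded[of y] W_nonneg[of y] by simp
  show "integrable lborel (\<lambda>y. m y * W y)" by (rule *[OF _ W]) measurable
  have "\<bar>(W y)\<^sup>2\<bar> \<le> ((H / s)\<^sup>2)\<^sup>2" for y
    using power_mono[OF W[of y], of 2] by simp
  then show "integrable lborel (\<lambda>y. m y * (W y)\<^sup>2)" by (intro *) measurable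
qed

text \<open>This is \<open>(W - 1)^2 \<ge> 0\<close>, averaged. The opposite bound is the hard one,
  since \<open>EW\<close> near 1 does not exclude large values of \<open>W\<close> on a set of small
  probability.\<close>

lemma EW2_lower: "2 * EW - 1 \<le> EW2"
proof -
  have "2 * EW - 1 = (\<integral>y. 2 * (m y * W y) - m y \<partial>lborel)"
    using integrable_mW integrable_m by (simp add: EW_def integral_m)
  also have "\<dots> \<le> EW2" unfolding EW2_def
  proof (rule integral_mono)
    fix y
    have "0 \<le> m y * (W y - 1)\<^sup>2" using m_pos[of y] by simp
    then show "2 * (m y * W y) - m y \<le> m y * (W y)\<^sup>2" by (simp add: power2_eq_square algebra_simps)
  qed (use integrable_mW integrable_m in auto)
  finally show ?thesis .
qed

text \<open>The posterior mean \<open>T\<close> is one of the competing estimators. It is this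
  direction that makes a large Bayes risk force a large \<open>EW\<close>.\<close>

lemma bayes_risk_le_EW: "gaussian_bayes_risk v \<pi> \<le> ennreal (v * EW)"
proof -
  interpret P: pair_sigma_finite \<pi> lborel by standard
  define T where "T y = y - s * (N1 y / m y)" for y
  have [measurable]: "T \<in> borel_measurable borel" unfolding T_def[abs_def] by measurable
  have T: "T \<in> borel_measurable (gaussian_shift v 0)"
    by (simp add: gaussian_shift_def)
  have "gaussian_bayes_risk v \<pi> \<le> (\<integral>\<^sup>+h. (\<integral>\<^sup>+y. ennreal ((T y - h)\<^sup>2) \<partial>gaussian_shift v h) \<partial>\<pi>)"
    unfolding gaussian_bayes_risk_def bayes_risk_def by (rule INF_lower[OF T])
  also have "\<dots> = (\<integral>\<^sup>+h. \<integral>\<^sup>+y. ennreal ((T y - h)\<^sup>2 * normal_density h s y) \<partial>lborel \<partial>\<pi>)"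
    unfolding gaussian_shift_def s_def[symmetric]
    by (intro nn_integral_cong, subst nn_integral_density)
       (use s_pos in \<open>auto simp: ennreal_mult[symmetric] mult.commute\<close>)
  also have "\<dots> = (\<integral>\<^sup>+y. \<integral>\<^sup>+h. ennreal ((T y - h)\<^sup>2 * normal_density h s y) \<partial>\<pi> \<partial>lborel)"
    by (rule P.Fubini'[symmetric]) (unfold normal_density_def, measurable)
  also have "\<dots> = (\<integral>\<^sup>+y. ennreal (v * (m y * W y)) \<partial>lborel)"
  proof (intro nn_integral_cong)
    fix y
    have "(T y - h)\<^sup>2 = v * ((y - h) / s - N1 y / m y)\<^sup>2" for h
    proof -
      have "T y - h = s * ((y - h) / s - N1 y / m y)"
        unfolding right_diff_distrib using s_pos by (simp add: T_def)
      then show ?thesis by (simp only: power_mult_distrib s_sq)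
    qed
    note T_sq = this
    have "(\<integral>h. (T y - h)\<^sup>2 * normal_density h s y \<partial>\<pi>) = N (\<lambda>z. v * (z - N1 y / m y)\<^sup>2) y"
      unfolding N_def[of "\<lambda>z. v * (z - N1 y / m y)\<^sup>2"] by (simp only: T_sq)
    then have e: "(\<integral>h. (T y - h)\<^sup>2 * normal_density h s y \<partial>\<pi>) = v * (m y * W y)"
      by (simp add: N_cmult N_centered_sq)
    show "(\<integral>\<^sup>+h. ennreal ((T y - h)\<^sup>2 * normal_density h s y) \<partial>\<pi>) = ennreal (v * (m y * W y))"
      unfolding e[symmetric]
    proof (rule nn_integral_eq_integral)
      show "integrable \<pi> (\<lambda>h. (T y - h)\<^sup>2 * normal_density h s y)"
        by (rule integrable_prior) (intro continuous_on_mult continuous_on_power continuous_on_diff continuous_on_const continuous_on_id cont_density)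
    qed (use s_pos in auto)
  qed
  also have "\<dots> = ennreal (\<integral>y. v * (m y * W y) \<partial>lborel)"
    by (rule nn_integral_eq_integral)
       (use integrable_mW v_pos W_nonneg m_pos[THEN less_imp_le] in auto)
  also have "\<dots> = ennreal (v * EW)" by (simp add: EW_def)
  finally show ?thesis .
qed

section \<open>Hermite means and the integration by parts\<close>

definition a1 :: "real \<Rightarrow> real" where "a1 y = N1 y / m y"
definition a2 :: "real \<Rightarrow> real" where "a2 y = N2 y / m y"
definition a3 :: "real \<Rightarrow> real" where "a3 y = N3 y / m y"

text \<open>Up to the factor \<open>- s\<close> this is \<open>m * a1 * a2\<close>. Differentiating
  \<open>N1\<close> produces \<open>m * a2^2\<close>, while \<open>a2' = (a1 * a2 - a3) / s\<close>
  keeps the factor \<open>a1\<close> in the two remaining terms of \<open>G'\<close>.\<close>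

definition G :: "real \<Rightarrow> real" where "G y = - s * (N1 y * a2 y)"
definition G' :: "real \<Rightarrow> real" where "G' y = m y * ((a2 y)\<^sup>2 + a1 y * a3 y - (a1 y)\<^sup>2 * a2 y)"

lemma DERIV_m: "(m has_real_derivative - N1 y / s) (at y)"
  using DERIV_N[of "\<lambda>_. 1" "\<lambda>_. 0" y] N_cmult[of "-1" "\<lambda>z. z" y] by simp

lemma DERIV_N1: "(N1 has_real_derivative - N2 y / s) (at y)"
proof -
  have "(N1 has_real_derivative N (\<lambda>z. 1 - z * z) y / s) (at y)"
    by (rule DERIV_N) (auto intro!: continuous_intros)
  moreover have "N (\<lambda>z. 1 - z * z) y = - N2 y"
    using N_cmult[of "-1" "\<lambda>z. z\<^sup>2 - 1" y] by (simp add: power2_eq_square)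
  ultimately show ?thesis by simp
qed

lemma DERIV_N2: "(N2 has_real_derivative - N3 y / s) (at y)"
proof -
  have "(N2 has_real_derivative N (\<lambda>z. 2 * z - z * (z\<^sup>2 - 1)) y / s) (at y)"
    by (rule DERIV_N) (auto intro!: continuous_intros derivative_eq_intros)
  moreover have "(\<lambda>z::real. 2 * z - z * (z\<^sup>2 - 1)) = (\<lambda>z. (-1) * (z ^ 3 - 3 * z))"
    by (auto simp: power2_eq_square power3_eq_cube algebra_simps)
  ultimately show ?thesis by (simp only: N_cmult) simp
qed

lemma cont_N: "continuous_on UNIV N1" "continuous_on UNIV N2" "continuous_on UNIV N3" "continuous_on UNIV m"
proof -
  have "((N3) has_real_derivative N (\<lambda>z. (3 * z\<^sup>2 - 3) - z * (z ^ 3 - 3 * z)) y / s) (at y)" for y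
    by (rule DERIV_N) (auto intro!: continuous_intros derivative_eq_intros)
  then show "continuous_on UNIV N3"
    by (rule DERIV_continuous_on)
  show "continuous_on UNIV N1" "continuous_on UNIV N2" "continuous_on UNIV m"
    by (rule DERIV_continuous_on, (rule DERIV_m DERIV_N1 DERIV_N2))+
qed

lemma DERIV_G: "(G has_real_derivative G' y) (at y)"
proof -
  have "((\<lambda>y. - s * (N1 y * (N2 y / m y))) has_real_derivative
      - s * ((- N2 y / s) * (N2 y / m y) + N1 y * (((- N3 y / s) * m y - N2 y * (- N1 y / s)) / (m y * m y)))) (at y)"
    using m_pos[of y]
    by (intro DERIV_cmult DERIV_cong[OF DERIV_mult[OF DERIV_N1 DERIV_divide[OF DERIV_N2 DERIV_m]]]) simp_all
  moreover have "- s * ((- p2 / s) * (p2 / q) + p1 * (((- p3 / s) * q - p2 * (- p1 / s)) / (q * q)))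
      = q * ((p2 / q)\<^sup>2 + p1 / q * (p3 / q) - (p1 / q)\<^sup>2 * (p2 / q))" if "0 < q" for p1 p2 p3 q
    using that s_pos by (simp add: field_simps power2_eq_square)
  note this[OF m_pos, of "N2 y" y "N1 y" "N3 y"]
  ultimately show ?thesis by (simp add: G_def[abs_def] G'_def a1_def a2_def a3_def)
qed

lemma cont_G': "isCont G' y"
proof -
  have "m y \<noteq> 0" for y using m_pos[of y] by simp
  then have "continuous_on UNIV G'"
    unfolding G'_def[abs_def] a1_def a2_def a3_def by (intro continuous_intros cont_N) auto
  then show ?thesis by (simp add: continuous_on_eq_continuous_at)
qed

text \<open>Jensen's inequality for the conditional expectation given \<open>y\<close>, multiplied
  by \<open>m y\<close>. The fourth power comes from using the square case for \<open>f\<close> and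
  then for its square.\<close>

lemma m_sq_le:
  assumes f: "continuous_on UNIV f"
  shows "m y * (N f y / m y)\<^sup>2 \<le> N (\<lambda>z. (f z)\<^sup>2) y"
    and "m y * (N f y / m y) ^ 4 \<le> N (\<lambda>z. (f z) ^ 4) y"
proof -
  have f2: "continuous_on UNIV (\<lambda>z. (f z)\<^sup>2)" by (intro continuous_on_power f)
  have *: "m y * (N g y / m y)\<^sup>2 \<le> N (\<lambda>z. (g z)\<^sup>2) y" if "continuous_on UNIV g" for g
  proof -
    have "q * (p / q)\<^sup>2 \<le> r" if "p\<^sup>2 \<le> q * r" "0 < q" for p q r :: real
      using that by (simp add: power2_eq_square field_simps)
    from this[OF N_Cauchy_Schwarz[OF that] m_pos] show ?thesis .
  qed
  show 1: "m y * (N f y / m y)\<^sup>2 \<le> N (\<lambda>z. (f z)\<^sup>2) y" by (rule *[OF f])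
  then have "(N f y / m y)\<^sup>2 \<le> N (\<lambda>z. (f z)\<^sup>2) y / m y"
    using m_pos[of y] by (simp add: field_simps)
  then have "((N f y / m y)\<^sup>2)\<^sup>2 \<le> (N (\<lambda>z. (f z)\<^sup>2) y / m y)\<^sup>2" by (rule power_mono) simp
  then have "m y * ((N f y / m y)\<^sup>2)\<^sup>2 \<le> m y * (N (\<lambda>z. (f z)\<^sup>2) y / m y)\<^sup>2"
    using m_pos[of y] by simp
  also have "\<dots> \<le> N (\<lambda>z. ((f z)\<^sup>2)\<^sup>2) y" by (rule *[OF f2])
  finally show "m y * (N f y / m y) ^ 4 \<le> N (\<lambda>z. (f z) ^ 4) y" by simp
qed

text \<open>Each right side integrates to a moment of the standard normal law, by
  \<open>N_integral\<close>, whatever the prior.\<close>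

lemma a_bounds:
  shows "m y * (a1 y)\<^sup>2 \<le> N (\<lambda>z. z\<^sup>2) y" "m y * (a1 y) ^ 4 \<le> N (\<lambda>z. z ^ 4) y"
    "m y * (a2 y)\<^sup>2 \<le> N (\<lambda>z. (z\<^sup>2 - 1)\<^sup>2) y" "m y * (a2 y) ^ 4 \<le> N (\<lambda>z. (z\<^sup>2 - 1) ^ 4) y"
    "m y * (a3 y)\<^sup>2 \<le> N (\<lambda>z. (z ^ 3 - 3 * z)\<^sup>2) y"
  using m_sq_le[of "\<lambda>z. z" y] m_sq_le[of "\<lambda>z. z\<^sup>2 - 1" y] m_sq_le[of "\<lambda>z. z ^ 3 - 3 * z" y]
  unfolding a1_def a2_def a3_def by (simp_all add: continuous_intros)

lemma N_poly_bound:
  fixes c\<^sub>0 c\<^sub>2 c\<^sub>4 c\<^sub>6 c\<^sub>8 :: real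
  defines "S \<equiv> (\<lambda>z. c\<^sub>0 + c\<^sub>2 * z\<^sup>2 + c\<^sub>4 * z ^ 4 + c\<^sub>6 * z ^ 6 + c\<^sub>8 * z ^ 8)"
  shows "integrable lborel (N S)"
    and "(\<integral>y. N S y \<partial>lborel) = c\<^sub>0 + c\<^sub>2 + 3 * c\<^sub>4 + 15 * c\<^sub>6 + 105 * c\<^sub>8"
proof -
  have c: "continuous_on UNIV S" unfolding S_def by (intro continuous_intros)
  note * = std_normal_even_poly[of c\<^sub>0 c\<^sub>2 c\<^sub>4 c\<^sub>6 c\<^sub>8, folded S_def]
  have "(\<lambda>x. std_normal_density x * S x) = (\<lambda>x. std_normal_density x * (c\<^sub>0 + c\<^sub>2 * x\<^sup>2 + c\<^sub>4 * x ^ 4 + c\<^sub>6 * x ^ 6 + c\<^sub>8 * x ^ 8))"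
    by (simp add: S_def)
  with * have "has_bochner_integral lborel (\<lambda>x. std_normal_density x * S x) (c\<^sub>0 + c\<^sub>2 + 3 * c\<^sub>4 + 15 * c\<^sub>6 + 105 * c\<^sub>8)"
    by simp
  then show "integrable lborel (N S)"
    "(\<integral>y. N S y \<partial>lborel) = c\<^sub>0 + c\<^sub>2 + 3 * c\<^sub>4 + 15 * c\<^sub>6 + 105 * c\<^sub>8"
    using N_integral[OF c] by (auto simp: has_bochner_integral_iff)
qed

lemma integrable_G': "integrable lborel G'"
proof -
  \<comment> \<open>The polynomial combines
    \<open>\<bar>a1 * a3\<bar> \<le> (a1^2 + a3^2) / 2\<close> and
    \<open>\<bar>a1^2 * a2\<bar> \<le> (a1^4 + a2^2) / 2\<close> with the term \<open>a2^2\<close>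
    itself, whence the weight 3/2 on the second Hermite polynomial and 1/2 elsewhere.\<close>
  let ?S = "\<lambda>z::real. 3/2 + 2 * z\<^sup>2 + (-1) * z ^ 4 + 1/2 * z ^ 6 + 0 * z ^ 8"
  have S: "?S = (\<lambda>z. 3/2 * (z\<^sup>2 - 1)\<^sup>2 + (1/2 * (z\<^sup>2) + (1/2 * (z ^ 3 - 3 * z)\<^sup>2 + 1/2 * z ^ 4)))"
    by (auto simp: power2_eq_square power3_eq_cube eval_nat_numeral algebra_simps)
  have "N ?S y = 3/2 * N (\<lambda>z. (z\<^sup>2 - 1)\<^sup>2) y + (1/2 * N (\<lambda>z. z\<^sup>2) y + (1/2 * N (\<lambda>z. (z ^ 3 - 3 * z)\<^sup>2) y + 1/2 * N (\<lambda>z. z ^ 4) y))" for y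
    unfolding S by (subst N_add, (intro continuous_intros)+)+ (simp only: N_cmult)
  then have NS: "3/2 * (m y * (a2 y)\<^sup>2) + (1/2 * (m y * (a1 y)\<^sup>2) + (1/2 * (m y * (a3 y)\<^sup>2) + 1/2 * (m y * a1 y ^ 4))) \<le> N ?S y" for y
    using a_bounds[of y] by simp
  have "\<bar>G' y\<bar> \<le> N ?S y" for y
  proof -
    have "\<bar>x\<^sup>2 + w * u - w\<^sup>2 * x\<bar> \<le> 3/2 * x\<^sup>2 + (1/2 * w\<^sup>2 + (1/2 * u\<^sup>2 + 1/2 * w ^ 4))" for x w u :: real
    proof -
      have "\<bar>w * u\<bar> \<le> w\<^sup>2 / 2 + u\<^sup>2 / 2"
        using weighted_AM_GM[of 1 "\<bar>w\<bar>" "\<bar>u\<bar>"] by (simp add: abs_mult)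
      moreover have "\<bar>w\<^sup>2 * x\<bar> \<le> w ^ 4 / 2 + x\<^sup>2 / 2"
        using weighted_AM_GM[of 1 "w\<^sup>2" "\<bar>x\<bar>"] by (simp add: abs_mult)
      moreover have "0 \<le> x\<^sup>2" by simp
      ultimately show ?thesis by linarith
    qed
    then have "m y * \<bar>(a2 y)\<^sup>2 + a1 y * a3 y - (a1 y)\<^sup>2 * a2 y\<bar>
       \<le> m y * (3/2 * (a2 y)\<^sup>2 + (1/2 * (a1 y)\<^sup>2 + (1/2 * (a3 y)\<^sup>2 + 1/2 * a1 y ^ 4)))"
      using m_pos[of y] by (intro mult_left_mono) auto
    also have "\<dots> \<le> N ?S y" using NS[of y] by (simp add: algebra_simps)
    finally show ?thesis using m_pos[of y] by (simp add: G'_def abs_mult)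
  qed
  then have "norm (G' y) \<le> norm (N ?S y)" for y
    unfolding real_norm_def by (rule order_trans) (rule abs_ge_self)
  moreover have "G' \<in> borel_measurable lborel"
    using cont_G' by (simp add: borel_measurable_continuous_onI continuous_at_imp_continuous_on)
  moreover have "integrable lborel (N ?S)" by (rule N_poly_bound(1))
  ultimately show ?thesis
    by (intro Bochner_Integration.integrable_bound[of lborel "N ?S" G'] AE_I2)
qed

lemma N_abs_le:
  assumes f: "continuous_on UNIV f" and B: "\<And>h. \<bar>h\<bar> \<le> H \<Longrightarrow> \<bar>f ((y - h) / s)\<bar> \<le> B"
  shows "\<bar>N f y\<bar> \<le> B * m y"
proof -
  have "N f y \<le> N (\<lambda>_. B * 1) y"
  proof (rule N_mono[OF f continuous_on_const])
    fix h assume "\<bar>h\<bar> \<le> H"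
    from B[OF this] show "f ((y - h) / s) \<le> B * 1" by linarith
  qed
  moreover have "N (\<lambda>_. (-B) * 1) y \<le> N f y"
  proof (rule N_mono[OF continuous_on_const f])
    fix h assume "\<bar>h\<bar> \<le> H"
    from B[OF this] show "- B * 1 \<le> f ((y - h) / s)" by linarith
  qed
  ultimately show ?thesis unfolding N_cmult[of B "\<lambda>_. 1"] N_cmult[of "-B" "\<lambda>_. 1"] by (simp add: abs_le_iff)
qed

text \<open>For \<open>y\<close> outside the support every \<open>h\<close> is at distance at least
  \<open>\<bar>y\<bar> - H\<close> from \<open>y\<close>, so the marginal density is at most the
  normal density centred at the nearer endpoint, reflected to \<open>H\<close>. The standardised
  noise is at most \<open>(\<bar>y\<bar> + H) / s\<close>, so the Hermite means grow only
  polynomially and the boundary terms vanish.\<close>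

lemma G_bound:
  assumes "H \<le> \<bar>y\<bar>"
  shows "\<bar>G y\<bar> \<le> s * ((\<bar>y\<bar> + H) / s) * (((\<bar>y\<bar> + H) / s)\<^sup>2 + 1) * normal_density H s \<bar>y\<bar>"
proof -
  let ?Z = "(\<bar>y\<bar> + H) / s"
  have Z: "\<bar>(y - h) / s\<bar> \<le> ?Z" if "\<bar>h\<bar> \<le> H" for h
  proof -
    have "\<bar>y - h\<bar> \<le> \<bar>y\<bar> + H" using that by linarith
    then show ?thesis using s_pos by (simp add: divide_right_mono)
  qed
  have Z0: "0 \<le> ?Z" using H_nonneg s_pos by simp
  have 1: "\<bar>N1 y\<bar> \<le> ?Z * m y" by (rule N_abs_le[OF continuous_on_id Z])
  have "\<bar>N2 y\<bar> \<le> (?Z\<^sup>2 + 1) * m y"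
  proof (rule N_abs_le)
    fix h assume "\<bar>h\<bar> \<le> H"
    from power_mono[OF Z[OF this], of 2] show "\<bar>((y - h) / s)\<^sup>2 - 1\<bar> \<le> ?Z\<^sup>2 + 1"
      by (simp only: power2_abs) (smt (verit) zero_le_power2)
  qed (intro continuous_intros)
  then have 2: "\<bar>a2 y\<bar> \<le> ?Z\<^sup>2 + 1"
    using m_pos[of y] by (simp add: a2_def abs_divide pos_divide_le_eq)
  have "m y \<le> (\<integral>h. normal_density H s \<bar>y\<bar> \<partial>\<pi>)"
    unfolding N_def
  proof (rule integral_mono_AE)
    show "AE h in \<pi>. 1 * normal_density h s y \<le> normal_density H s \<bar>y\<bar>"
    proof (rule AE_I2)
      fix h assume "h \<in> space \<pi>"
      then have "\<bar>h\<bar> \<le> H" by (auto simp: space_prior)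
      then have "\<bar>\<bar>y\<bar> - H\<bar> \<le> \<bar>y - h\<bar>" using assms by linarith
      then have "(\<bar>y\<bar> - H)\<^sup>2 \<le> (y - h)\<^sup>2" by (simp add: abs_le_square_iff)
      then show "1 * normal_density h s y \<le> normal_density H s \<bar>y\<bar>"
        using s_pos by (auto simp: normal_density_def intro!: divide_right_mono)
    qed
  qed (use integrable_N[of "\<lambda>_. 1"] in auto)
  then have 3: "m y \<le> normal_density H s \<bar>y\<bar>" by (simp add: prob_space)
  have "\<bar>G y\<bar> = s * (\<bar>N1 y\<bar> * \<bar>a2 y\<bar>)" using s_pos by (simp add: G_def abs_mult)
  also have "\<dots> \<le> s * ((?Z * m y) * (?Z\<^sup>2 + 1))"
    using s_pos 1 2 Z0 m_pos[of y] by (intro mult_left_mono mult_mono) auto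
  also have "\<dots> = s * ?Z * (?Z\<^sup>2 + 1) * m y" by simp
  also have "\<dots> \<le> s * ?Z * (?Z\<^sup>2 + 1) * normal_density H s \<bar>y\<bar>"
    using s_pos Z0 3 by (intro mult_left_mono mult_nonneg_nonneg) auto
  finally show ?thesis .
qed

lemma G_tendsto: "(G \<longlongrightarrow> 0) at_top" "(G \<longlongrightarrow> 0) at_bot"
proof -
  let ?B = "\<lambda>y. s * ((y + H) / s) * (((y + H) / s)\<^sup>2 + 1) * normal_density H s y"
  have lim: "(?B \<longlongrightarrow> 0) at_top"
    by (rule poly_normal_density_tendsto_0[OF s_pos H_nonneg])
  show "(G \<longlongrightarrow> 0) at_top"
  proof (rule Lim_null_comparison[OF _ lim])
    show "eventually (\<lambda>y. norm (G y) \<le> ?B y) at_top"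
      using eventually_ge_at_top[of H]
    proof eventually_elim
      case (elim y) then show ?case using G_bound[of y] H_nonneg by simp
    qed
  qed
  show "(G \<longlongrightarrow> 0) at_bot" unfolding filterlim_at_bot_mirror
  proof (rule Lim_null_comparison[OF _ lim])
    show "eventually (\<lambda>y. norm (G (-y)) \<le> ?B y) at_top"
      using eventually_ge_at_top[of H]
    proof eventually_elim
      case (elim y) then show ?case using G_bound[of "-y"] H_nonneg by simp
    qed
  qed
qed

lemma integral_G': "(\<integral>y. G' y \<partial>lborel) = 0"
  by (rule FTC_integral_whole_line_zero[OF DERIV_G cont_G' integrable_G' G_tendsto])

text \<open>The integration by parts \<open>\<integral> G' = 0\<close> trades \<open>\<integral> m a2\<^sup>2\<close> for products containing the factor \<open>a1\<close>,
  whose second moment is \<open>1 - EW\<close>.\<close>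

lemma EW2_upper:
  assumes t: "0 < t"
  shows "EW2 \<le> 1 + t * (1 - EW) + 19 / t"
proof -
  \<comment> \<open>The coefficient opposite to \<open>t / 2\<close> in Young's inequality.\<close>
  define c where "c = 1 / (2 * t)"
  let ?S = "\<lambda>z::real. (-1 + c / 2) + (2 + t + 7 * c) * z\<^sup>2 + (- (5/2) * c) * z ^ 4 + (- c) * z ^ 6 + (c / 2) * z ^ 8"
  have c: "0 < c" using t by (simp add: c_def)
  have S: "?S = (\<lambda>z. 1 + (2 * (z\<^sup>2 - 1) + (t * z\<^sup>2 + (c * (z ^ 3 - 3 * z)\<^sup>2 + (c / 2 * z ^ 4 + c / 2 * (z\<^sup>2 - 1) ^ 4)))))"
    by (rule ext) (rule hermite_moment_polynomial)
  have NS: "N ?S y = m y + (2 * N2 y + (t * N (\<lambda>z. z\<^sup>2) y + (c * N (\<lambda>z. (z ^ 3 - 3 * z)\<^sup>2) y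
      + (c / 2 * N (\<lambda>z. z ^ 4) y + c / 2 * N (\<lambda>z. (z\<^sup>2 - 1) ^ 4) y))))" for y
    unfolding S by (subst N_add, (intro continuous_intros)+)+ (simp only: N_cmult)
  \<comment> \<open>From \<open>0 \<le> W \<le> 1 + a2\<close> one gets
    \<open>W^2 \<le> (1 + a2)^2\<close>, and its term \<open>a2^2\<close> is exchanged for
    \<open>G' / m\<close> plus two products containing \<open>a1\<close>. Young's inequality charges
    \<open>t * a1^2 / 2\<close> to each of them; the total \<open>t * m * a1^2\<close> is
    \<open>t * N (\<lambda>z. z^2) - t * m * W\<close>, which explains the second term on the
    left.\<close>
  have le: "m y * (W y)\<^sup>2 + t * (m y * W y) \<le> G' y + N ?S y" for y
  proof -
    have W: "W y = 1 + a2 y - (a1 y)\<^sup>2" by (simp add: W_def a1_def a2_def)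
    have "(W y)\<^sup>2 \<le> (1 + a2 y)\<^sup>2" using W_nonneg[of y] by (intro power_mono) (auto simp: W)
    moreover have "- (a1 y * a3 y) \<le> t * (a1 y)\<^sup>2 / 2 + c * (a3 y)\<^sup>2"
      using weighted_AM_GM[OF t, of "a1 y" "- a3 y"] by (simp add: c_def)
    moreover have "(a1 y)\<^sup>2 * a2 y \<le> t * (a1 y)\<^sup>2 / 2 + c * (a1 y * a2 y)\<^sup>2"
      using weighted_AM_GM[OF t, of "a1 y" "a1 y * a2 y"] by (simp add: c_def power2_eq_square mult.assoc)
    moreover have "c * (a1 y * a2 y)\<^sup>2 \<le> c * ((a1 y) ^ 4 / 2 + (a2 y) ^ 4 / 2)"
      using weighted_AM_GM[of 1 "(a1 y)\<^sup>2" "(a2 y)\<^sup>2"] c by (intro mult_left_mono) (auto simp: power_mult_distrib)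
    moreover have "(1 + a2 y)\<^sup>2 = 1 + 2 * a2 y + (a2 y)\<^sup>2" by (simp add: power2_eq_square algebra_simps)
    ultimately have "(W y)\<^sup>2 - t * (a1 y)\<^sup>2 \<le> ((a2 y)\<^sup>2 + a1 y * a3 y - (a1 y)\<^sup>2 * a2 y) + 1 + 2 * a2 y
        + c * (a3 y)\<^sup>2 + c / 2 * a1 y ^ 4 + c / 2 * a2 y ^ 4" by (simp add: distrib_left)
    then have "m y * ((W y)\<^sup>2 - t * (a1 y)\<^sup>2) \<le> m y * (((a2 y)\<^sup>2 + a1 y * a3 y - (a1 y)\<^sup>2 * a2 y) + 1 + 2 * a2 y
        + c * (a3 y)\<^sup>2 + c / 2 * a1 y ^ 4 + c / 2 * a2 y ^ 4)"
      using m_pos[of y] by (intro mult_left_mono) auto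
    also have "\<dots> = G' y + (m y + (2 * (m y * a2 y) + (c * (m y * (a3 y)\<^sup>2)
      + (c / 2 * (m y * a1 y ^ 4) + c / 2 * (m y * a2 y ^ 4)))))"
      unfolding G'_def by (simp add: algebra_simps)
    also have "\<dots> \<le> G' y + (m y + (2 * N2 y + (c * N (\<lambda>z. (z ^ 3 - 3 * z)\<^sup>2) y
      + (c / 2 * N (\<lambda>z. z ^ 4) y + c / 2 * N (\<lambda>z. (z\<^sup>2 - 1) ^ 4) y))))"
      using a_bounds[of y] c m_pos[of y] by (intro add_mono mult_left_mono) (auto simp: a2_def)
    finally have "m y * (W y)\<^sup>2 - t * (m y * (a1 y)\<^sup>2) \<le> G' y + N ?S y - t * N (\<lambda>z. z\<^sup>2) y"
      unfolding NS by (simp add: algebra_simps)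
    then show ?thesis unfolding mW_eq a1_def[symmetric] by (simp add: algebra_simps)
  qed
  \<comment> \<open>The Hermite term \<open>2 * (z^2 - 1)\<close> has mean 0. The number 75/2 is 6 +
    3/2 + 30, from the squared third Hermite polynomial, half of \<open>z^4\<close> and half of
    \<open>(z^2 - 1)^4\<close>. With \<open>c = 1 / (2 * t)\<close> it becomes 18.75 / t, rounded up
    to 19 / t below.\<close>
  have I: "integrable lborel (N ?S)" "(\<integral>y. N ?S y \<partial>lborel) = 1 + t + 75 / 2 * c"
    by (rule N_poly_bound(1)) (subst N_poly_bound(2), simp add: algebra_simps)
  have "EW2 + t * EW = (\<integral>y. m y * (W y)\<^sup>2 + t * (m y * W y) \<partial>lborel)"
    using integrable_mW by (simp add: EW2_def EW_def)
  also have "\<dots> \<le> (\<integral>y. G' y + N ?S y \<partial>lborel)"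
    by (rule integral_mono) (use integrable_mW integrable_G' I(1) le in auto)
  also have "\<dots> = 1 + t + 75 / 2 * c"
    using integrable_G' I by (simp only: Bochner_Integration.integral_add integral_G')
  also have "75 / 2 * c \<le> 19 / t" using t by (simp add: c_def divide_simps)
  finally show ?thesis by (simp add: algebra_simps)
qed

end

section \<open>A lower bound for the Gaussian minimax risk\<close>

lemma nn_integral_Icc_FTC:
  fixes f F :: "real \<Rightarrow> real"
  assumes ab: "a \<le> b" and F: "\<And>x. (F has_real_derivative f x) (at x)"
    and f: "continuous_on {a..b} f" and nonneg: "\<And>x. 0 \<le> f x"
  shows "(\<integral>\<^sup>+x. ennreal (indicator {a..b} x * f x) \<partial>lborel) = ennreal (F b - F a)"
proof -
  have "(\<integral>\<^sup>+x. ennreal (indicator {a..b} x *\<^sub>R f x) \<partial>lborel) = ennreal (\<integral>x. indicator {a..b} x *\<^sub>R f x \<partial>lborel)"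
    by (rule nn_integral_eq_integral[OF borel_integrable_compact[OF compact_Icc f]]) (auto simp: nonneg)
  also have "(\<integral>x. indicator {a..b} x *\<^sub>R f x \<partial>lborel) = F b - F a"
    by (rule integral_FTC_atLeastAtMost[OF ab _ f])
       (use F in \<open>auto simp: has_real_derivative_iff_has_vector_derivative intro: has_vector_derivative_at_within\<close>)
  finally show ?thesis by simp
qed

lemma nn_integral_normal_quadratic:
  assumes "0 < s"
  shows "(\<integral>\<^sup>+y. ennreal ((a * (y - h) + b)\<^sup>2 * normal_density h s y) \<partial>lborel) = ennreal (a\<^sup>2 * s\<^sup>2 + b\<^sup>2)"
proof -
  have "has_bochner_integral lborel (\<lambda>y. a\<^sup>2 * (normal_density h s y * (y - h) ^ (2 * 1))
      + (2 * a * b) * (normal_density h s y * (y - h) ^ (2 * 0 + 1)) + b\<^sup>2 * (normal_density h s y * (y - h) ^ (2 * 0)))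
      (a\<^sup>2 * (fact (2 * 1) / ((2 / s\<^sup>2) ^ 1 * fact 1)) + (2 * a * b) * 0 + b\<^sup>2 * (fact (2 * 0) / ((2 / s\<^sup>2) ^ 0 * fact 0)))"
    by (intro has_bochner_integral_add has_bochner_integral_mult_right normal_moment_even normal_moment_odd assms)
  also have "(\<lambda>y. a\<^sup>2 * (normal_density h s y * (y - h) ^ (2 * 1))
      + (2 * a * b) * (normal_density h s y * (y - h) ^ (2 * 0 + 1)) + b\<^sup>2 * (normal_density h s y * (y - h) ^ (2 * 0)))
    = (\<lambda>y. (a * (y - h) + b)\<^sup>2 * normal_density h s y)"
  proof
    fix y
    have "A * (n * d ^ (2 * 1)) + (2 * a * b) * (n * d ^ (2 * 0 + 1)) + b\<^sup>2 * (n * d ^ (2 * 0)) = (a * d + b)\<^sup>2 * n"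
      if "A = a\<^sup>2" for A n d :: real
      unfolding that by (simp add: power2_eq_square algebra_simps)
    from this[OF refl] show "a\<^sup>2 * (normal_density h s y * (y - h) ^ (2 * 1))
      + (2 * a * b) * (normal_density h s y * (y - h) ^ (2 * 0 + 1)) + b\<^sup>2 * (normal_density h s y * (y - h) ^ (2 * 0))
      = (a * (y - h) + b)\<^sup>2 * normal_density h s y" .
  qed
  finally have *: "has_bochner_integral lborel (\<lambda>y. (a * (y - h) + b)\<^sup>2 * normal_density h s y) (a\<^sup>2 * s\<^sup>2 + b\<^sup>2)"
    using assms by (simp add: field_simps)
  then show ?thesis
    by (subst nn_integral_eq_integral) (use assms in \<open>auto simp: has_bochner_integral_iff intro!: AE_I2\<close>)
qed

text \<open>A van Trees bound for the prior with density proportional to \<open>(H\<^sup>2 - h\<^sup>2)\<^sup>2\<close>, whose Fisher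
  information is \<open>10 / H\<^sup>2\<close>.\<close>

lemma exists_hard_prior:
  assumes v: "0 < v" and H: "0 < H"
  shows "\<exists>\<pi>\<in>priors H. ennreal (1 / (1 / v + 10 / H\<^sup>2)) \<le> gaussian_bayes_risk v \<pi>"
proof -
  define s where "s = sqrt v"
  \<comment> \<open>The normalising constant: \<open>(H^2 - h^2)^2\<close> has integral
    \<open>16 * H^5 / 15\<close> over \<open>[-H, H]\<close>.\<close>
  define \<kappa> where "\<kappa> = 15 / (16 * H ^ 5)"
  \<comment> \<open>With \<open>J\<close> the total information \<open>1 / v + 10 / H^2\<close>,
    this value maximises the lower bound \<open>2 * c - c^2 * J\<close> that \<open>key\<close>
    yields after integration over \<open>y\<close>.\<close>
  define c where "c = 1 / (1 / v + 10 / H\<^sup>2)"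
  define P where "P h = H\<^sup>2 - h\<^sup>2" for h
  \<comment> \<open>\<open>U\<close> is \<open>P\<close> times the derivative in \<open>h\<close> of
    the logarithm of the joint density, \<open>(y - h) / v - 4 * h / P h\<close>. The factor
    \<open>P\<close> removes the singularity of the prior's score at the endpoints.\<close>
  define U where "U y h = (y - h) * P h / v - 4 * h" for y h
  define I :: "real \<Rightarrow> real" where "I = indicator {-H..H}"
  \<comment> \<open>Members of \<open>priors H\<close> carry the sigma-algebra of the interval
    itself, so the density is taken on the restricted space; \<open>\<pi>_int\<close> moves its
    integrals back to the line.\<close>
  define \<pi> where "\<pi> = density (restrict_space lborel {-H..H}) (\<lambda>h. ennreal (\<kappa> * (P h)\<^sup>2))"
  have s: "0 < s" "s\<^sup>2 = v" and \<kappa>: "0 < \<kappa>" and c: "0 < c"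
    using v H by (auto simp: s_def \<kappa>_def c_def add_pos_pos)
  have [measurable]: "P \<in> borel_measurable borel" "I \<in> borel_measurable borel"
    by (simp_all add: P_def[abs_def] I_def)
  have contP: "continuous_on A P" for A unfolding P_def[abs_def] by (intro continuous_intros)
  have contU: "continuous_on A (U y)" for A y unfolding U_def[abs_def] by (intro continuous_intros contP) (use v in auto)
  have contN: "continuous_on A (\<lambda>h. normal_density h s y)" for A y
    unfolding normal_density_def using s by (intro continuous_intros) auto
  have I01: "0 \<le> I h" for h by (simp add: I_def)
  have \<pi>_int: "(\<integral>\<^sup>+h. f h \<partial>\<pi>) = (\<integral>\<^sup>+h. ennreal (I h * (\<kappa> * (P h)\<^sup>2)) * f h \<partial>lborel)"
    if [measurable]: "f \<in> borel_measurable borel" for f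
  proof -
    have "(\<integral>\<^sup>+h. f h \<partial>\<pi>) = (\<integral>\<^sup>+h. ennreal (\<kappa> * (P h)\<^sup>2) * f h \<partial>restrict_space lborel {-H..H})"
      unfolding \<pi>_def by (rule nn_integral_density) (auto intro!: measurable_restrict_space1)
    also have "\<dots> = (\<integral>\<^sup>+h. ennreal (\<kappa> * (P h)\<^sup>2) * f h * indicator {-H..H} h \<partial>lborel)"
      by (rule nn_integral_restrict_space) simp
    also have "\<dots> = (\<integral>\<^sup>+h. ennreal (I h * (\<kappa> * (P h)\<^sup>2)) * f h \<partial>lborel)"
      by (intro nn_integral_cong) (auto simp: I_def indicator_def)
    finally show ?thesis .
  qed
  have mass: "(\<integral>\<^sup>+h. ennreal (I h * (\<kappa> * (P h)\<^sup>2)) \<partial>lborel) = 1"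
  proof -
    have "(\<integral>\<^sup>+h. ennreal (I h * (\<kappa> * (P h)\<^sup>2)) \<partial>lborel)
      = ennreal (\<kappa> * (H ^ 4 * H - 2 * H\<^sup>2 * H ^ 3 / 3 + H ^ 5 / 5) - \<kappa> * (H ^ 4 * (- H) - 2 * H\<^sup>2 * (- H) ^ 3 / 3 + (- H) ^ 5 / 5))"
      unfolding I_def
    proof (rule nn_integral_Icc_FTC)
      fix x
      show "((\<lambda>h. \<kappa> * (H ^ 4 * h - 2 * H\<^sup>2 * h ^ 3 / 3 + h ^ 5 / 5)) has_real_derivative \<kappa> * (P x)\<^sup>2) (at x)"
        unfolding P_def by (auto intro!: derivative_eq_intros simp: power2_eq_square eval_nat_numeral algebra_simps)
    qed (use \<kappa> H in \<open>auto intro!: continuous_intros contP\<close>)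
    also have "\<kappa> * (H ^ 4 * H - 2 * H\<^sup>2 * H ^ 3 / 3 + H ^ 5 / 5) - \<kappa> * (H ^ 4 * (- H) - 2 * H\<^sup>2 * (- H) ^ 3 / 3 + (- H) ^ 5 / 5) = 1"
      using H by (simp add: \<kappa>_def eval_nat_numeral field_simps)
    finally show ?thesis by simp
  qed
  have info: "(\<integral>\<^sup>+h. ennreal (I h * (\<kappa> * ((P h)\<^sup>2 / v + 16 * h\<^sup>2))) \<partial>lborel) = ennreal (1 / v + 10 / H\<^sup>2)"
  proof -
    have h2: "(\<integral>\<^sup>+h. ennreal (I h * (\<kappa> * 16 * h\<^sup>2)) \<partial>lborel) = ennreal (\<kappa> * 16 * H ^ 3 / 3 - \<kappa> * 16 * (- H) ^ 3 / 3)"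
      unfolding I_def
    proof (rule nn_integral_Icc_FTC)
      fix x show "((\<lambda>h. \<kappa> * 16 * h ^ 3 / 3) has_real_derivative \<kappa> * 16 * x\<^sup>2) (at x)"
        by (auto intro!: derivative_eq_intros simp: power2_eq_square)
    qed (use \<kappa> H in \<open>auto intro!: continuous_intros\<close>)
    also have "\<kappa> * 16 * H ^ 3 / 3 - \<kappa> * 16 * (- H) ^ 3 / 3 = 10 / H\<^sup>2"
      using H by (simp add: \<kappa>_def eval_nat_numeral field_simps)
    finally have h2: "(\<integral>\<^sup>+h. ennreal (I h * (\<kappa> * 16 * h\<^sup>2)) \<partial>lborel) = ennreal (10 / H\<^sup>2)" .
    have "(\<integral>\<^sup>+h. ennreal (I h * (\<kappa> * ((P h)\<^sup>2 / v + 16 * h\<^sup>2))) \<partial>lborel)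
      = (\<integral>\<^sup>+h. ennreal (1 / v) * ennreal (I h * (\<kappa> * (P h)\<^sup>2)) + ennreal (I h * (\<kappa> * 16 * h\<^sup>2)) \<partial>lborel)"
      using v \<kappa> I01 by (intro nn_integral_cong)
        (simp add: ennreal_mult[symmetric] ennreal_plus[symmetric] algebra_simps del: ennreal_plus)
    also have "\<dots> = ennreal (1 / v) * 1 + ennreal (10 / H\<^sup>2)"
      by (subst nn_integral_add, measurable, subst nn_integral_cmult, measurable) (simp add: mass h2)
    also have "\<dots> = ennreal (1 / v + 10 / H\<^sup>2)"
      using v H by (simp add: ennreal_plus[symmetric] del: ennreal_plus)
    finally show ?thesis .
  qed
  have "prob_space \<pi>"
  proof
    have "emeasure \<pi> (space \<pi>) = (\<integral>\<^sup>+h. 1 \<partial>\<pi>)" by simp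
    also have "\<dots> = 1" by (subst \<pi>_int) (auto simp: mass)
    finally show "emeasure \<pi> (space \<pi>) = 1" .
  qed
  moreover have "sets \<pi> = sets (restrict_space borel {-H..H})"
    by (simp add: \<pi>_def sets_restrict_space)
  ultimately have "\<pi> \<in> priors H"
    by (simp add: priors_def space_prob_algebra)
  moreover have "ennreal c \<le> gaussian_bayes_risk v \<pi>"
    unfolding gaussian_bayes_risk_def bayes_risk_def
  proof (rule INF_greatest)
    fix T :: "real \<Rightarrow> real" assume "T \<in> borel_measurable (gaussian_shift v 0)"
    then have [measurable]: "T \<in> borel_measurable borel" by (simp add: gaussian_shift_def)
    let ?n = "\<lambda>h y. normal_density h s y"
    define R where "R = (\<integral>\<^sup>+h. (\<integral>\<^sup>+y. ennreal ((T y - h)\<^sup>2) \<partial>gaussian_shift v h) \<partial>\<pi>)"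
    have "R = (\<integral>\<^sup>+h. (\<integral>\<^sup>+y. ennreal ((T y - h)\<^sup>2 * ?n h y) \<partial>lborel) \<partial>\<pi>)"
      unfolding R_def gaussian_shift_def s_def[symmetric]
      by (intro nn_integral_cong, subst nn_integral_density)
         (use s in \<open>auto simp: ennreal_mult[symmetric] mult.commute\<close>)
    also have "\<dots> = (\<integral>\<^sup>+h. ennreal (I h * (\<kappa> * (P h)\<^sup>2)) * (\<integral>\<^sup>+y. ennreal ((T y - h)\<^sup>2 * ?n h y) \<partial>lborel) \<partial>lborel)"
      by (rule \<pi>_int) (unfold normal_density_def, measurable)
    also have "\<dots> = (\<integral>\<^sup>+h. (\<integral>\<^sup>+y. ennreal (I h * (\<kappa> * (P h)\<^sup>2 * ((T y - h)\<^sup>2 * ?n h y))) \<partial>lborel) \<partial>lborel)"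
      using I01 \<kappa> s by (subst nn_integral_cmult[symmetric]) (auto simp: ennreal_mult[symmetric] mult.assoc)
    also have "\<dots> = (\<integral>\<^sup>+y. (\<integral>\<^sup>+h. ennreal (I h * (\<kappa> * (P h)\<^sup>2 * ((T y - h)\<^sup>2 * ?n h y))) \<partial>lborel) \<partial>lborel)"
      by (rule lborel_pair.Fubini'[symmetric]) (unfold normal_density_def, measurable)
    finally have R: "R = (\<integral>\<^sup>+y. (\<integral>\<^sup>+h. ennreal (I h * (\<kappa> * (P h)\<^sup>2 * ((T y - h)\<^sup>2 * ?n h y))) \<partial>lborel) \<partial>lborel)" .
    have B: "(\<integral>\<^sup>+y. (\<integral>\<^sup>+h. ennreal (I h * (\<kappa> * (U y h)\<^sup>2 * ?n h y)) \<partial>lborel) \<partial>lborel) = ennreal (1 / v + 10 / H\<^sup>2)"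
    proof -
      have "(\<integral>\<^sup>+y. (\<integral>\<^sup>+h. ennreal (I h * (\<kappa> * (U y h)\<^sup>2 * ?n h y)) \<partial>lborel) \<partial>lborel)
        = (\<integral>\<^sup>+h. (\<integral>\<^sup>+y. ennreal (I h * (\<kappa> * (U y h)\<^sup>2 * ?n h y)) \<partial>lborel) \<partial>lborel)"
        by (rule lborel_pair.Fubini') (unfold normal_density_def U_def, measurable)
      also have "\<dots> = (\<integral>\<^sup>+h. ennreal (I h * \<kappa>) * (\<integral>\<^sup>+y. ennreal ((P h / v * (y - h) + (- 4 * h))\<^sup>2 * ?n h y) \<partial>lborel) \<partial>lborel)"
        using I01 \<kappa> s by (subst nn_integral_cmult[symmetric])
          (auto simp: ennreal_mult[symmetric] mult.assoc U_def mult.commute[of _ "P _"])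
      also have "\<dots> = (\<integral>\<^sup>+h. ennreal (I h * (\<kappa> * ((P h)\<^sup>2 / v + 16 * h\<^sup>2))) \<partial>lborel)"
        unfolding nn_integral_normal_quadratic[OF s(1)] s(2)
      proof (intro nn_integral_cong)
        fix h
        have "(P h / v)\<^sup>2 * v + (- 4 * h)\<^sup>2 = (P h)\<^sup>2 / v + 16 * h\<^sup>2"
          using v by (simp add: power2_eq_square)
        then show "ennreal (I h * \<kappa>) * ennreal ((P h / v)\<^sup>2 * v + (- 4 * h)\<^sup>2)
            = ennreal (I h * (\<kappa> * ((P h)\<^sup>2 / v + 16 * h\<^sup>2)))"
          using I01[of h] \<kappa> by (simp only: mult.assoc[symmetric]) (rule ennreal_mult''[symmetric], use v in simp)
      qed
      finally show ?thesis by (simp add: info)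
    qed
    have M: "(\<integral>\<^sup>+y. (\<integral>\<^sup>+h. ennreal (I h * (\<kappa> * (P h)\<^sup>2 * ?n h y)) \<partial>lborel) \<partial>lborel) = 1"
    proof -
      have "(\<integral>\<^sup>+y. (\<integral>\<^sup>+h. ennreal (I h * (\<kappa> * (P h)\<^sup>2 * ?n h y)) \<partial>lborel) \<partial>lborel)
        = (\<integral>\<^sup>+h. (\<integral>\<^sup>+y. ennreal (I h * (\<kappa> * (P h)\<^sup>2 * ?n h y)) \<partial>lborel) \<partial>lborel)"
        by (rule lborel_pair.Fubini') (unfold normal_density_def U_def, measurable)
      also have "\<dots> = (\<integral>\<^sup>+h. ennreal (I h * (\<kappa> * (P h)\<^sup>2)) * (\<integral>\<^sup>+y. ennreal ((0 * (y - h) + 1)\<^sup>2 * ?n h y) \<partial>lborel) \<partial>lborel)"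
        using I01 \<kappa> s by (subst nn_integral_cmult[symmetric]) (auto simp: ennreal_mult[symmetric] mult.assoc)
      also have "\<dots> = 1"
        unfolding nn_integral_normal_quadratic[OF s(1)] by (simp add: mass)
      finally show ?thesis .
    qed
    \<comment> \<open>The van Trees argument before integrating over \<open>y\<close>: for fixed
      \<open>y\<close> the value \<open>T y\<close> is a constant, so the integrands are continuous
      in \<open>h\<close> for every estimator. Completing a square in place of Cauchy-Schwarz keeps
      the inequality additive, so it survives an infinite total risk.\<close>
    have key: "ennreal (2 * c) * (\<integral>\<^sup>+h. ennreal (I h * (\<kappa> * (P h)\<^sup>2 * ?n h y)) \<partial>lborel)
       \<le> (\<integral>\<^sup>+h. ennreal (I h * (\<kappa> * (P h)\<^sup>2 * ((T y - h)\<^sup>2 * ?n h y))) \<partial>lborel)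
         + ennreal (c\<^sup>2) * (\<integral>\<^sup>+h. ennreal (I h * (\<kappa> * (U y h)\<^sup>2 * ?n h y)) \<partial>lborel)" for y
    proof -
      \<comment> \<open>\<open>g\<close> vanishes at both endpoints together with \<open>P\<close>,
        so \<open>g'\<close> integrates to 0: the mean of \<open>P * (T y - h) * U\<close> equals
        that of \<open>P^2\<close>. This is the cross term of the completed square.\<close>
      define g where "g h = (T y - h) * (P h)\<^sup>2 * ?n h y" for h
      define g' where "g' h = (T y - h) * P h * U y h * ?n h y - (P h)\<^sup>2 * ?n h y" for h
      define f1 where "f1 h = \<kappa> * (P h)\<^sup>2 * ?n h y" for h
      define f2 where "f2 h = \<kappa> * (P h)\<^sup>2 * ((T y - h)\<^sup>2 * ?n h y)" for h
      define f3 where "f3 h = \<kappa> * (U y h)\<^sup>2 * ?n h y" for h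
      have cont: "continuous_on {-H..H} f1" "continuous_on {-H..H} f2" "continuous_on {-H..H} f3" "continuous_on {-H..H} g'"
        unfolding f1_def[abs_def] f2_def[abs_def] f3_def[abs_def] g'_def[abs_def]
        by (intro continuous_on_mult continuous_on_power continuous_on_diff continuous_on_const continuous_on_id contP contU contN)+
      have nn: "0 \<le> f1 h" "0 \<le> f2 h" "0 \<le> f3 h" for h
        using \<kappa> s by (auto simp: f1_def f2_def f3_def)
      note int = borel_integrable_compact[OF compact_Icc]
      have dn: "((\<lambda>h. ?n h y) has_real_derivative (y - h) / v * ?n h y) (at h)" for h
      proof -
        have e: "((\<lambda>h. exp (- (y - h)\<^sup>2 / (2 * v))) has_real_derivative exp (- (y - h)\<^sup>2 / (2 * v)) * ((y - h) / v)) (at h)"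
          using v by (auto intro!: derivative_eq_intros simp: field_simps)
        show ?thesis
          using DERIV_cmult[OF e, of "1 / sqrt (2 * pi * v)"]
          unfolding normal_density_def s(2) by (simp only: mult.assoc mult.commute mult.left_commute)
      qed
      have dP: "(P has_real_derivative - 2 * h) (at h)" for h
        unfolding P_def[abs_def] by (auto intro!: derivative_eq_intros)
      have dg: "(g has_real_derivative g' h) (at h)" for h
        unfolding g_def[abs_def]
        by (rule DERIV_cong, (rule derivative_intros dP dn)+)
           (use v in \<open>simp add: g'_def U_def power2_eq_square field_simps\<close>)
      have "(\<integral>h. indicator {-H..H} h *\<^sub>R g' h \<partial>lborel) = g H - g (-H)"
        by (rule integral_FTC_atLeastAtMost[OF _ _ cont(4)])
           (use dg H in \<open>auto simp: has_real_derivative_iff_has_vector_derivative intro: has_vector_derivative_at_within\<close>)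
      then have ibp: "(\<integral>h. indicator {-H..H} h *\<^sub>R g' h \<partial>lborel) = 0" by (simp add: g_def P_def)
      have "2 * c * \<kappa> * g' h \<le> f2 h + c\<^sup>2 * f3 h - 2 * c * f1 h" for h
      proof -
        have "0 \<le> \<kappa> * ((P h * (T y - h) - c * U y h)\<^sup>2 * ?n h y)" using \<kappa> s by simp
        also have "\<dots> = f2 h + c\<^sup>2 * f3 h - 2 * c * f1 h - 2 * c * \<kappa> * g' h"
          unfolding f1_def f2_def f3_def g'_def by (simp add: power2_eq_square algebra_simps)
        finally show ?thesis by simp
      qed
      then have "(\<integral>h. (2 * c * \<kappa>) * (indicator {-H..H} h *\<^sub>R g' h) \<partial>lborel)
        \<le> (\<integral>h. indicator {-H..H} h *\<^sub>R f2 h + c\<^sup>2 * (indicator {-H..H} h *\<^sub>R f3 h) - 2 * c * (indicator {-H..H} h *\<^sub>R f1 h) \<partial>lborel)"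
        by (intro integral_mono Bochner_Integration.integrable_diff Bochner_Integration.integrable_add integrable_mult_right int cont)
           (auto simp: indicator_def)
      then have real: "2 * c * (\<integral>h. indicator {-H..H} h *\<^sub>R f1 h \<partial>lborel)
        \<le> (\<integral>h. indicator {-H..H} h *\<^sub>R f2 h \<partial>lborel) + c\<^sup>2 * (\<integral>h. indicator {-H..H} h *\<^sub>R f3 h \<partial>lborel)"
        using int[OF cont(1)] int[OF cont(2)] int[OF cont(3)] by (simp only: integral_mult_right_zero ibp) simp
      have nnint: "(\<integral>\<^sup>+h. ennreal (I h * f h) \<partial>lborel) = ennreal (\<integral>h. indicator {-H..H} h *\<^sub>R f h \<partial>lborel)"
        if "continuous_on {-H..H} f" "\<And>h. 0 \<le> f h" for f
        using nn_integral_eq_integral[OF int[OF that(1)]] that(2) by (simp add: I_def)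
      have pos: "0 \<le> (\<integral>h. indicator {-H..H} h *\<^sub>R f h \<partial>lborel)" if "\<And>h. 0 \<le> f h" for f :: "real \<Rightarrow> real"
        by (rule integral_nonneg_AE) (simp add: that)
      show ?thesis
        unfolding f1_def[symmetric] f2_def[symmetric] f3_def[symmetric]
          nnint[OF cont(1) nn(1)] nnint[OF cont(2) nn(2)] nnint[OF cont(3) nn(3)]
        using real c pos[of f1, OF nn(1)] pos[of f2, OF nn(2)] pos[of f3, OF nn(3)]
        by (simp add: ennreal_mult[symmetric] ennreal_plus[symmetric] del: ennreal_plus)
    qed
    have "ennreal (2 * c) = (\<integral>\<^sup>+y. ennreal (2 * c) * (\<integral>\<^sup>+h. ennreal (I h * (\<kappa> * (P h)\<^sup>2 * ?n h y)) \<partial>lborel) \<partial>lborel)"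
      by (subst nn_integral_cmult) (unfold normal_density_def, measurable, fold normal_density_def, simp add: M)
    also have "\<dots> \<le> (\<integral>\<^sup>+y. (\<integral>\<^sup>+h. ennreal (I h * (\<kappa> * (P h)\<^sup>2 * ((T y - h)\<^sup>2 * ?n h y))) \<partial>lborel)
         + ennreal (c\<^sup>2) * (\<integral>\<^sup>+h. ennreal (I h * (\<kappa> * (U y h)\<^sup>2 * ?n h y)) \<partial>lborel) \<partial>lborel)"
      by (intro nn_integral_mono key)
    also have "\<dots> = R + ennreal (c\<^sup>2) * ennreal (1 / v + 10 / H\<^sup>2)"
      unfolding R B[symmetric]
      by (subst nn_integral_add, unfold normal_density_def U_def, measurable, subst nn_integral_cmult, measurable)
    also have "ennreal (c\<^sup>2) * ennreal (1 / v + 10 / H\<^sup>2) = ennreal c"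
    proof -
      have "0 < 1 / v + 10 / H\<^sup>2" using v H by (simp add: add_pos_pos)
      then have "c\<^sup>2 * (1 / v + 10 / H\<^sup>2) = c" "0 \<le> 1 / v + 10 / H\<^sup>2"
        by (simp_all add: c_def power2_eq_square)
      then show ?thesis by (metis ennreal_mult zero_le_power2)
    qed
    \<comment> \<open>\<open>R\<close> may be infinite, so it is the finite summand \<open>c\<close>
      that gets cancelled in \<open>ennreal\<close>.\<close>
    finally have "ennreal c + ennreal c \<le> R + ennreal c"
      using c by (simp add: ennreal_plus[symmetric] del: ennreal_plus)
    then show "ennreal c \<le> (\<integral>\<^sup>+h. (\<integral>\<^sup>+y. ennreal ((T y - h)\<^sup>2) \<partial>gaussian_shift v h) \<partial>\<pi>)"
      unfolding R_def[symmetric] by (simp add: ennreal_add_left_cancel_le add.commute)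
  qed
  ultimately show ?thesis unfolding c_def by blast
qed

section \<open>Blackwell monotonicity of minimax risks\<close>

text \<open>The locale \<open>product_prob_space\<close> wants a probability measure at every index.
  Indices outside \<open>I\<close> are filled with a point mass, which does not change the product
  over \<open>I\<close>.\<close>

lemma emeasure_PiM_prob:
  assumes I: "finite I" and prob: "\<And>i. i \<in> I \<Longrightarrow> prob_space (M i)" and X: "\<And>i. i \<in> I \<Longrightarrow> X i \<in> sets (M i)"
  shows "emeasure (PiM I M) (PiE I X) = (\<Prod>i\<in>I. emeasure (M i) (X i))"
proof -
  let ?M = "\<lambda>i. if i \<in> I then M i else return (count_space UNIV) undefined"
  have eq: "PiM I M = PiM I ?M" by (rule PiM_cong) auto
  have "prob_space (?M i)" for i using prob by (auto intro!: prob_space_return)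
  then interpret product_prob_space ?M I by (rule product_prob_spaceI)
  have "emeasure (PiM I ?M) (PiE I X) = (\<Prod>i\<in>I. emeasure (?M i) (X i))"
    using I X by (intro emeasure_PiM) auto
  then show ?thesis unfolding eq by simp
qed

text \<open>Rectangles form an intersection-stable generator, and the mass of a rectangle is a
  finite product of measurable functions of the coordinates. Together with
  \<open>PiM_bind_kernel\<close> this lifts Blackwell domination from one observation to
  \<open>n\<close> independent ones.\<close>

lemma PiM_kernel_measurable:
  assumes I: "finite I" and K: "K \<in> A \<rightarrow>\<^sub>M prob_algebra B"
  shows "(\<lambda>\<omega>. PiM I (\<lambda>i. K (\<omega> i))) \<in> PiM I (\<lambda>_. A) \<rightarrow>\<^sub>M prob_algebra (PiM I (\<lambda>_. B))"
    (is "?K \<in> ?A \<rightarrow>\<^sub>M prob_algebra ?B")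
proof (rule measurable_prob_algebraI)
  have Kx: "K (\<omega> i) \<in> space (prob_algebra B)" if "\<omega> \<in> space ?A" "i \<in> I" for \<omega> i
    using that measurable_space[OF K] by (auto simp: space_PiM)
  have prob: "prob_space (?K \<omega>)" if "\<omega> \<in> space ?A" for \<omega>
    using Kx[OF that] by (intro prob_space_PiM) (auto simp: space_prob_algebra)
  then show "\<And>x. x \<in> space ?A \<Longrightarrow> prob_space (?K x)" .
  have K': "K \<in> A \<rightarrow>\<^sub>M subprob_algebra B" using K by (rule measurable_prob_algebraD)
  have setsK: "sets (?K \<omega>) = sets ?B" if "\<omega> \<in> space ?A" for \<omega>
    using Kx[OF that] by (intro sets_PiM_cong) (auto simp: space_prob_algebra)
  have em: "emeasure (?K \<omega>) (PiE I X) = (\<Prod>i\<in>I. emeasure (K (\<omega> i)) (X i))"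
    if \<omega>: "\<omega> \<in> space ?A" and X: "X \<in> I \<rightarrow> sets B" for \<omega> X
    using Kx[OF \<omega>] X by (intro emeasure_PiM_prob[OF I]) (auto simp: space_prob_algebra Pi_iff)
  show "?K \<in> ?A \<rightarrow>\<^sub>M subprob_algebra ?B"
  proof (rule measurable_subprob_algebra_generated[OF sets_PiM Int_stable_prod_algebra prod_algebra_sets_into_space])
    show "\<And>a. a \<in> space ?A \<Longrightarrow> subprob_space (?K a)"
      using prob prob_space_imp_subprob_space by blast
    show "\<And>a. a \<in> space ?A \<Longrightarrow> sets (?K a) = sets ?B" by (rule setsK)
    show "(\<lambda>a. emeasure (?K a) (\<Pi>\<^sub>E i\<in>I. space B)) \<in> borel_measurable ?A"
    proof (subst measurable_cong)
      fix a assume a: "a \<in> space ?A"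
      then have "space (?K a) = (\<Pi>\<^sub>E i\<in>I. space B)"
        using sets_eq_imp_space_eq[OF setsK[OF a]] by (simp add: space_PiM)
      then show "emeasure (?K a) (\<Pi>\<^sub>E i\<in>I. space B) = 1"
        using prob_space.emeasure_space_1[OF prob[OF a]] by simp
    qed simp
    fix E assume "E \<in> prod_algebra I (\<lambda>_. B)"
    then obtain X where E: "E = PiE I X" and X: "X \<in> I \<rightarrow> sets B"
      unfolding prod_algebra_eq_finite[OF I] by auto
    have meas: "(\<lambda>\<omega>. emeasure (K (\<omega> i)) (X i)) \<in> borel_measurable ?A" if i: "i \<in> I" for i
      using X i K' by (intro measurable_compose[OF measurable_component_singleton[OF i]]
        measurable_compose[OF K' measurable_emeasure_subprob_algebra]) auto
    have "(\<lambda>\<omega>. \<Prod>i\<in>I. emeasure (K (\<omega> i)) (X i)) \<in> borel_measurable ?A"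
      using meas by (intro borel_measurable_prod_ennreal)
    then show "(\<lambda>\<omega>. emeasure (?K \<omega>) E) \<in> borel_measurable ?A"
      unfolding E by (subst measurable_cong[OF em[OF _ X]])
  qed
qed

text \<open>Both sides agree on rectangles: under the product law the integral of a product over the
  coordinates factorises.\<close>

lemma PiM_bind_kernel:
  assumes I: "finite I" and K: "K \<in> A \<rightarrow>\<^sub>M prob_algebra B" and B: "B = A \<bind> K" and A: "prob_space A"
  shows "PiM I (\<lambda>_. B) = PiM I (\<lambda>_. A) \<bind> (\<lambda>\<omega>. PiM I (\<lambda>i. K (\<omega> i)))"
    (is "?B = Giry_Monad.bind ?A ?K")
proof -
  have AA: "A \<in> space (prob_algebra A)" using A by (simp add: space_prob_algebra)
  have Bp: "prob_space B"
    using prob_space_bind'[OF AA K] B by simp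
  interpret PB: product_prob_space "\<lambda>_. B" I
    by (rule product_prob_spaceI) (rule Bp)
  interpret PA: product_prob_space "\<lambda>_. A" I
    by (rule product_prob_spaceI) (rule A)
  note Km = PiM_kernel_measurable[OF I K]
  have AA': "?A \<in> space (prob_algebra ?A)"
    using PA.prob_space_axioms by (simp add: space_prob_algebra)
  have K': "K \<in> A \<rightarrow>\<^sub>M subprob_algebra B" using K by (rule measurable_prob_algebraD)
  have "Giry_Monad.bind ?A ?K = ?B"
  proof (rule PB.PiM_eqI[OF I])
    show "sets (Giry_Monad.bind ?A ?K) = sets ?B"
      using sets_bind'[OF AA' Km] by simp
    fix X assume X: "\<And>i. i \<in> I \<Longrightarrow> X i \<in> sets B"
    then have X': "PiE I X \<in> sets ?B" using I by (intro sets_PiM_I_finite) auto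
    have em: "emeasure (?K \<omega>) (PiE I X) = (\<Prod>i\<in>I. emeasure (K (\<omega> i)) (X i))" if \<omega>: "\<omega> \<in> space ?A" for \<omega>
    proof -
      have Kx: "K (\<omega> i) \<in> space (prob_algebra B)" if "i \<in> I" for i
        using that \<omega> measurable_space[OF K] by (auto simp: space_PiM)
      then show ?thesis
        using X by (intro emeasure_PiM_prob[OF I]) (auto simp: space_prob_algebra)
    qed
    have "emeasure (Giry_Monad.bind ?A ?K) (PiE I X) = (\<integral>\<^sup>+\<omega>. emeasure (?K \<omega>) (PiE I X) \<partial>?A)"
      by (rule emeasure_bind_prob_algebra[OF AA' Km X'])
    also have "\<dots> = (\<integral>\<^sup>+\<omega>. (\<Prod>i\<in>I. emeasure (K (\<omega> i)) (X i)) \<partial>?A)"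
      by (intro nn_integral_cong em)
    also have "\<dots> = (\<Prod>i\<in>I. \<integral>\<^sup>+x. emeasure (K x) (X i) \<partial>A)"
      using X by (intro PA.product_nn_integral_prod[OF I] measurable_compose[OF K' measurable_emeasure_subprob_algebra])
    also have "\<dots> = (\<Prod>i\<in>I. emeasure B (X i))"
      using emeasure_bind_prob_algebra[OF AA K] X unfolding B[symmetric] by simp
    finally show "emeasure (Giry_Monad.bind ?A ?K) (PiE I X) = (\<Prod>i\<in>I. emeasure B (X i))" .
  qed
  then show ?thesis ..
qed

text \<open>\<open>T\<close> need not be integrable. If it is not, its integral is 0 by convention,
  but then the right side is infinite; a finite right side makes \<open>T - c\<close> square
  integrable, hence integrable on a probability space.\<close>

lemma Jensen_square_nn:
  fixes T :: "'b \<Rightarrow> real"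
  assumes "prob_space M" and [measurable]: "T \<in> borel_measurable M"
  shows "ennreal (((\<integral>y. T y \<partial>M) - c)\<^sup>2) \<le> (\<integral>\<^sup>+y. ennreal ((T y - c)\<^sup>2) \<partial>M)"
proof -
  interpret prob_space M by fact
  show ?thesis
  proof (cases "(\<integral>\<^sup>+y. ennreal ((T y - c)\<^sup>2) \<partial>M) = \<infinity>")
    case False
    then have sq: "integrable M (\<lambda>y. (T y - c)\<^sup>2)"
      by (intro integrableI_bounded) (auto simp: less_top)
    have "integrable M (\<lambda>y. T y - c)" by (rule square_integrable_imp_integrable[OF _ sq]) measurable
    then have T: "integrable M T" using Bochner_Integration.integrable_add[of M "\<lambda>y. T y - c" "\<lambda>_. c"] by simp
    have "((\<integral>y. T y \<partial>M) - c)\<^sup>2 = (\<integral>y. T y - c \<partial>M)\<^sup>2" using T by (simp add: prob_space)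
    also have "\<dots> \<le> (\<integral>y. (T y - c)\<^sup>2 \<partial>M)"
      using variance_positive[of "\<lambda>y. T y - c"] variance_eq[OF \<open>integrable M (\<lambda>y. T y - c)\<close> sq] by simp
    finally show ?thesis
      using nn_integral_eq_integral[OF sq] by (simp add: ennreal_leI)
  qed simp
qed

text \<open>Averaging an estimator over the kernel yields a nonrandomised estimator \<open>S\<close>
  in the finer experiment, and by convexity of squared loss its risk is no larger at any
  parameter.\<close>

lemma minimax_risk_kernel_mono:
  assumes P: "\<And>h. h \<in> {-H..H} \<Longrightarrow> prob_space (P h) \<and> sets (P h) = sets (P 0) \<and> sets (P' h) = sets (P' 0)"
    and K: "\<And>h. h \<in> {-H..H} \<Longrightarrow> K \<in> P h \<rightarrow>\<^sub>M prob_algebra (P' h) \<and> P' h = P h \<bind> K"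
    and H: "0 \<le> H"
  shows "minimax_risk P g H \<le> minimax_risk P' g H"
  unfolding minimax_risk_def
proof (rule INF_greatest)
  fix T :: "_ \<Rightarrow> real" assume T: "T \<in> borel_measurable (P' 0)"
  define S where "S x = (\<integral>y. T y \<partial>K x)" for x
  have S: "S \<in> borel_measurable (P 0)"
  proof -
    have "K \<in> P 0 \<rightarrow>\<^sub>M prob_algebra (P' 0)" using K[of 0, THEN conjunct1] H by simp
    from measurable_compose[OF measurable_prob_algebraD[OF this] integral_measurable_subprob_algebra[OF T]]
    show ?thesis by (simp add: S_def[abs_def])
  qed
  show "(INF T\<in>borel_measurable (P 0). SUP h\<in>{-H..H}. \<integral>\<^sup>+x. ennreal ((T x - g h)\<^sup>2) \<partial>P h)
     \<le> (SUP h\<in>{-H..H}. \<integral>\<^sup>+x. ennreal ((T x - g h)\<^sup>2) \<partial>P' h)"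
  proof (rule INF_lower2[OF S], rule SUP_mono)
    fix h assume h: "h \<in> {-H..H}"
    have K': "K \<in> P h \<rightarrow>\<^sub>M subprob_algebra (P' h)"
      using K[OF h, THEN conjunct1] by (rule measurable_prob_algebraD)
    have T': "T \<in> borel_measurable (P' h)"
    proof (subst measurable_cong_sets[OF _ refl])
      show "sets (P' h) = sets (P' 0)" using P[OF h] by blast
    qed (rule T)
    have "(\<integral>\<^sup>+x. ennreal ((S x - g h)\<^sup>2) \<partial>P h) \<le> (\<integral>\<^sup>+x. (\<integral>\<^sup>+y. ennreal ((T y - g h)\<^sup>2) \<partial>K x) \<partial>P h)"
    proof (rule nn_integral_mono)
      fix x assume "x \<in> space (P h)"
      then have Kx: "K x \<in> space (prob_algebra (P' h))"
        by (rule measurable_space[OF K[OF h, THEN conjunct1]])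
      show "ennreal ((S x - g h)\<^sup>2) \<le> (\<integral>\<^sup>+y. ennreal ((T y - g h)\<^sup>2) \<partial>K x)"
        unfolding S_def
      proof (rule Jensen_square_nn)
        show "prob_space (K x)" using Kx by (simp add: space_prob_algebra)
        have "sets (K x) = sets (P' h)" using Kx by (simp add: space_prob_algebra)
        then show "T \<in> borel_measurable (K x)" using T' by (subst measurable_cong_sets[OF _ refl])
      qed
    qed
    also have "\<dots> = (\<integral>\<^sup>+y. ennreal ((T y - g h)\<^sup>2) \<partial>(P h \<bind> K))"
      using T' by (intro nn_integral_bind[OF _ K', symmetric] measurable_compose[OF _ measurable_ennreal]
        borel_measurable_power borel_measurable_diff borel_measurable_const)
    also have "P h \<bind> K = P' h" by (rule K[OF h, THEN conjunct2, symmetric])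
    finally show "\<exists>h'\<in>{-H..H}. (\<integral>\<^sup>+x. ennreal ((S x - g h)\<^sup>2) \<partial>P h) \<le> (\<integral>\<^sup>+x. ennreal ((T x - g h')\<^sup>2) \<partial>P' h')"
      using h by blast
  qed
qed

section \<open>Increments of the minimax risk\<close>

lemma minimax_risk_le_bound:
  assumes "\<And>h. h \<in> {-H..H} \<Longrightarrow> prob_space (P h) \<and> \<bar>g h\<bar> \<le> B"
  shows "minimax_risk P g H \<le> ennreal (B\<^sup>2)"
  unfolding minimax_risk_def
proof (rule INF_lower2[of "\<lambda>_. 0"])
  show "(SUP h\<in>{-H..H}. \<integral>\<^sup>+x. ennreal ((0 - g h)\<^sup>2) \<partial>P h) \<le> ennreal (B\<^sup>2)"
  proof (rule SUP_least)
    fix h assume h: "h \<in> {-H..H}"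
    then interpret prob_space "P h" using assms by blast
    have "\<bar>g h\<bar> \<le> B" using assms[OF h] by blast
    then have "\<bar>g h\<bar> \<le> \<bar>B\<bar>" by linarith
    then show "(\<integral>\<^sup>+x. ennreal ((0 - g h)\<^sup>2) \<partial>P h) \<le> ennreal (B\<^sup>2)"
      by (simp add: emeasure_space_1 abs_le_square_iff)
  qed
qed simp

text \<open>\<open>enn2real\<close> sends infinity to 0, so comparisons of risks pass to real
  numbers only once the minimax risk is known to be finite.\<close>

lemma minimax_attained_least_favorable:
  assumes att: "minimax_attained P g H" and fin: "minimax_risk P g H < \<infinity>"
  obtains \<pi> where "\<pi> \<in> priors H" "enn2real (bayes_risk P g \<pi>) = enn2real (minimax_risk P g H)"
    "\<And>\<pi>'. \<pi>' \<in> priors H \<Longrightarrow> enn2real (bayes_risk P g \<pi>') \<le> enn2real (minimax_risk P g H)"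
proof -
  obtain \<pi> where \<pi>: "\<pi> \<in> priors H" "bayes_risk P g \<pi> = minimax_risk P g H"
    using att by (auto simp: minimax_attained_def)
  have "enn2real (bayes_risk P g \<pi>') \<le> enn2real (minimax_risk P g H)" if "\<pi>' \<in> priors H" for \<pi>'
  proof (rule enn2real_mono[OF _ fin[unfolded infinity_ennreal_def]])
    show "bayes_risk P g \<pi>' \<le> minimax_risk P g H"
      using att that by (auto simp: minimax_attained_def intro: SUP_upper)
  qed
  with \<pi> show thesis by (intro that[of \<pi>]) auto
qed

text \<open>The two transfer assumptions each assert the existence of a derivative of the shift
  risk; this identifies the two numbers, also at the ends of the interval.\<close>

lemma DERIV_within_Icc_unique:
  fixes f :: "real \<Rightarrow> real"
  assumes "(f has_real_derivative D) (at x within {a..b})" "(f has_real_derivative D') (at x within {a..b})"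
    and "a < b" "x \<in> {a..b}"
  shows "D = D'"
proof -
  have "at x within {a..b} \<noteq> bot"
    using assms(3,4) by (simp add: trivial_limit_within islimpt_Icc)
  then show ?thesis
    using assms(1,2) tendsto_unique unfolding has_field_derivative_iff by blast
qed

text \<open>Derivatives are taken within the larger set \<open>S\<close>, as they are one-sided at
  the ends of \<open>near_levels\<close>. The case \<open>a = b\<close> occurs when the level is the
  oracle level.\<close>

lemma mean_value_Icc:
  fixes f :: "real \<Rightarrow> real"
  assumes ab: "a \<le> b" and S: "{a..b} \<subseteq> S"
    and f: "\<And>x. x \<in> {a..b} \<Longrightarrow> \<exists>D. (f has_real_derivative D) (at x within S) \<and> l \<le> D \<and> D \<le> u"
  shows "l * (b - a) \<le> f b - f a" "f b - f a \<le> u * (b - a)"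
proof -
  obtain D where D: "\<And>x. x \<in> {a..b} \<Longrightarrow> (f has_real_derivative D x) (at x within S) \<and> l \<le> D x \<and> D x \<le> u"
    using f by metis
  have "\<exists>\<xi>\<in>{a..b}. f b - f a = D \<xi> * (b - a)"
  proof (cases "a = b")
    case False
    then have "\<exists>\<xi>\<in>{a<..<b}. f b - f a = (\<lambda>x. D \<xi> * x) (b - a)"
      using ab D S by (intro mvt_simple) (auto simp: has_field_derivative_def intro: has_derivative_subset)
    then show ?thesis by force
  qed auto
  then obtain \<xi> where \<xi>: "\<xi> \<in> {a..b}" "f b - f a = D \<xi> * (b - a)" by blast
  show "l * (b - a) \<le> f b - f a" "f b - f a \<le> u * (b - a)"
    unfolding \<xi>(2) using D[OF \<xi>(1)] ab by (auto intro: mult_right_mono)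
qed

text \<open>The order of quantifiers is the point: \<open>e\<close> depends on
  \<open>\<kappa>\<close> alone and serves all priors, radii and levels.\<close>

lemma gaussian_near_least_favorable:
  assumes "0 < \<kappa>"
  obtains e where "0 < e"
    "\<And>\<pi> H v. \<pi> \<in> priors H \<Longrightarrow> 0 < v \<Longrightarrow> v * (1 - e) \<le> enn2real (gaussian_bayes_risk v \<pi>) \<Longrightarrow>
      \<bar>gaussian_expectation v \<pi> (\<lambda>y. (gaussian_posterior_variance v \<pi> y / v)\<^sup>2) - 1\<bar> \<le> \<kappa>"
proof -
  \<comment> \<open>With 38 the term \<open>19 / t\<close> of \<open>EW2_upper\<close> is exactly
    \<open>\<kappa> / 2\<close>; then \<open>e\<close> is small enough that
    \<open>t * (1 - EW)\<close> stays below the other half.\<close>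
  define t where "t = 38 / \<kappa>"
  define e where "e = min (\<kappa> / 2) (\<kappa> / (2 * t))"
  have t: "0 < t" "19 / t = \<kappa> / 2" and e: "0 < e" "2 * e \<le> \<kappa>" "t * e \<le> \<kappa> / 2"
  proof -
    show t: "0 < t" "19 / t = \<kappa> / 2" using assms by (auto simp: t_def)
    show "0 < e" "2 * e \<le> \<kappa>" using t assms by (auto simp: e_def)
    have "t * e \<le> t * (\<kappa> / (2 * t))" using t by (intro mult_left_mono) (auto simp: e_def)
    then show "t * e \<le> \<kappa> / 2" using t by simp
  qed
  show thesis
  proof (rule that[OF e(1)])
    fix \<pi> :: "real measure" and H v :: real
    assume \<pi>: "\<pi> \<in> priors H" and v: "0 < v" and risk: "v * (1 - e) \<le> enn2real (gaussian_bayes_risk v \<pi>)"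
    interpret bounded_prior \<pi> H v by standard fact+
    have "0 \<le> EW" unfolding EW_def
      by (rule integral_nonneg_AE) (use m_pos[THEN less_imp_le] W_nonneg in auto)
    then have "enn2real (gaussian_bayes_risk v \<pi>) \<le> v * EW"
      using v by (intro enn2real_leI bayes_risk_le_EW) auto
    with risk v have EW: "1 - e \<le> EW" by (meson mult_le_cancel_left_pos order_trans)
    have "t * (1 - EW) \<le> t * e" using EW t by (intro mult_left_mono) auto
    then have "EW2 \<le> 1 + \<kappa>" using EW2_upper[OF t(1)] t e by linarith
    moreover have "1 - \<kappa> \<le> EW2" using EW2_lower EW e by linarith
    ultimately show "\<bar>gaussian_expectation v \<pi> (\<lambda>y. (gaussian_posterior_variance v \<pi> y / v)\<^sup>2) - 1\<bar> \<le> \<kappa>"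
      unfolding expectation_variance_sq by (simp add: abs_le_iff)
  qed
qed

section \<open>The local experiments and their minimax risks\<close>

lemma chain_expt:
  assumes ch: "continuous_blackwell_chain M \<delta>" and q: "q \<in> contexts M" and l: "l \<in> available_levels M \<delta> q"
    and \<theta>: "\<theta> \<in> param_set M"
  shows "prob_space (expt M q l \<theta>)" "sets (expt M q l \<theta>) = sets (expt M q l (base_param M))"
proof -
  have "expt M q l \<in> restrict_space borel (param_set M) \<rightarrow>\<^sub>M prob_algebra (expt M q l (base_param M))"
    using ch q l unfolding continuous_blackwell_chain_def by blast
  from measurable_space[OF this, of \<theta>] \<theta>
  show "prob_space (expt M q l \<theta>)" "sets (expt M q l \<theta>) = sets (expt M q l (base_param M))"
    by (auto simp: space_restrict_space space_prob_algebra)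
qed

lemma local_expt_prob:
  assumes ch: "continuous_blackwell_chain M \<delta>" and q: "q \<in> contexts M" and l: "l \<in> available_levels M \<delta> q"
    and h: "base_param M + h / sqrt (real n) \<in> param_set M"
  shows "prob_space (local_expt M n q l h)" "sets (local_expt M n q l h) = sets (local_expt M n q l 0)"
  unfolding local_expt_def using chain_expt[OF ch q l h]
  by (auto intro!: prob_space_PiM sets_PiM_cong)

lemma target_minimax_risk_mono:
  assumes ch: "continuous_blackwell_chain M \<delta>" and q: "q \<in> contexts M"
    and l: "l \<in> available_levels M \<delta> q" and l': "l' \<in> available_levels M \<delta> q" and le: "l \<le> l'"
    and H: "0 \<le> H" and h: "\<And>h. h \<in> {-H..H} \<Longrightarrow> base_param M + h / sqrt (real n) \<in> param_set M"
  shows "target_minimax_risk M n H q l \<le> target_minimax_risk M n H q l'"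
proof -
  have "blackwell_dominates (param_set M) (expt M q l) (expt M q l')"
    using ch q l l' le unfolding continuous_blackwell_chain_def by blast
  then obtain K where K: "\<And>\<theta>. \<theta> \<in> param_set M \<Longrightarrow>
      K \<in> expt M q l \<theta> \<rightarrow>\<^sub>M prob_algebra (expt M q l' \<theta>) \<and> expt M q l' \<theta> = Giry_Monad.bind (expt M q l \<theta>) K"
    unfolding blackwell_dominates_def by blast
  show ?thesis
    unfolding target_minimax_risk_def
  proof (rule minimax_risk_kernel_mono[OF _ _ H, where K="\<lambda>\<omega>. PiM {..<n} (\<lambda>i. K (\<omega> i))"])
    fix h assume hH: "h \<in> {-H..H}"
    note P = local_expt_prob[OF ch q l h[OF hH]] and P' = local_expt_prob[OF ch q l' h[OF hH]]
    show "prob_space (local_expt M n q l h) \<and> sets (local_expt M n q l h) = sets (local_expt M n q l 0) \<and>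
        sets (local_expt M n q l' h) = sets (local_expt M n q l' 0)"
      using P P' by blast
    note Kh = K[OF h[OF hH]]
    show "(\<lambda>\<omega>. PiM {..<n} (\<lambda>i. K (\<omega> i))) \<in> local_expt M n q l h \<rightarrow>\<^sub>M prob_algebra (local_expt M n q l' h) \<and>
        local_expt M n q l' h = Giry_Monad.bind (local_expt M n q l h) (\<lambda>\<omega>. PiM {..<n} (\<lambda>i. K (\<omega> i)))"
      unfolding local_expt_def
      by (intro conjI PiM_kernel_measurable PiM_bind_kernel finite_lessThan Kh[THEN conjunct1] Kh[THEN conjunct2]
          chain_expt(1)[OF ch q l h[OF hH]])
  qed
qed

lemma near_levels_available: "v \<in> near_levels M \<delta> q \<Longrightarrow> ereal v \<in> available_levels M \<delta> q"
  by (auto simp: available_levels_def)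

text \<open>The local target is continuous, hence bounded, on the compact interval of parameters, so
  the zero estimator has bounded risk.\<close>

lemma target_minimax_risk_finite:
  assumes ch: "continuous_blackwell_chain M \<delta>" and q: "q \<in> contexts M" and l: "l \<in> available_levels M \<delta> q"
    and \<rho>: "ball (base_param M) \<rho> \<subseteq> param_set M"
    and diff: "\<And>\<theta>. \<theta> \<in> ball (base_param M) \<rho> \<Longrightarrow> target M q differentiable at \<theta>"
    and h: "\<And>h. h \<in> {-H..H} \<Longrightarrow> base_param M + h / sqrt (real n) \<in> ball (base_param M) \<rho>"
  shows "target_minimax_risk M n H q l < \<infinity>"
proof -
  have "continuous_on {-H..H} (local_target M n q)"
  proof -
    have "continuous_on (ball (base_param M) \<rho>) (target M q)"
      using diff by (intro continuous_at_imp_continuous_on ballI differentiable_imp_continuous_within)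
    \<comment> \<open>Multiplying by the inverse spares the side condition that
      \<open>sqrt (real n)\<close> is nonzero, which division would raise for
      \<open>n = 0\<close>.\<close>
    then have "continuous_on {-H..H} (\<lambda>h. target M q (base_param M + h * inverse (sqrt (real n))))"
      by (rule continuous_on_compose2) (use h in \<open>auto intro!: continuous_intros simp: divide_inverse\<close>)
    then show ?thesis unfolding local_target_def[abs_def] divide_inverse by (intro continuous_intros)
  qed
  then have "bounded (local_target M n q ` {-H..H})"
    using compact_continuous_image compact_imp_bounded by blast
  then obtain B where B: "\<And>h. h \<in> {-H..H} \<Longrightarrow> \<bar>local_target M n q h\<bar> \<le> B"
    unfolding bounded_iff real_norm_def by blast
  have "target_minimax_risk M n H q l \<le> ennreal (B\<^sup>2)"
    unfolding target_minimax_risk_def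
    by (rule minimax_risk_le_bound) (use B h \<rho> local_expt_prob(1)[OF ch q l] in blast)
  then show ?thesis by (rule le_less_trans) simp
qed

text \<open>At a prior that is least favorable for the target at level \<open>v\<^sub>0\<close>, the Gaussian Bayes risk is
  within \<open>o(1)\<close> of its largest possible value \<open>u\<close> at all levels \<open>u\<close> near \<open>v\<^sub>0\<close>.\<close>

lemma gaussian_risk_lower:
  assumes S: "convex S" and pos: "\<And>v. v \<in> S \<Longrightarrow> 0 < v" and H: "0 < H" and b: "0 < b\<^sub>0" "b\<^sub>0 \<le> \<bar>b\<bar>"
    and G: "\<And>v \<pi>. v \<in> S \<Longrightarrow> \<pi> \<in> priors H \<Longrightarrow> \<bar>r \<pi> v - enn2real (gaussian_bayes_risk v \<pi>)\<bar> \<le> \<eta>\<^sub>0"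
    and D: "\<And>v \<pi>. v \<in> S \<Longrightarrow> \<pi> \<in> priors H \<Longrightarrow>
      \<exists>D. (r \<pi> has_real_derivative D) (at v within S) \<and> 0 \<le> D \<and> D \<le> C"
    and T: "\<And>v \<pi>. v \<in> S \<Longrightarrow> \<pi> \<in> priors H \<Longrightarrow> \<bar>g \<pi> v - b\<^sup>2 * r \<pi> v\<bar> \<le> e\<^sub>1"
    and \<pi>: "\<pi> \<in> priors H" and max: "\<And>\<pi>'. \<pi>' \<in> priors H \<Longrightarrow> g \<pi>' v\<^sub>0 \<le> g \<pi> v\<^sub>0"
    and v0: "v\<^sub>0 \<in> S" and u: "u \<in> S" and \<tau>: "\<bar>u - v\<^sub>0\<bar> \<le> \<tau>"
  shows "u - (\<tau> + C * \<tau> + 2 * \<eta>\<^sub>0 + 2 * e\<^sub>1 / b\<^sub>0\<^sup>2 + 10 * v\<^sub>0\<^sup>2 / H\<^sup>2) \<le> enn2real (gaussian_bayes_risk u \<pi>)"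
proof -
  obtain \<pi>' where \<pi>': "\<pi>' \<in> priors H" "ennreal (1 / (1 / v\<^sub>0 + 10 / H\<^sup>2)) \<le> gaussian_bayes_risk v\<^sub>0 \<pi>'"
    using exists_hard_prior[OF pos[OF v0] H] by blast
  have v0p: "0 < v\<^sub>0" using pos v0 by blast
  interpret bounded_prior \<pi>' H v\<^sub>0 by standard fact+
  have fin: "gaussian_bayes_risk v\<^sub>0 \<pi>' < top"
    using bayes_risk_le_EW le_less_trans ennreal_less_top by blast
  \<comment> \<open>Linearised van Trees bound: the product of the left side and the information is
    \<open>1 - x^2\<close> with \<open>x = 10 * v\<^sub>0 / H^2\<close>.\<close>
  have "v\<^sub>0 - 10 * v\<^sub>0\<^sup>2 / H\<^sup>2 \<le> 1 / (1 / v\<^sub>0 + 10 / H\<^sup>2)"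
  proof -
    have "0 < 1 / v\<^sub>0 + 10 / H\<^sup>2" using v0p H by (simp add: add_pos_pos)
    moreover have "(v\<^sub>0 - 10 * v\<^sub>0\<^sup>2 / H\<^sup>2) * (1 / v\<^sub>0 + 10 / H\<^sup>2) = 1 - (10 * v\<^sub>0 / H\<^sup>2)\<^sup>2"
      using v0p H by (simp add: power2_eq_square field_simps)
    ultimately show ?thesis by (simp add: pos_le_divide_eq)
  qed
  also have "\<dots> \<le> enn2real (gaussian_bayes_risk v\<^sub>0 \<pi>')"
  proof -
    have "0 \<le> 1 / (1 / v\<^sub>0 + 10 / H\<^sup>2)" using v0p H by (simp add: add_pos_pos)
    then show ?thesis using enn2real_mono[OF \<pi>'(2) fin] by simp
  qed
  also have "\<dots> \<le> r \<pi>' v\<^sub>0 + \<eta>\<^sub>0" using G[OF v0 \<pi>'(1)] by linarith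
  \<comment> \<open>\<open>\<pi>\<close> is maximal for the target, not for \<open>h\<close>, so the
    two priors are compared through their target risks; this costs \<open>e\<^sub>1\<close> twice,
    divided by the squared slope.\<close>
  also have "r \<pi>' v\<^sub>0 \<le> r \<pi> v\<^sub>0 + 2 * e\<^sub>1 / b\<^sub>0\<^sup>2"
  proof -
    have bb: "b\<^sub>0\<^sup>2 \<le> b\<^sup>2" "0 < b\<^sub>0\<^sup>2" using b power_mono[of b\<^sub>0 "\<bar>b\<bar>" 2] by auto
    have e1: "0 \<le> e\<^sub>1" using T[OF v0 \<pi>] by linarith
    have "b\<^sup>2 * r \<pi>' v\<^sub>0 \<le> b\<^sup>2 * r \<pi> v\<^sub>0 + 2 * e\<^sub>1"
      using T[OF v0 \<pi>] T[OF v0 \<pi>'(1)] max[OF \<pi>'(1)] by linarith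
    then have "b\<^sup>2 * (r \<pi>' v\<^sub>0 - r \<pi> v\<^sub>0) \<le> 2 * e\<^sub>1" by (simp add: right_diff_distrib)
    then have "r \<pi>' v\<^sub>0 - r \<pi> v\<^sub>0 \<le> 2 * e\<^sub>1 / b\<^sup>2"
    proof -
      have "0 < b\<^sup>2" using bb by linarith
      then show ?thesis using \<open>b\<^sup>2 * (r \<pi>' v\<^sub>0 - r \<pi> v\<^sub>0) \<le> 2 * e\<^sub>1\<close>
        by (subst pos_le_divide_eq) (simp_all add: mult.commute)
    qed
    also have "\<dots> \<le> 2 * e\<^sub>1 / b\<^sub>0\<^sup>2" using bb e1 b(1) by (intro divide_left_mono mult_pos_pos) (linarith | simp)+
    finally show ?thesis by simp
  qed
  \<comment> \<open>With the prior fixed only the level moves: for \<open>u\<close> above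
    \<open>v\<^sub>0\<close> monotonicity suffices, and below it the derivative bound
    \<open>C\<close> costs at most \<open>C * \<tau>\<close>.\<close>
  also have "r \<pi> v\<^sub>0 \<le> r \<pi> u + C * \<tau>"
  proof -
    have C: "0 \<le> C" using D[OF v0 \<pi>] by force
    have sub: "{min u v\<^sub>0..max u v\<^sub>0} \<subseteq> S"
      using closed_segment_subset[OF u v0 S] by (simp add: closed_segment_eq_real_ivl min_def max_def split: if_splits)
    have mv: "0 * (max u v\<^sub>0 - min u v\<^sub>0) \<le> r \<pi> (max u v\<^sub>0) - r \<pi> (min u v\<^sub>0)"
      "r \<pi> (max u v\<^sub>0) - r \<pi> (min u v\<^sub>0) \<le> C * (max u v\<^sub>0 - min u v\<^sub>0)"
      by (rule mean_value_Icc[OF _ sub]; use sub D[OF _ \<pi>] in force)+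
    have "C * (max u v\<^sub>0 - min u v\<^sub>0) \<le> C * \<tau>" using C \<tau> by (intro mult_left_mono) auto
    moreover have "0 \<le> C * \<tau>" using C \<tau> by (intro mult_nonneg_nonneg) auto
    ultimately show ?thesis using mv by (cases "u \<le> v\<^sub>0") auto
  qed
  also have "r \<pi> u \<le> enn2real (gaussian_bayes_risk u \<pi>) + \<eta>\<^sub>0" using G[OF u \<pi>] by linarith
  finally show ?thesis using \<tau> by linarith
qed

section \<open>Limits along the radii and the first-order slope\<close>

lemma filterlim_power_exp_neg_square:
  fixes H :: "nat \<Rightarrow> real"
  assumes H: "filterlim H at_top sequentially" and c: "0 < c"
  shows "(\<lambda>n. H n ^ k * exp (- c * H n ^ 2)) \<longlonglongrightarrow> 0"
proof -
  have "((\<lambda>x::real. x ^ k * exp (- c * x ^ 2)) \<longlongrightarrow> 0) at_top"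
    using c by real_asymp
  then show ?thesis by (rule filterlim_compose[OF _ H])
qed

lemma power_div_sqrt_tendsto_0:
  fixes H :: "nat \<Rightarrow> real"
  assumes H: "filterlim H at_top sequentially" and lim: "(\<lambda>n. H n ^ m / sqrt (real n)) \<longlonglongrightarrow> 0" and jm: "j \<le> m"
  shows "(\<lambda>n. H n ^ j / sqrt (real n)) \<longlonglongrightarrow> 0"
proof (rule tendsto_sandwich[OF _ _ tendsto_const lim])
  have H1: "\<forall>\<^sub>F n in sequentially. 1 \<le> H n" using H by (simp add: filterlim_at_top)
  show "\<forall>\<^sub>F n in sequentially. 0 \<le> H n ^ j / sqrt (real n)" using H1 by eventually_elim simp
  show "\<forall>\<^sub>F n in sequentially. H n ^ j / sqrt (real n) \<le> H n ^ m / sqrt (real n)"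
    using H1 by eventually_elim (intro divide_right_mono power_increasing jm, auto)
qed

text \<open>A relative error of \<open>\<kappa> / 10\<close> in the slope, squared, and of
  \<open>\<kappa> / 2\<close> in the derivative add up to \<open>7 * \<kappa> / 10\<close> to first
  order; the remaining room absorbs the higher powers of \<open>\<kappa> \<le> 1\<close>.\<close>

lemma slope_factor_bounds:
  fixes b b\<^sub>0 x D Dp \<kappa> :: real
  assumes \<kappa>: "0 < \<kappa>" "\<kappa> \<le> 1" and b: "0 < b\<^sub>0" "b\<^sub>0 \<le> \<bar>b\<bar>" and x: "\<bar>x\<bar> \<le> b\<^sub>0 * (\<kappa> / 10)"
    and D: "\<bar>D - 1\<bar> \<le> \<kappa> / 2" and lower: "(max 0 (\<bar>b\<bar> - x))\<^sup>2 * D \<le> Dp" and upper: "Dp \<le> (\<bar>b\<bar> + x)\<^sup>2 * D"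
  shows "(1 - \<kappa>) * b\<^sup>2 \<le> Dp" "Dp \<le> (1 + \<kappa>) * b\<^sup>2"
proof -
  have x': "\<bar>x\<bar> \<le> \<bar>b\<bar> * (\<kappa> / 10)"
    using x mult_right_mono[OF b(2), of "\<kappa> / 10"] \<kappa> by linarith
  have D0: "1 - \<kappa> / 2 \<le> D" "D \<le> 1 + \<kappa> / 2" "0 \<le> D" using D \<kappa> by linarith+
  have nb: "0 \<le> \<bar>b\<bar> * (1 - \<kappa> / 10)" using \<kappa> by simp
  have "(1 + \<kappa> / 10)\<^sup>2 * (1 + \<kappa> / 2) \<le> 1 + \<kappa>"
  proof -
    have "(1 + \<kappa> / 10)\<^sup>2 * (1 + \<kappa> / 2) = 1 + \<kappa> * (7 / 10 + 11 / 100 * \<kappa> + 1 / 200 * (\<kappa> * \<kappa>))"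
      by (simp add: power2_eq_square field_simps)
    also have "\<kappa> * (7 / 10 + 11 / 100 * \<kappa> + 1 / 200 * (\<kappa> * \<kappa>)) \<le> \<kappa> * 1"
      using \<kappa> mult_mono[of \<kappa> 1 \<kappa> 1] by (intro mult_left_mono) auto
    finally show ?thesis by simp
  qed
  have "Dp \<le> (\<bar>b\<bar> + x)\<^sup>2 * D" by (rule upper)
  also have "\<dots> \<le> (\<bar>b\<bar> * (1 + \<kappa> / 10))\<^sup>2 * (1 + \<kappa> / 2)"
  proof (intro mult_mono power_mono)
    show "\<bar>b\<bar> + x \<le> \<bar>b\<bar> * (1 + \<kappa> / 10)" using x' by (simp add: distrib_left abs_le_iff)
    show "0 \<le> \<bar>b\<bar> + x" using x' nb by (simp add: right_diff_distrib abs_le_iff)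
  qed (use D0 in auto)
  also have "\<dots> = b\<^sup>2 * ((1 + \<kappa> / 10)\<^sup>2 * (1 + \<kappa> / 2))" by (simp add: power_mult_distrib)
  also have "\<dots> \<le> b\<^sup>2 * (1 + \<kappa>)" by (intro mult_left_mono) (fact, simp)
  finally show "Dp \<le> (1 + \<kappa>) * b\<^sup>2" by (simp add: mult.commute)
  have "1 - \<kappa> \<le> (1 - \<kappa> / 10)\<^sup>2 * (1 - \<kappa> / 2)"
  proof -
    have "(1 - \<kappa> / 10)\<^sup>2 * (1 - \<kappa> / 2) = 1 - \<kappa> * (7 / 10 - 11 / 100 * \<kappa> + 1 / 200 * (\<kappa> * \<kappa>))"
      by (simp add: power2_eq_square field_simps)
    moreover have "\<kappa> * (7 / 10 - 11 / 100 * \<kappa> + 1 / 200 * (\<kappa> * \<kappa>)) \<le> \<kappa> * 1"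
    proof (intro mult_left_mono)
      have "\<kappa> * \<kappa> \<le> 1" using \<kappa> mult_mono[of \<kappa> 1 \<kappa> 1] by simp
      then show "7 / 10 - 11 / 100 * \<kappa> + 1 / 200 * (\<kappa> * \<kappa>) \<le> 1" using \<kappa> by linarith
    qed (use \<kappa> in auto)
    ultimately show ?thesis by simp
  qed
  then have "b\<^sup>2 * (1 - \<kappa>) \<le> b\<^sup>2 * ((1 - \<kappa> / 10)\<^sup>2 * (1 - \<kappa> / 2))" by (intro mult_left_mono) auto
  also have "\<dots> = (\<bar>b\<bar> * (1 - \<kappa> / 10))\<^sup>2 * (1 - \<kappa> / 2)" by (simp add: power_mult_distrib)
  also have "\<dots> \<le> (max 0 (\<bar>b\<bar> - x))\<^sup>2 * D"
  proof (intro mult_mono power_mono nb D0)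
    have "\<bar>b\<bar> * (1 - \<kappa> / 10) = \<bar>b\<bar> - \<bar>b\<bar> * (\<kappa> / 10)" by (simp add: right_diff_distrib)
    then have "\<bar>b\<bar> * (1 - \<kappa> / 10) \<le> \<bar>b\<bar> - x" using x' by linarith
    then show "\<bar>b\<bar> * (1 - \<kappa> / 10) \<le> max 0 (\<bar>b\<bar> - x)" by (rule max.coboundedI2)
  qed (use \<kappa> in auto)
  also have "\<dots> \<le> Dp" by (rule lower)
  finally show "(1 - \<kappa>) * b\<^sup>2 \<le> Dp" by (simp add: mult.commute)
qed

text \<open>The error is relative to \<open>v - oracle_level M q\<close>, however small that
  difference is compared with the transfer errors. The product of \<open>H ^ 4\<close> and
  \<open>\<tau>\<close> has to vanish because moving the level of a fixed prior by
  \<open>\<tau>\<close> can change its shift risk by \<open>\<tau>\<close> times a derivative of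
  order \<open>H ^ 4\<close>.\<close>

lemma risk_increment:
  fixes M :: "('q, 'a, 'x) menu_problem" and H :: "nat \<Rightarrow> real"
  assumes ch: "continuous_blackwell_chain M \<delta>" and \<delta>: "0 < \<delta>"
    and K: "compact K" "K \<subseteq> {0<..}" "\<forall>q\<in>contexts M. near_levels M \<delta> q \<subseteq> K"
    and H: "filterlim H at_top sequentially" and Hn: "(\<lambda>n. H n ^ 11 / sqrt (real n)) \<longlonglongrightarrow> 0"
    and dgt: "differentiated_gaussian_transfer M \<delta> H \<eta>\<^sub>0 \<eta>\<^sub>1" and stt: "smooth_target_transfer M \<delta> H"
    and c: "0 < c"
    and \<eta>0: "\<forall>\<^sub>F n in sequentially. \<eta>\<^sub>0 n (H n) \<le> C * H n ^ 5 / sqrt (real n) + C * H n ^ 2 * exp (- c * H n ^ 2)"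
    and \<eta>1: "\<forall>\<^sub>F n in sequentially. \<eta>\<^sub>1 n (H n) \<le> C * H n ^ 7 / sqrt (real n) + C * H n ^ 4 * exp (- c * H n ^ 2)"
    and \<tau>: "\<And>n. 0 \<le> \<tau> n" "(\<lambda>n. H n ^ 4 * \<tau> n) \<longlonglongrightarrow> 0"
    and \<kappa>: "0 < \<kappa>" "\<kappa> \<le> 1"
  shows "\<forall>\<^sub>F n in sequentially. 0 \<le> H n \<and> (\<forall>h\<in>{-H n..H n}. base_param M + h / sqrt (real n) \<in> param_set M) \<and>
    (\<forall>q\<in>contexts M. \<forall>v\<in>near_levels M \<delta> q.
      target_minimax_risk M n (H n) q (ereal v) < \<infinity> \<and>
      (v - oracle_level M q \<le> \<tau> n \<longrightarrow>
        (1 - \<kappa>) * (target_slope M q)\<^sup>2 * (v - oracle_level M q)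
          \<le> enn2real (target_minimax_risk M n (H n) q (ereal v)) - enn2real (target_minimax_risk M n (H n) q (ereal (oracle_level M q))) \<and>
        enn2real (target_minimax_risk M n (H n) q (ereal v)) - enn2real (target_minimax_risk M n (H n) q (ereal (oracle_level M q)))
          \<le> (1 + \<kappa>) * (target_slope M q)\<^sup>2 * (v - oracle_level M q)))"
proof -
  \<comment> \<open>Bounds for all levels: \<open>k\<^sub>0\<close> turns the relative slack
    \<open>e\<close> into the absolute slack \<open>e * k\<^sub>0\<close>, and
    \<open>k\<^sub>1\<close> bounds the van Trees loss. If \<open>K\<close> is empty, any values
    will do.\<close>
  obtain k\<^sub>0 k\<^sub>1 where k: "0 < k\<^sub>0" "\<And>v. v \<in> K \<Longrightarrow> k\<^sub>0 \<le> v \<and> v \<le> k\<^sub>1"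
  proof (cases "K = {}")
    case False
    then show thesis using compact_attains_inf[OF K(1) False] compact_attains_sup[OF K(1) False] K(2) that
      by (metis greaterThan_iff subsetD)
  qed (use that[of 1] in auto)
  obtain e where e: "0 < e" "\<And>\<pi> H v. \<pi> \<in> priors H \<Longrightarrow> 0 < v \<Longrightarrow> v * (1 - e) \<le> enn2real (gaussian_bayes_risk v \<pi>) \<Longrightarrow>
      \<bar>gaussian_expectation v \<pi> (\<lambda>y. (gaussian_posterior_variance v \<pi> y / v)\<^sup>2) - 1\<bar> \<le> \<kappa> / 4"
    using gaussian_near_least_favorable[of "\<kappa> / 4"] \<kappa>(1) by auto
  obtain C1 where C1: "\<forall>\<^sub>F n in sequentially. \<forall>q\<in>contexts M. \<forall>v\<in>near_levels M \<delta> q.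
        minimax_attained (local_expt M n q (ereal v)) (\<lambda>h. h) (H n) \<and>
        (\<forall>\<pi>\<in>priors (H n).
           \<bar>shift_bayes_risk M n q \<pi> v - enn2real (gaussian_bayes_risk v \<pi>)\<bar> \<le> \<eta>\<^sub>0 n (H n) \<and>
           (\<exists>D. (shift_bayes_risk M n q \<pi> has_real_derivative D) (at v within near_levels M \<delta> q) \<and>
              0 \<le> D \<and> D \<le> C1 * H n ^ 4 \<and>
              \<bar>D - gaussian_expectation v \<pi> (\<lambda>y. (gaussian_posterior_variance v \<pi> y / v)\<^sup>2)\<bar> \<le> \<eta>\<^sub>1 n (H n)))"
    using dgt unfolding differentiated_gaussian_transfer_def by blast
  obtain b\<^sub>0 where b0: "0 < b\<^sub>0" "\<And>q. q \<in> contexts M \<Longrightarrow> b\<^sub>0 \<le> \<bar>target_slope M q\<bar>"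
    using stt unfolding smooth_target_transfer_def by blast
  obtain \<rho> where \<rho>: "0 < \<rho>" "ball (base_param M) \<rho> \<subseteq> param_set M"
    "\<And>q \<theta>. q \<in> contexts M \<Longrightarrow> \<theta> \<in> ball (base_param M) \<rho> \<Longrightarrow> target M q differentiable at \<theta>"
    using stt unfolding smooth_target_transfer_def by blast
  obtain C2 where C2: "\<forall>\<^sub>F n in sequentially. \<forall>q\<in>contexts M. \<forall>v\<in>near_levels M \<delta> q.
        minimax_attained (local_expt M n q (ereal v)) (local_target M n q) (H n) \<and>
        (\<forall>\<pi>\<in>priors (H n).
           \<bar>target_bayes_risk M n q \<pi> v - (target_slope M q)\<^sup>2 * shift_bayes_risk M n q \<pi> v\<bar>
             \<le> C2 * (H n ^ 3 / sqrt (real n) + H n ^ 4 / real n) \<and>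
           (\<exists>D\<^sub>h D\<^sub>\<psi>.
              (shift_bayes_risk M n q \<pi> has_real_derivative D\<^sub>h) (at v within near_levels M \<delta> q) \<and>
              (target_bayes_risk M n q \<pi> has_real_derivative D\<^sub>\<psi>) (at v within near_levels M \<delta> q) \<and>
              (max 0 (\<bar>target_slope M q\<bar> - C2 * H n / sqrt (real n)))\<^sup>2 * D\<^sub>h \<le> D\<^sub>\<psi> \<and>
              D\<^sub>\<psi> \<le> (\<bar>target_slope M q\<bar> + C2 * H n / sqrt (real n))\<^sup>2 * D\<^sub>h))"
    using stt unfolding smooth_target_transfer_def by blast
  define \<eta>0' where "\<eta>0' n = C * (H n ^ 5 / sqrt (real n)) + C * (H n ^ 2 * exp (- c * H n ^ 2))" for n
  define \<eta>1' where "\<eta>1' n = C * (H n ^ 7 / sqrt (real n)) + C * (H n ^ 4 * exp (- c * H n ^ 2))" for n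
  define e1 where "e1 n = C2 * (H n ^ 3 / sqrt (real n) + H n ^ 4 / real n)" for n
  \<comment> \<open>The total loss in \<open>gaussian_risk_lower\<close>, made independent of the
    context and the level.\<close>
  define \<epsilon> where "\<epsilon> n = \<tau> n + C1 * (H n ^ 4 * \<tau> n) + 2 * \<eta>0' n + 2 * e1 n / b\<^sub>0\<^sup>2 + 10 * k\<^sub>1\<^sup>2 * inverse ((H n)\<^sup>2)" for n
  note pw = power_div_sqrt_tendsto_0[OF H Hn]
  note ex = filterlim_power_exp_neg_square[OF H c]
  have H1: "\<forall>\<^sub>F n in sequentially. 1 \<le> H n" using H by (simp add: filterlim_at_top)
  have \<eta>0'_lim: "\<eta>0' \<longlonglongrightarrow> 0" unfolding \<eta>0'_def
    by (rule tendsto_eq_intros pw ex refl | simp)+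
  have \<eta>1'_lim: "\<eta>1' \<longlonglongrightarrow> 0" unfolding \<eta>1'_def
    by (rule tendsto_eq_intros pw ex refl | simp)+
  have H4n: "(\<lambda>n. H n ^ 4 / real n) \<longlonglongrightarrow> 0"
  proof (rule tendsto_sandwich[OF _ _ tendsto_const])
    show "(\<lambda>n. H n ^ 4 / sqrt (real n)) \<longlonglongrightarrow> 0" by (rule pw) simp
    show "\<forall>\<^sub>F n in sequentially. H n ^ 4 / real n \<le> H n ^ 4 / sqrt (real n)"
      using eventually_gt_at_top[of 0]
    proof eventually_elim
      case (elim n)
      have "sqrt (real n) * 1 \<le> sqrt (real n) * sqrt (real n)" using elim by (intro mult_left_mono) auto
      then have "sqrt (real n) \<le> real n" by simp
      then show ?case using elim by (intro divide_left_mono) auto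
    qed
  qed simp
  have e1_lim: "e1 \<longlonglongrightarrow> 0" unfolding e1_def
    by (rule tendsto_eq_intros pw H4n refl | simp)+
  have \<tau>_lim: "\<tau> \<longlonglongrightarrow> 0"
  proof (rule tendsto_sandwich[OF _ _ tendsto_const \<tau>(2)])
    show "\<forall>\<^sub>F n in sequentially. \<tau> n \<le> H n ^ 4 * \<tau> n"
      using H1
    proof eventually_elim
      case (elim n)
      have "1 * \<tau> n \<le> H n ^ 4 * \<tau> n" using elim \<tau>(1) by (intro mult_right_mono) auto
      then show ?case by simp
    qed
  qed (use \<tau>(1) in simp)
  have "(\<lambda>n. inverse ((H n)\<^sup>2)) \<longlonglongrightarrow> 0"
    by (intro tendsto_inverse_0_at_top filterlim_pow_at_top H) simp
  then have "\<epsilon> \<longlonglongrightarrow> 0 + C1 * 0 + 2 * 0 + 2 * 0 / b\<^sub>0\<^sup>2 + 10 * k\<^sub>1\<^sup>2 * 0" unfolding \<epsilon>_def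
    using b0(1) by (intro tendsto_add tendsto_mult[OF tendsto_const] tendsto_divide[OF _ tendsto_const]
      \<eta>0'_lim e1_lim \<tau>_lim \<tau>(2)) auto
  then have "\<epsilon> \<longlonglongrightarrow> 0" by simp
  then have E1: "\<forall>\<^sub>F n in sequentially. \<epsilon> n < e * k\<^sub>0"
    using e(1) k(1) by (intro order_tendstoD) auto
  have E2: "\<forall>\<^sub>F n in sequentially. \<eta>1' n < \<kappa> / 4"
    using \<kappa>(1) by (intro order_tendstoD[OF \<eta>1'_lim]) auto
  have Hsqrt: "(\<lambda>n. H n / sqrt (real n)) \<longlonglongrightarrow> 0" using pw[of 1] by simp
  have "(\<lambda>n. \<bar>C2 * (H n / sqrt (real n))\<bar>) \<longlonglongrightarrow> 0"
    by (rule tendsto_eq_intros Hsqrt refl | simp)+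
  then have E3: "\<forall>\<^sub>F n in sequentially. \<bar>C2 * (H n / sqrt (real n))\<bar> < b\<^sub>0 * (\<kappa> / 10)"
    using \<kappa>(1) b0(1) by (intro order_tendstoD) auto
  have E4: "\<forall>\<^sub>F n in sequentially. H n / sqrt (real n) < \<rho>"
    using \<rho>(1) by (intro order_tendstoD[OF Hsqrt]) auto
  show ?thesis
    using C1 C2 E1 E2 E3 E4 H1 \<eta>0 \<eta>1
  proof eventually_elim
    case (elim n)
    note DG = elim(1) and ST = elim(2) and \<epsilon>n = elim(3) and \<eta>1n = elim(4) and xn = elim(5) and Hn1 = elim(7)
    have \<eta>0n: "\<eta>\<^sub>0 n (H n) \<le> \<eta>0' n" using elim(8) by (simp add: \<eta>0'_def)
    have \<eta>1n: "\<eta>\<^sub>1 n (H n) \<le> \<kappa> / 4"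
    proof -
      have "\<eta>1' n = C * H n ^ 7 / sqrt (real n) + C * H n ^ 4 * exp (- c * H n ^ 2)"
        by (simp add: \<eta>1'_def)
      then show ?thesis using elim(9) \<eta>1n by linarith
    qed
    have Hp: "0 < H n" using Hn1 by simp
    have ball: "base_param M + h / sqrt (real n) \<in> ball (base_param M) \<rho>" if "h \<in> {-H n..H n}" for h
    proof -
      have "\<bar>h\<bar> / sqrt (real n) \<le> H n / sqrt (real n)" using that by (intro divide_right_mono) auto
      then show ?thesis using elim(6) by (simp add: dist_norm)
    qed
    have fin: "target_minimax_risk M n (H n) q (ereal v) < \<infinity>" if "q \<in> contexts M" "v \<in> near_levels M \<delta> q" for q v
      using that ball \<rho> by (intro target_minimax_risk_finite[OF ch _ near_levels_available \<rho>(2)]) auto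
    \<comment> \<open>\<open>v\<^sub>0\<close> is the level at which the prior is least favorable.
      Both ends of the interval are allowed, since the upper and the lower bound on the increment
      use different priors.\<close>
    have slope: "(1 - \<kappa>) * (target_slope M q)\<^sup>2 * (v - oracle_level M q) \<le> target_bayes_risk M n q \<pi> v - target_bayes_risk M n q \<pi> (oracle_level M q)"
        "target_bayes_risk M n q \<pi> v - target_bayes_risk M n q \<pi> (oracle_level M q) \<le> (1 + \<kappa>) * (target_slope M q)\<^sup>2 * (v - oracle_level M q)"
      if q: "q \<in> contexts M" and v: "v \<in> near_levels M \<delta> q" and v\<tau>: "v - oracle_level M q \<le> \<tau> n"
        and \<pi>: "\<pi> \<in> priors (H n)" and v0: "v\<^sub>0 = v \<or> v\<^sub>0 = oracle_level M q"
        and max: "\<And>\<pi>'. \<pi>' \<in> priors (H n) \<Longrightarrow> target_bayes_risk M n q \<pi>' v\<^sub>0 \<le> target_bayes_risk M n q \<pi> v\<^sub>0"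
      for q v \<pi> v\<^sub>0
    proof -
      let ?S = "near_levels M \<delta> q" and ?b = "target_slope M q" and ?o = "oracle_level M q"
      have vo: "?o \<le> v" "{?o..v} \<subseteq> ?S" using v by (auto simp: near_levels_def)
      have SK: "k\<^sub>0 \<le> u \<and> u \<le> k\<^sub>1" if "u \<in> ?S" for u using K(3) q that k(2) by blast
      have v0S: "v\<^sub>0 \<in> {?o..v}" using v0 vo by auto
      have "\<exists>D. (target_bayes_risk M n q \<pi> has_real_derivative D) (at u within ?S) \<and> (1 - \<kappa>) * ?b\<^sup>2 \<le> D \<and> D \<le> (1 + \<kappa>) * ?b\<^sup>2"
        if u: "u \<in> {?o..v}" for u
      proof -
        have uS: "u \<in> ?S" using u vo by blast
        have "u - (\<tau> n + C1 * H n ^ 4 * \<tau> n + 2 * \<eta>\<^sub>0 n (H n) + 2 * e1 n / b\<^sub>0\<^sup>2 + 10 * v\<^sub>0\<^sup>2 / (H n)\<^sup>2) \<le> enn2real (gaussian_bayes_risk u \<pi>)"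
        proof (rule gaussian_risk_lower[where S="?S" and r="shift_bayes_risk M n q" and g="target_bayes_risk M n q" and b="?b"])
          show "convex ?S" by (simp add: near_levels_def)
          show "\<And>v. v \<in> ?S \<Longrightarrow> 0 < v" using SK k(1) by force
          show "\<And>v \<pi>. v \<in> ?S \<Longrightarrow> \<pi> \<in> priors (H n) \<Longrightarrow> \<bar>shift_bayes_risk M n q \<pi> v - enn2real (gaussian_bayes_risk v \<pi>)\<bar> \<le> \<eta>\<^sub>0 n (H n)"
            using DG q by blast
          show "\<And>v \<pi>. v \<in> ?S \<Longrightarrow> \<pi> \<in> priors (H n) \<Longrightarrow> \<exists>D. (shift_bayes_risk M n q \<pi> has_real_derivative D) (at v within ?S) \<and> 0 \<le> D \<and> D \<le> C1 * H n ^ 4"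
            using DG q by blast
          show "\<And>v \<pi>. v \<in> ?S \<Longrightarrow> \<pi> \<in> priors (H n) \<Longrightarrow> \<bar>target_bayes_risk M n q \<pi> v - ?b\<^sup>2 * shift_bayes_risk M n q \<pi> v\<bar> \<le> e1 n"
            using ST q unfolding e1_def by blast
          show "\<bar>u - v\<^sub>0\<bar> \<le> \<tau> n" using u v0S v\<tau> by (auto simp: abs_le_iff)
        qed (use Hp b0 q \<pi> max v0S vo uS in auto)
        moreover have "10 * v\<^sub>0\<^sup>2 / (H n)\<^sup>2 \<le> 10 * k\<^sub>1\<^sup>2 * inverse ((H n)\<^sup>2)"
        proof -
          have "v\<^sub>0\<^sup>2 \<le> k\<^sub>1\<^sup>2" using SK[of v\<^sub>0] v0S vo k(1) by (intro power_mono) auto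
          then show ?thesis unfolding divide_inverse by (intro mult_right_mono mult_left_mono) auto
        qed
        ultimately have "u - \<epsilon> n \<le> enn2real (gaussian_bayes_risk u \<pi>)"
          using \<eta>0n unfolding \<epsilon>_def mult.assoc[of C1] by linarith
        moreover have "e * k\<^sub>0 \<le> e * u" using SK[OF uS] e(1) by (intro mult_left_mono) auto
        ultimately have "u * (1 - e) \<le> enn2real (gaussian_bayes_risk u \<pi>)"
          using \<epsilon>n by (simp add: right_diff_distrib mult.commute)
        then have W: "\<bar>gaussian_expectation u \<pi> (\<lambda>y. (gaussian_posterior_variance u \<pi> y / u)\<^sup>2) - 1\<bar> \<le> \<kappa> / 4"
          using \<pi> SK[OF uS] k(1) by (intro e(2)) auto
        obtain D where D: "(shift_bayes_risk M n q \<pi> has_real_derivative D) (at u within ?S)"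
          "\<bar>D - gaussian_expectation u \<pi> (\<lambda>y. (gaussian_posterior_variance u \<pi> y / u)\<^sup>2)\<bar> \<le> \<eta>\<^sub>1 n (H n)"
          using DG q uS \<pi> by blast
        obtain Dh Dp where Dp: "(shift_bayes_risk M n q \<pi> has_real_derivative Dh) (at u within ?S)"
          "(target_bayes_risk M n q \<pi> has_real_derivative Dp) (at u within ?S)"
          "(max 0 (\<bar>?b\<bar> - C2 * H n / sqrt (real n)))\<^sup>2 * Dh \<le> Dp" "Dp \<le> (\<bar>?b\<bar> + C2 * H n / sqrt (real n))\<^sup>2 * Dh"
          using ST q uS \<pi> by blast
        \<comment> \<open>\<open>D\<close> is close to the Gaussian functional, \<open>Dh\<close> is
          tied to the derivative of the target risk; only their equality connects the two
          assumptions.\<close>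
        have "Dh = D"
          using DERIV_within_Icc_unique[OF Dp(1)[unfolded near_levels_def] D(1)[unfolded near_levels_def]] \<delta> uS
          by (simp add: near_levels_def)
        then have "\<bar>Dh - 1\<bar> \<le> \<kappa> / 2" using D(2) W \<eta>1n by linarith
        from slope_factor_bounds[OF \<kappa> b0(1) b0(2)[OF q] _ this Dp(3,4)] xn Dp(2)
        show ?thesis by auto
      qed
      from mean_value_Icc[OF vo this]
      show "(1 - \<kappa>) * ?b\<^sup>2 * (v - ?o) \<le> target_bayes_risk M n q \<pi> v - target_bayes_risk M n q \<pi> ?o"
        "target_bayes_risk M n q \<pi> v - target_bayes_risk M n q \<pi> ?o \<le> (1 + \<kappa>) * ?b\<^sup>2 * (v - ?o)" by auto
    qed
    have incr: "(1 - \<kappa>) * (target_slope M q)\<^sup>2 * (v - oracle_level M q)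
          \<le> enn2real (target_minimax_risk M n (H n) q (ereal v)) - enn2real (target_minimax_risk M n (H n) q (ereal (oracle_level M q))) \<and>
        enn2real (target_minimax_risk M n (H n) q (ereal v)) - enn2real (target_minimax_risk M n (H n) q (ereal (oracle_level M q)))
          \<le> (1 + \<kappa>) * (target_slope M q)\<^sup>2 * (v - oracle_level M q)"
      if q: "q \<in> contexts M" and v: "v \<in> near_levels M \<delta> q" and v\<tau>: "v - oracle_level M q \<le> \<tau> n" for q v
    proof -
      let ?o = "oracle_level M q"
      have o: "?o \<in> near_levels M \<delta> q" using \<delta> by (simp add: near_levels_def)
      have LF: "\<exists>\<pi>\<in>priors (H n). target_bayes_risk M n q \<pi> w = enn2real (target_minimax_risk M n (H n) q (ereal w)) \<and>
          (\<forall>\<pi>'\<in>priors (H n). target_bayes_risk M n q \<pi>' w \<le> enn2real (target_minimax_risk M n (H n) q (ereal w)))"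
        if w: "w \<in> near_levels M \<delta> q" for w
      proof -
        have "minimax_attained (local_expt M n q (ereal w)) (local_target M n q) (H n)" using ST q w by blast
        from minimax_attained_least_favorable[OF this fin[OF q w, unfolded target_minimax_risk_def]]
        show ?thesis unfolding target_bayes_risk_def target_minimax_risk_def by metis
      qed
      obtain \<pi> where \<pi>: "\<pi> \<in> priors (H n)" "target_bayes_risk M n q \<pi> v = enn2real (target_minimax_risk M n (H n) q (ereal v))"
          "\<forall>\<pi>'\<in>priors (H n). target_bayes_risk M n q \<pi>' v \<le> enn2real (target_minimax_risk M n (H n) q (ereal v))"
        using LF[OF v] by blast
      obtain \<pi>o where \<pi>o: "\<pi>o \<in> priors (H n)" "target_bayes_risk M n q \<pi>o ?o = enn2real (target_minimax_risk M n (H n) q (ereal ?o))"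
          "\<forall>\<pi>'\<in>priors (H n). target_bayes_risk M n q \<pi>' ?o \<le> enn2real (target_minimax_risk M n (H n) q (ereal ?o))"
        using LF[OF o] by blast
      \<comment> \<open>Envelope argument: the prior least favorable at \<open>v\<close> attains the
        minimax risk there and lies below it at the oracle level, so its increment dominates the
        minimax increment. The prior least favorable at the oracle level gives the reverse
        inequality.\<close>
      have "target_bayes_risk M n q \<pi> v - target_bayes_risk M n q \<pi> ?o \<le> (1 + \<kappa>) * (target_slope M q)\<^sup>2 * (v - ?o)"
        using \<pi> by (intro slope(2)[OF q v v\<tau> \<pi>(1), of v]) auto
      moreover have "(1 - \<kappa>) * (target_slope M q)\<^sup>2 * (v - ?o) \<le> target_bayes_risk M n q \<pi>o v - target_bayes_risk M n q \<pi>o ?o"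
        using \<pi>o by (intro slope(1)[OF q v v\<tau> \<pi>o(1), of ?o]) auto
      ultimately show ?thesis using \<pi> \<pi>o bspec[OF \<pi>(3) \<pi>o(1)] bspec[OF \<pi>o(3) \<pi>(1)] by linarith
    qed
    show ?case using Hp ball \<rho>(2) fin incr by (auto simp: less_imp_le)
  qed
qed

section \<open>The frontiers\<close>

lemma menu_level_available:
  assumes ch: "continuous_blackwell_chain M \<delta>" and q: "q \<in> contexts M" and V: "V \<in> menus M k"
  shows "menu_level M V q \<in> available_levels M \<delta> q" "ereal (oracle_level M q) \<le> menu_level M V q"
proof -
  have "finite (level M q ` V)" "level M q ` V \<noteq> {}" and V': "V \<subseteq> actions M"
    using V by (auto simp: menus_def)
  then have "menu_level M V q \<in> level M q ` V" unfolding menu_level_def by (intro Min_in)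
  then obtain a where a: "a \<in> actions M" "menu_level M V q = level M q a" using V' by auto
  then show "menu_level M V q \<in> available_levels M \<delta> q" by (simp add: available_levels_def)
  show "ereal (oracle_level M q) \<le> menu_level M V q"
    using ch q a unfolding continuous_blackwell_chain_def by auto
qed

lemma enn2ereal_finite: "x < \<infinity> \<Longrightarrow> enn2ereal x = ereal (enn2real x)"
  using enn2ereal_ennreal[of "enn2real x"] by simp

text \<open>One factor \<open>1 - \<kappa>\<close> pays for a context at which the supremum in the
  information gap is only approached, the other for the risk increment.\<close>

lemma risk_frontier_lower:
  fixes M :: "('q, 'a, 'x) menu_problem" and H :: real
  assumes ch: "continuous_blackwell_chain M \<delta>" and \<delta>: "0 < \<delta>" and \<kappa>: "0 < \<kappa>" "\<kappa> \<le> 1" and b0: "0 < b\<^sub>0"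
    "\<And>q. q \<in> contexts M \<Longrightarrow> b\<^sub>0 \<le> \<bar>target_slope M q\<bar>"
    and H: "0 \<le> H" "\<And>h. h \<in> {-H..H} \<Longrightarrow> base_param M + h / sqrt (real n) \<in> param_set M"
    and fin: "\<And>q v. q \<in> contexts M \<Longrightarrow> v \<in> near_levels M \<delta> q \<Longrightarrow> target_minimax_risk M n H q (ereal v) < \<infinity>"
    and inc: "\<And>q v. q \<in> contexts M \<Longrightarrow> v \<in> near_levels M \<delta> q \<Longrightarrow> v - oracle_level M q \<le> \<tau> \<Longrightarrow>
        (1 - \<kappa>) * (target_slope M q)\<^sup>2 * (v - oracle_level M q)
          \<le> enn2real (target_minimax_risk M n H q (ereal v)) - enn2real (target_minimax_risk M n H q (ereal (oracle_level M q)))"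
    and \<alpha>: "0 < \<alpha>" "information_frontier M k = ereal \<alpha>" and small: "\<alpha> / b\<^sub>0\<^sup>2 \<le> \<tau>" "\<alpha> / b\<^sub>0\<^sup>2 \<le> \<delta>"
  shows "ereal ((1 - \<kappa>) * ((1 - \<kappa>) * \<alpha>)) \<le> risk_frontier M n k H"
  unfolding risk_frontier_def
proof (rule INF_greatest)
  fix V assume V: "V \<in> menus M k"
  \<comment> \<open>Strictness is what allows a context to be extracted from the supremum; it holds
    because \<open>\<alpha>\<close> is positive.\<close>
  have "ereal ((1 - \<kappa>) * \<alpha>) < ereal \<alpha>" using \<kappa> \<alpha>(1) by simp
  also have "\<dots> \<le> information_gap M V"
    using V \<alpha>(2) unfolding information_frontier_def by (metis INF_lower)
  finally obtain q where q: "q \<in> contexts M"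
    and gap: "ereal ((1 - \<kappa>) * \<alpha>) < ereal ((target_slope M q)\<^sup>2) * (menu_level M V q - ereal (oracle_level M q))"
    unfolding information_gap_def less_SUP_iff by blast
  let ?L = "menu_level M V q" and ?o = "oracle_level M q" and ?b = "target_slope M q"
  let ?R = "target_minimax_risk M n H q"
  have b: "b\<^sub>0\<^sup>2 \<le> ?b\<^sup>2" "0 < b\<^sub>0\<^sup>2" using b0(1) power_mono[OF b0(2)[OF q], of 2] by auto
  then have bp: "0 < ?b\<^sup>2" by linarith
  \<comment> \<open>The increment at which \<open>?b^2 * t\<close> equals
    \<open>(1 - \<kappa>) * \<alpha>\<close>. The level \<open>?o + t\<close> is small enough for
    \<open>inc\<close> and still at most the menu's level, which may be far away or
    infinite.\<close>
  define t where "t = (1 - \<kappa>) * \<alpha> / ?b\<^sup>2"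
  have t0: "0 \<le> t" using \<kappa> \<alpha> by (simp add: t_def)
  have "t \<le> \<alpha> / ?b\<^sup>2" unfolding t_def using \<kappa> \<alpha> by (intro divide_right_mono) (auto simp: mult_le_cancel_right1)
  also have "\<dots> \<le> \<alpha> / b\<^sub>0\<^sup>2" using b bp \<alpha> by (intro divide_left_mono mult_pos_pos) auto
  finally have t: "t \<le> \<tau>" "t \<le> \<delta>" using small by auto
  have v': "?o + t \<in> near_levels M \<delta> q" and o: "?o \<in> near_levels M \<delta> q" using t0 t \<delta> by (auto simp: near_levels_def)
  have "ereal (?o + t) \<le> ?L"
  proof (cases ?L)
    case (real r)
    then have "(1 - \<kappa>) * \<alpha> < (r - ?o) * ?b\<^sup>2" using gap by (simp add: mult.commute)
    then have "t < r - ?o" using bp by (simp add: t_def pos_divide_less_eq)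
    then show ?thesis using real by simp
  qed (use menu_level_available(2)[OF ch q V] in auto)
  then have "?R (ereal (?o + t)) \<le> ?R ?L"
    by (intro target_minimax_risk_mono[OF ch q near_levels_available[OF v'] menu_level_available(1)[OF ch q V] _ H])
  then have "enn2ereal (?R (ereal (?o + t))) - enn2ereal (?R (ereal ?o)) \<le> enn2ereal (?R ?L) - enn2ereal (?R (ereal ?o))"
    by (intro ereal_minus_mono) (auto simp: less_eq_ennreal.rep_eq)
  moreover have "ereal ((1 - \<kappa>) * ((1 - \<kappa>) * \<alpha>)) \<le> enn2ereal (?R (ereal (?o + t))) - enn2ereal (?R (ereal ?o))"
  proof -
    have "(1 - \<kappa>) * ((1 - \<kappa>) * \<alpha>) = (1 - \<kappa>) * ?b\<^sup>2 * ((?o + t) - ?o)"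
      using bp by (simp add: t_def)
    also have "\<dots> \<le> enn2real (?R (ereal (?o + t))) - enn2real (?R (ereal ?o))"
      using t by (intro inc[OF q v']) simp
    finally show ?thesis
      unfolding enn2ereal_finite[OF fin[OF q v']] enn2ereal_finite[OF fin[OF q o]] by simp
  qed
  ultimately have "ereal ((1 - \<kappa>) * ((1 - \<kappa>) * \<alpha>)) \<le> enn2ereal (?R ?L) - enn2ereal (?R (ereal ?o))"
    by (rule order_trans[rotated])
  then show "ereal ((1 - \<kappa>) * ((1 - \<kappa>) * \<alpha>)) \<le> risk_gap M n H V"
    unfolding risk_gap_def using q by (rule SUP_upper2[rotated])
qed

text \<open>A small information gap is small at every context, and as the slopes are bounded below,
  all levels of the menu then lie within \<open>\<beta> / b\<^sub>0^2\<close> of the oracle, where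
  the increment bound applies directly.\<close>

lemma risk_frontier_upper:
  fixes M :: "('q, 'a, 'x) menu_problem" and H :: real
  assumes ch: "continuous_blackwell_chain M \<delta>" and \<delta>: "0 < \<delta>" and \<kappa>: "0 < \<kappa>" and b0: "0 < b\<^sub>0"
    "\<And>q. q \<in> contexts M \<Longrightarrow> b\<^sub>0 \<le> \<bar>target_slope M q\<bar>"
    and fin: "\<And>q v. q \<in> contexts M \<Longrightarrow> v \<in> near_levels M \<delta> q \<Longrightarrow> target_minimax_risk M n H q (ereal v) < \<infinity>"
    and inc: "\<And>q v. q \<in> contexts M \<Longrightarrow> v \<in> near_levels M \<delta> q \<Longrightarrow> v - oracle_level M q \<le> \<tau> \<Longrightarrow>
        enn2real (target_minimax_risk M n H q (ereal v)) - enn2real (target_minimax_risk M n H q (ereal (oracle_level M q)))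
          \<le> (1 + \<kappa>) * (target_slope M q)\<^sup>2 * (v - oracle_level M q)"
    and V: "V \<in> menus M k" and \<beta>: "information_gap M V \<le> ereal \<beta>" and small: "\<beta> / b\<^sub>0\<^sup>2 \<le> \<tau>" "\<beta> / b\<^sub>0\<^sup>2 \<le> \<delta>"
  shows "risk_frontier M n k H \<le> ereal ((1 + \<kappa>) * \<beta>)"
proof -
  have "risk_gap M n H V \<le> ereal ((1 + \<kappa>) * \<beta>)"
    unfolding risk_gap_def
  proof (rule SUP_least)
    fix q assume q: "q \<in> contexts M"
    let ?L = "menu_level M V q" and ?o = "oracle_level M q" and ?b = "target_slope M q"
    let ?R = "target_minimax_risk M n H q"
    have b: "b\<^sub>0\<^sup>2 \<le> ?b\<^sup>2" "0 < b\<^sub>0\<^sup>2" using b0(1) power_mono[OF b0(2)[OF q], of 2] by auto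
    then have bp: "0 < ?b\<^sup>2" by linarith
    have gap: "ereal (?b\<^sup>2) * (?L - ereal ?o) \<le> ereal \<beta>"
      using \<beta> q unfolding information_gap_def by (auto simp: SUP_le_iff)
    \<comment> \<open>An infinite level is excluded: times the positive squared slope it would
      exceed the finite \<open>\<beta>\<close>.\<close>
    obtain r where r: "?L = ereal r" and ro: "?o \<le> r"
      using gap bp menu_level_available(2)[OF ch q V] by (cases ?L) (auto split: if_splits)
    have gr: "?b\<^sup>2 * (r - ?o) \<le> \<beta>" using gap r by simp
    then have "b\<^sub>0\<^sup>2 * (r - ?o) \<le> \<beta>"
      using mult_right_mono[OF b(1), of "r - ?o"] ro by linarith
    then have "r - ?o \<le> \<beta> / b\<^sub>0\<^sup>2" using b(2) by (subst pos_le_divide_eq) (auto simp: mult.commute)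
    then have rt: "r - ?o \<le> \<tau>" "r - ?o \<le> \<delta>" using small by auto
    have rn: "r \<in> near_levels M \<delta> q" and o: "?o \<in> near_levels M \<delta> q" using ro rt \<delta> by (auto simp: near_levels_def)
    have "enn2real (?R (ereal r)) - enn2real (?R (ereal ?o)) \<le> (1 + \<kappa>) * (?b\<^sup>2 * (r - ?o))"
      using inc[OF q rn rt(1)] by (simp add: mult.assoc)
    also have "\<dots> \<le> (1 + \<kappa>) * \<beta>" using \<kappa> gr by (intro mult_left_mono) auto
    finally show "enn2ereal (?R ?L) - enn2ereal (?R (ereal ?o)) \<le> ereal ((1 + \<kappa>) * \<beta>)"
      unfolding r enn2ereal_finite[OF fin[OF q rn]] enn2ereal_finite[OF fin[OF q o]] by simp
  qed
  then show ?thesis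
    unfolding risk_frontier_def using V by (rule INF_lower2[rotated])
qed

section \<open>Real-valued frontiers, the explicit radii and the conclusion\<close>

lemma eventually_ereal_real_pos:
  assumes A: "A \<longlonglongrightarrow> (0::ereal)" and pos: "\<forall>n\<ge>1. 0 < A n"
  shows "\<forall>\<^sub>F n in sequentially. A n = ereal (real_of_ereal (A n)) \<and> 0 < real_of_ereal (A n)"
proof -
  have "\<forall>\<^sub>F n in sequentially. A n < 1" by (rule order_tendstoD(2)[OF A]) simp
  then show ?thesis
    using eventually_ge_at_top[of 1]
  proof eventually_elim
    case (elim n)
    then have "0 < A n" "A n < 1" using pos by auto
    then show ?case by (cases "A n") auto
  qed
qed

text \<open>With these exponents \<open>H^10 * \<alpha>\<close> is at most the square root of
  \<open>\<alpha>\<close>, and \<open>H^11 / sqrt n\<close> is at most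
  \<open>n powr (- 1/4)\<close>.\<close>

lemma admissible_radii_explicit:
  assumes A: "A \<longlonglongrightarrow> (0::ereal)" and pos: "\<forall>n\<ge>1. 0 < A n"
  shows "admissible_radii A (\<lambda>n. min (real_of_ereal (A n) powr (- (1/20))) (real n powr (1/44)))"
proof -
  define \<alpha> where "\<alpha> n = real_of_ereal (A n)" for n
  define H where "H n = min (\<alpha> n powr (- (1/20))) (real n powr (1/44))" for n
  have \<alpha>0: "\<alpha> \<longlonglongrightarrow> 0" unfolding \<alpha>_def[abs_def] using A by (intro lim_real_of_ereal) (simp add: zero_ereal_def)
  have A\<alpha>: "\<forall>\<^sub>F n in sequentially. A n = ereal (\<alpha> n) \<and> 0 < \<alpha> n"
    unfolding \<alpha>_def by (rule eventually_ereal_real_pos[OF A pos])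
  have "filterlim \<alpha> (at_right 0) sequentially"
    unfolding filterlim_at using \<alpha>0 A\<alpha> by (auto elim!: eventually_mono)
  moreover have "filterlim (\<lambda>x::real. x powr (- (1/20))) at_top (at_right 0)" by real_asymp
  ultimately have l1: "filterlim (\<lambda>n. \<alpha> n powr (- (1/20))) at_top sequentially"
    using filterlim_compose by blast
  have l2: "filterlim (\<lambda>n. real n powr (1/44)) at_top sequentially" by real_asymp
  have H: "filterlim H at_top sequentially"
    unfolding H_def[abs_def] filterlim_at_top
  proof
    fix Z :: real
    show "\<forall>\<^sub>F n in sequentially. Z \<le> min (\<alpha> n powr (- (1/20))) (real n powr (1/44))"
      using l1[unfolded filterlim_at_top, rule_format, of Z] l2[unfolded filterlim_at_top, rule_format, of Z]
      by eventually_elim simp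
  qed
  have H11: "(\<lambda>n. H n ^ 11 / sqrt (real n)) \<longlonglongrightarrow> 0"
  proof (rule tendsto_sandwich[OF _ _ tendsto_const])
    show "\<forall>\<^sub>F n in sequentially. 0 \<le> H n ^ 11 / sqrt (real n)" by (simp add: H_def)
    show "\<forall>\<^sub>F n in sequentially. H n ^ 11 / sqrt (real n) \<le> (real n powr (1/44)) ^ 11 / sqrt (real n)"
      by (intro always_eventually allI divide_right_mono power_mono) (auto simp: H_def)
    show "(\<lambda>n. (real n powr (1/44)) ^ 11 / sqrt (real n)) \<longlonglongrightarrow> 0" by real_asymp
  qed
  have H10: "(\<lambda>n. H n ^ 10 * \<alpha> n) \<longlonglongrightarrow> 0"
  proof (rule tendsto_sandwich[OF _ _ tendsto_const])
    show "\<forall>\<^sub>F n in sequentially. 0 \<le> H n ^ 10 * \<alpha> n"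
      using A\<alpha> by eventually_elim (simp add: H_def)
    show "\<forall>\<^sub>F n in sequentially. H n ^ 10 * \<alpha> n \<le> sqrt (\<alpha> n)"
      using A\<alpha>
    proof eventually_elim
      case (elim n)
      have "H n ^ 10 * \<alpha> n \<le> (\<alpha> n powr (- (1/20))) ^ 10 * \<alpha> n"
        using elim by (intro mult_right_mono power_mono) (auto simp: H_def)
      also have "(\<alpha> n powr (- (1/20))) ^ 10 = \<alpha> n powr (- (1/2))"
        using elim by (simp add: powr_realpow[symmetric] powr_powr)
      also have "\<alpha> n powr (- (1/2)) * \<alpha> n = \<alpha> n powr (- (1/2)) * \<alpha> n powr 1" using elim by simp
      also have "\<dots> = sqrt (\<alpha> n)" using elim by (simp only: powr_add[symmetric]) (simp add: powr_half_sqrt)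
      finally show ?case .
    qed
    show "(\<lambda>n. sqrt (\<alpha> n)) \<longlonglongrightarrow> 0" using tendsto_real_sqrt[OF \<alpha>0] by simp
  qed
  have "(\<lambda>n. ereal (H n ^ 10 * \<alpha> n)) \<longlonglongrightarrow> 0"
    using H10 by (simp add: zero_ereal_def)
  then have "(\<lambda>n. ereal (H n ^ 10) * A n) \<longlonglongrightarrow> 0"
    by (rule Lim_transform_eventually) (use A\<alpha> in \<open>eventually_elim, simp\<close>)
  with H H11 show ?thesis unfolding admissible_radii_def H_def[abs_def] \<alpha>_def by simp
qed

theorem theorem4p8:
  fixes M :: "('q::topological_space, 'a, 'x) menu_problem"
    and \<delta> :: real and K :: "real set" and k :: "nat \<Rightarrow> nat"
  assumes "compact (contexts M)"
    and "0 < \<delta>"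
    and "continuous_blackwell_chain M \<delta>"
    and "compact K" and "K \<subseteq> {0<..}"
    and "\<forall>q\<in>contexts M. near_levels M \<delta> q \<subseteq> K"
    and "information_frontier M \<longlonglongrightarrow> 0"
    and "\<exists>\<epsilon>::nat \<Rightarrow> real. \<epsilon> \<longlonglongrightarrow> 0 \<and>
           (\<forall>j\<ge>1. \<exists>V\<in>menus M j. information_gap M V \<le> information_frontier M j * ereal (1 + \<epsilon> j))"
    and "filterlim k at_top sequentially"
    and "\<forall>n\<ge>1. 0 < information_frontier M (k n)"
  shows "(\<forall>H \<eta>\<^sub>0 \<eta>\<^sub>1 C c.
            admissible_radii (\<lambda>n. information_frontier M (k n)) H \<longrightarrow>
            differentiated_gaussian_transfer M \<delta> H \<eta>\<^sub>0 \<eta>\<^sub>1 \<longrightarrow>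
            smooth_target_transfer M \<delta> H \<longrightarrow>
            0 < C \<longrightarrow> 0 < c \<longrightarrow>
            (\<forall>\<^sub>F n in sequentially.
               \<eta>\<^sub>0 n (H n) \<le> C * H n ^ 5 / sqrt (real n) + C * H n ^ 2 * exp (- c * H n ^ 2)) \<longrightarrow>
            (\<forall>\<^sub>F n in sequentially.
               \<eta>\<^sub>1 n (H n) \<le> C * H n ^ 7 / sqrt (real n) + C * H n ^ 4 * exp (- c * H n ^ 2)) \<longrightarrow>
            (\<exists>\<epsilon>::nat \<Rightarrow> real. \<epsilon> \<longlonglongrightarrow> 0 \<and>
               (\<forall>\<^sub>F n in sequentially.
                  risk_frontier M n (k n) (H n) = information_frontier M (k n) * ereal (1 + \<epsilon> n))))
       \<and> admissible_radii (\<lambda>n. information_frontier M (k n))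
            (\<lambda>n. min (real_of_ereal (information_frontier M (k n)) powr (- (1/20))) (real n powr (1/44)))"
proof (intro conjI allI impI)
  have A: "(\<lambda>n. information_frontier M (k n)) \<longlonglongrightarrow> 0"
    using assms(7,9) by (rule filterlim_compose)
  then show "admissible_radii (\<lambda>n. information_frontier M (k n))
      (\<lambda>n. min (real_of_ereal (information_frontier M (k n)) powr (- (1/20))) (real n powr (1/44)))"
    using assms(10) by (rule admissible_radii_explicit)
  fix H \<eta>\<^sub>0 \<eta>\<^sub>1 C c
  assume adm: "admissible_radii (\<lambda>n. information_frontier M (k n)) H"
    and dgt: "differentiated_gaussian_transfer M \<delta> H \<eta>\<^sub>0 \<eta>\<^sub>1" and stt: "smooth_target_transfer M \<delta> H"
    and "0 < C" and c: "0 < c"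
    and \<eta>0: "\<forall>\<^sub>F n in sequentially. \<eta>\<^sub>0 n (H n) \<le> C * H n ^ 5 / sqrt (real n) + C * H n ^ 2 * exp (- c * H n ^ 2)"
    and \<eta>1: "\<forall>\<^sub>F n in sequentially. \<eta>\<^sub>1 n (H n) \<le> C * H n ^ 7 / sqrt (real n) + C * H n ^ 4 * exp (- c * H n ^ 2)"
  have Hlim: "filterlim H at_top sequentially" and H11: "(\<lambda>n. H n ^ 11 / sqrt (real n)) \<longlonglongrightarrow> 0"
    and H10: "(\<lambda>n. ereal (H n ^ 10) * information_frontier M (k n)) \<longlonglongrightarrow> 0"
    using adm by (auto simp: admissible_radii_def)
  define \<alpha> where "\<alpha> n = real_of_ereal (information_frontier M (k n))" for n
  have \<alpha>_lim: "\<alpha> \<longlonglongrightarrow> 0" unfolding \<alpha>_def[abs_def] using A by (intro lim_real_of_ereal) (simp add: zero_ereal_def)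
  have A\<alpha>: "\<forall>\<^sub>F n in sequentially. information_frontier M (k n) = ereal (\<alpha> n) \<and> 0 < \<alpha> n"
    unfolding \<alpha>_def by (rule eventually_ereal_real_pos[OF A assms(10)])
  obtain b\<^sub>0 where b0: "0 < b\<^sub>0" "\<And>q. q \<in> contexts M \<Longrightarrow> b\<^sub>0 \<le> \<bar>target_slope M q\<bar>"
    using stt unfolding smooth_target_transfer_def by blast
  obtain \<xi> :: "nat \<Rightarrow> real" where \<xi>: "\<xi> \<longlonglongrightarrow> 0"
    "\<And>j. 1 \<le> j \<Longrightarrow> \<exists>V\<in>menus M j. information_gap M V \<le> information_frontier M j * ereal (1 + \<xi> j)"
    using assms(8) by blast
  have \<xi>k: "(\<lambda>n. \<xi> (k n)) \<longlonglongrightarrow> 0" using \<xi>(1) assms(9) by (rule filterlim_compose)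
  have k1: "\<forall>\<^sub>F n in sequentially. 1 \<le> k n" using assms(9) by (simp add: filterlim_at_top)
  have H1: "\<forall>\<^sub>F n in sequentially. 1 \<le> H n" using Hlim by (simp add: filterlim_at_top)
  \<comment> \<open>The factor 2 makes room for \<open>\<alpha> * (1 + \<kappa>)\<close> with
    \<open>\<kappa> \<le> 1\<close>; the absolute value makes \<open>\<tau>\<close> nonnegative for
    every \<open>n\<close>, not just eventually.\<close>
  define \<tau> where "\<tau> n = 2 * \<bar>\<alpha> n\<bar> / b\<^sub>0\<^sup>2" for n
  have \<tau>0: "0 \<le> \<tau> n" for n by (simp add: \<tau>_def)
  have "(\<lambda>n. 2 * \<bar>\<alpha> n\<bar> / b\<^sub>0\<^sup>2) \<longlonglongrightarrow> 2 * \<bar>0\<bar> / b\<^sub>0\<^sup>2"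
    using b0(1) by (intro tendsto_intros \<alpha>_lim) auto
  then have "\<tau> \<longlonglongrightarrow> 0" by (simp add: \<tau>_def[abs_def])
  then have \<tau>\<delta>: "\<forall>\<^sub>F n in sequentially. \<tau> n < \<delta>" using assms(2) by (intro order_tendstoD) auto
  have \<alpha>H10: "(\<lambda>n. H n ^ 10 * \<alpha> n) \<longlonglongrightarrow> 0"
  proof -
    have "(\<lambda>n. ereal (H n ^ 10 * \<alpha> n)) \<longlonglongrightarrow> 0"
      using H10 by (rule Lim_transform_eventually) (use A\<alpha> in \<open>eventually_elim, simp\<close>)
    then show ?thesis by (simp add: zero_ereal_def)
  qed
  have "(\<lambda>n. H n ^ 4 * \<tau> n) \<longlonglongrightarrow> 0"
  proof (rule tendsto_sandwich[OF _ _ tendsto_const])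
    have "(\<lambda>n. 2 / b\<^sub>0\<^sup>2 * (H n ^ 10 * \<alpha> n)) \<longlonglongrightarrow> 2 / b\<^sub>0\<^sup>2 * 0" by (intro tendsto_mult tendsto_const \<alpha>H10)
    then show "(\<lambda>n. 2 / b\<^sub>0\<^sup>2 * (H n ^ 10 * \<alpha> n)) \<longlonglongrightarrow> 0" by simp
    show "\<forall>\<^sub>F n in sequentially. 0 \<le> H n ^ 4 * \<tau> n" using \<tau>0 by simp
    show "\<forall>\<^sub>F n in sequentially. H n ^ 4 * \<tau> n \<le> 2 / b\<^sub>0\<^sup>2 * (H n ^ 10 * \<alpha> n)"
      using A\<alpha> H1
    proof eventually_elim
      case (elim n)
      have "H n ^ 4 * \<tau> n \<le> H n ^ 10 * \<tau> n"
        using elim \<tau>0 by (intro mult_right_mono power_increasing) auto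
      then show ?case using elim by (simp add: \<tau>_def mult.commute mult.left_commute)
    qed
  qed
  note incr = risk_increment[OF assms(3,2,4,5,6) Hlim H11 dgt stt c \<eta>0 \<eta>1 \<tau>0 this]
  define F where "F n = risk_frontier M n (k n) (H n)" for n
  have bounds: "\<forall>\<^sub>F n in sequentially. ereal ((1 - \<kappa>) * ((1 - \<kappa>) * \<alpha> n)) \<le> F n \<and> F n \<le> ereal ((1 + \<kappa>) * (\<alpha> n * (1 + \<kappa>)))"
    if \<kappa>: "0 < \<kappa>" "\<kappa> \<le> 1" for \<kappa>
  proof -
    have "\<forall>\<^sub>F n in sequentially. \<xi> (k n) < \<kappa>" using \<xi>k \<kappa>(1) by (intro order_tendstoD) auto
    then show ?thesis
      using incr[OF \<kappa>] A\<alpha> k1 \<tau>\<delta>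
    proof eventually_elim
      case (elim n)
      note INC = elim(2) and \<alpha> = elim(3)
      have fin: "target_minimax_risk M n (H n) q (ereal v) < \<infinity>" if "q \<in> contexts M" "v \<in> near_levels M \<delta> q" for q v
        using INC that by blast
      have \<alpha>b: "\<alpha> n / b\<^sub>0\<^sup>2 \<le> \<tau> n" "\<alpha> n * (1 + \<kappa>) / b\<^sub>0\<^sup>2 \<le> \<tau> n"
      proof -
        have "\<alpha> n * (1 + \<kappa>) \<le> \<alpha> n * 2" using \<kappa> \<alpha> by (intro mult_left_mono) auto
        then show "\<alpha> n / b\<^sub>0\<^sup>2 \<le> \<tau> n" "\<alpha> n * (1 + \<kappa>) / b\<^sub>0\<^sup>2 \<le> \<tau> n"
          using \<alpha> unfolding \<tau>_def by (intro divide_right_mono; simp)+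
      qed
      have "ereal ((1 - \<kappa>) * ((1 - \<kappa>) * \<alpha> n)) \<le> F n"
        unfolding F_def
      proof (rule risk_frontier_lower[where \<tau>="\<tau> n", OF assms(3,2) \<kappa> b0])
        show "\<alpha> n / b\<^sub>0\<^sup>2 \<le> \<delta>" using \<alpha>b(1) elim(5) by linarith
      qed (use INC \<alpha> fin \<alpha>b in auto)
      moreover obtain V where V: "V \<in> menus M (k n)" "information_gap M V \<le> information_frontier M (k n) * ereal (1 + \<xi> (k n))"
        using \<xi>(2)[OF elim(4)] by blast
      moreover have "information_frontier M (k n) * ereal (1 + \<xi> (k n)) \<le> ereal (\<alpha> n * (1 + \<kappa>))"
        using \<alpha> elim(1) by (simp add: mult_left_mono)
      ultimately have gap: "information_gap M V \<le> ereal (\<alpha> n * (1 + \<kappa>))" by (meson order_trans)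
      have "F n \<le> ereal ((1 + \<kappa>) * (\<alpha> n * (1 + \<kappa>)))"
        unfolding F_def
      proof (rule risk_frontier_upper[where \<tau>="\<tau> n", OF assms(3,2) \<kappa>(1) b0 _ _ V(1) gap])
        show "\<alpha> n * (1 + \<kappa>) / b\<^sub>0\<^sup>2 \<le> \<delta>" using \<alpha>b(2) elim(5) by linarith
      qed (use INC fin \<alpha>b in auto)
      with \<open>ereal ((1 - \<kappa>) * ((1 - \<kappa>) * \<alpha> n)) \<le> F n\<close> show ?case ..
    qed
  qed
  define \<epsilon> where "\<epsilon> n = real_of_ereal (F n) / \<alpha> n - 1" for n
  have "\<epsilon> \<longlonglongrightarrow> 0"
  proof (rule LIMSEQ_I)
    fix r :: real assume r: "0 < r"
    \<comment> \<open>Both \<open>(1 + \<kappa>)^2\<close> and \<open>(1 - \<kappa>)^2\<close>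
      differ from 1 by at most \<open>3 * \<kappa>\<close>, which is below
      \<open>4 * \<kappa> \<le> r\<close>.\<close>
    define \<kappa> where "\<kappa> = min 1 (r / 4)"
    have \<kappa>: "0 < \<kappa>" "\<kappa> \<le> 1" "4 * \<kappa> \<le> r" using r by (auto simp: \<kappa>_def)
    have "\<forall>\<^sub>F n in sequentially. norm (\<epsilon> n - 0) < r"
      using bounds[OF \<kappa>(1,2)] A\<alpha>
    proof eventually_elim
      case (elim n)
      then obtain f where f: "F n = ereal f" by (cases "F n") auto
      have "(1 - \<kappa>) * (1 - \<kappa>) \<le> f / \<alpha> n" "f / \<alpha> n \<le> (1 + \<kappa>) * (1 + \<kappa>)"
        using elim f by (auto simp: pos_le_divide_eq pos_divide_le_eq mult.assoc mult.left_commute mult.commute)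
      moreover have "\<kappa> * \<kappa> \<le> \<kappa> * 1" "0 < \<kappa> * \<kappa>" using \<kappa> by (auto intro: mult_left_mono)
      moreover have "(1 - \<kappa>) * (1 - \<kappa>) = 1 - 2 * \<kappa> + \<kappa> * \<kappa>" "(1 + \<kappa>) * (1 + \<kappa>) = 1 + 2 * \<kappa> + \<kappa> * \<kappa>"
        by (simp_all add: algebra_simps)
      ultimately have "f / \<alpha> n - 1 < r" "- r < f / \<alpha> n - 1" using \<kappa> by linarith+
      then show ?case by (simp add: \<epsilon>_def f abs_less_iff)
    qed
    then show "\<exists>no. \<forall>n\<ge>no. norm (\<epsilon> n - 0) < r" by (simp add: eventually_sequentially)
  qed
  \<comment> \<open>Here \<open>\<kappa> = 1\<close> only provides that \<open>F n\<close> is a real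
    number, so that the ratio defining \<open>\<epsilon>\<close> can be multiplied back.\<close>
  moreover have "\<forall>\<^sub>F n in sequentially. risk_frontier M n (k n) (H n) = information_frontier M (k n) * ereal (1 + \<epsilon> n)"
    using bounds[OF zero_less_one order_refl] A\<alpha>
  proof eventually_elim
    case (elim n)
    then obtain f where "F n = ereal f" by (cases "F n") auto
    then show ?case using elim by (simp add: \<epsilon>_def F_def[symmetric])
  qed
  ultimately show "\<exists>\<epsilon>::nat \<Rightarrow> real. \<epsilon> \<longlonglongrightarrow> 0 \<and>
      (\<forall>\<^sub>F n in sequentially. risk_frontier M n (k n) (H n) = information_frontier M (k n) * ereal (1 + \<epsilon> n))"
    by blast
qed

end
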